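(* Let $\beta\in(0,1]$ and let $g$ be a fiberwise $\beta$-balanced Riemannian metric on the sphere $S^2$. Then $$L_{min}(g)^2\leq\frac{\pi}{\beta}\,\mathrm{Area}(S^2,g).$$
   Context: $S^2\subset\mathbb{R}^3$ is the unit sphere with round metric $g_0$ induced from Euclidean space. For a Riemannian metric $g$ on $S^2$, $g^*$ denotes the dual metric on $T^*S^2$. Put $\mathcal{R}(g)=\max\{\sqrt{g_0^*(\nu,\nu)}\mid \nu\in T^*S^2,\ g^*(\nu,\nu)=1\}$ and $r(g)=\min\{\sqrt{g_0^*(\nu,\nu)}\mid \nu\in T^*S^2,\ g^*(\nu,\nu)=1\}$. For $\beta\in(0,1]$, $g$ is fiberwise $\beta$-balanced if $(r(g)/\mathcal{R}(g))^2\geq\beta$. $L_{min}(g)$ is the length of the shortest (nonconstant) closed geodesic of $g$, and $\mathrm{Area}(S^2,g)=\int_{S^2}dA_g$. *)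

theory Defs
  imports "HOL-Analysis.Analysis"
begin

section \<open>Smooth maps\<close>

text \<open>\<open>Ck_on k U f\<close> and \<open>smooth_on U f\<close> are meant for open \<open>U\<close>.\<close>

primrec Ck_on ::
  "nat \<Rightarrow> 'a::real_normed_vector set \<Rightarrow> ('a \<Rightarrow> 'b::real_normed_vector) \<Rightarrow> bool" where
  "Ck_on 0 U f \<longleftrightarrow> continuous_on U f"
| "Ck_on (Suc k) U f \<longleftrightarrow>
     (\<forall>x\<in>U. f differentiable (at x)) \<and>
     (\<forall>v. Ck_on k U (\<lambda>x. frechet_derivative f (at x) v))"

definition smooth_on :: "'a::real_normed_vector set \<Rightarrow> ('a \<Rightarrow> 'b::real_normed_vector) \<Rightarrow> bool" where
  "smooth_on U f \<longleftrightarrow> (\<forall>k. Ck_on k U f)"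

definition partial :: "'n::finite \<Rightarrow> (real^'n \<Rightarrow> 'b::real_normed_vector) \<Rightarrow> real^'n \<Rightarrow> 'b" where
  "partial i f x = frechet_derivative f (at x) (axis i 1)"

section \<open>The sphere and Riemannian metrics on it\<close>

text \<open>The tangent space at a point of the sphere is identified with a plane in Euclidean
  three-space, and a cotangent vector with the linear functional on three-space that extends it
  by zero on the normal line.\<close>

abbreviation S2 :: "(real^3) set" where
  "S2 \<equiv> sphere 0 1"

definition tangent_space :: "real^3 \<Rightarrow> (real^3) set" where
  "tangent_space p = {v. v \<bullet> p = 0}"

definition cotangent_space :: "real^3 \<Rightarrow> (real^3 \<Rightarrow> real) set" where
  "cotangent_space p = {\<nu>. linear \<nu> \<and> \<nu> p = 0}"

definition smooth_on_S2 :: "(real^3 \<Rightarrow> 'b::real_normed_vector) \<Rightarrow> bool" where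
  "smooth_on_S2 f \<longleftrightarrow>
     (\<forall>p\<in>S2. \<exists>U F. open U \<and> p \<in> U \<and> smooth_on U F \<and> (\<forall>q\<in>U \<inter> S2. F q = f q))"

definition smooth_vector_field :: "(real^3 \<Rightarrow> real^3) \<Rightarrow> bool" where
  "smooth_vector_field X \<longleftrightarrow> smooth_on_S2 X \<and> (\<forall>p\<in>S2. X p \<in> tangent_space p)"

text \<open>Only the values \<open>g p u v\<close> with \<open>p\<close> on the sphere and \<open>u\<close>, \<open>v\<close> tangent at \<open>p\<close> are
  relevant, here and in everything below.\<close>

type_synonym metric_tensor = "real^3 \<Rightarrow> real^3 \<Rightarrow> real^3 \<Rightarrow> real"

definition riemannian_metric :: "metric_tensor \<Rightarrow> bool" where
  "riemannian_metric g \<longleftrightarrow>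
     (\<forall>p\<in>S2.
        (\<forall>u\<in>tangent_space p. \<forall>v\<in>tangent_space p. g p u v = g p v u) \<and>
        (\<forall>u\<in>tangent_space p. \<forall>v\<in>tangent_space p. \<forall>w\<in>tangent_space p. \<forall>a b.
           g p (a *\<^sub>R u + b *\<^sub>R v) w = a * g p u w + b * g p v w) \<and>
        (\<forall>u\<in>tangent_space p. u \<noteq> 0 \<longrightarrow> g p u u > 0)) \<and>
     (\<forall>X Y. smooth_vector_field X \<and> smooth_vector_field Y \<longrightarrow>
        smooth_on_S2 (\<lambda>p. g p (X p) (Y p)))"

definition round_metric :: metric_tensor where
  "round_metric p u v = u \<bullet> v"

section \<open>The dual metric and fiberwise balanced metrics\<close>

definition sharp :: "metric_tensor \<Rightarrow> real^3 \<Rightarrow> (real^3 \<Rightarrow> real) \<Rightarrow> real^3" where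
  "sharp g p \<nu> = (THE v. v \<in> tangent_space p \<and> (\<forall>w\<in>tangent_space p. g p v w = \<nu> w))"

definition dual_metric ::
  "metric_tensor \<Rightarrow> real^3 \<Rightarrow> (real^3 \<Rightarrow> real) \<Rightarrow> (real^3 \<Rightarrow> real) \<Rightarrow> real" where
  "dual_metric g p \<mu> \<nu> = g p (sharp g p \<mu>) (sharp g p \<nu>)"

definition unit_covector_norms :: "metric_tensor \<Rightarrow> real set" where
  "unit_covector_norms g =
     {sqrt (dual_metric round_metric p \<nu> \<nu>) | p \<nu>.
        p \<in> S2 \<and> \<nu> \<in> cotangent_space p \<and> dual_metric g p \<nu> \<nu> = 1}"

text \<open>The unit cosphere bundle is compact, so for a Riemannian metric the supremum and the
  infimum below are the maximum and the minimum.\<close>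

definition R_max :: "metric_tensor \<Rightarrow> real" where
  "R_max g = Sup (unit_covector_norms g)"

definition r_min :: "metric_tensor \<Rightarrow> real" where
  "r_min g = Inf (unit_covector_norms g)"

definition fiberwise_balanced :: "real \<Rightarrow> metric_tensor \<Rightarrow> bool" where
  "fiberwise_balanced \<beta> g \<longleftrightarrow> (r_min g / R_max g)\<^sup>2 \<ge> \<beta>"

section \<open>Geodesics\<close>

text \<open>By invariance of domain, a local parametrization as defined here is automatically a
  diffeomorphism onto a relatively open subset of the sphere.\<close>

definition local_parametrization :: "(real^2 \<Rightarrow> real^3) \<Rightarrow> (real^2) set \<Rightarrow> bool" where
  "local_parametrization \<phi> U \<longleftrightarrow>
     open U \<and> smooth_on U \<phi> \<and> \<phi> ` U \<subseteq> S2 \<and> inj_on \<phi> U \<and>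
     (\<forall>x\<in>U. inj (frechet_derivative \<phi> (at x)))"

definition coord_metric :: "metric_tensor \<Rightarrow> (real^2 \<Rightarrow> real^3) \<Rightarrow> real^2 \<Rightarrow> real^2^2" where
  "coord_metric g \<phi> x = (\<chi> i j. g (\<phi> x) (partial i \<phi> x) (partial j \<phi> x))"

text \<open>\<open>christoffel g \<phi> k i j x\<close> is the symbol with upper index \<open>k\<close> and lower indices \<open>i\<close>, \<open>j\<close>.\<close>

definition christoffel ::
  "metric_tensor \<Rightarrow> (real^2 \<Rightarrow> real^3) \<Rightarrow> 2 \<Rightarrow> 2 \<Rightarrow> 2 \<Rightarrow> real^2 \<Rightarrow> real" where
  "christoffel g \<phi> k i j x =
     (1/2) * (\<Sum>l\<in>UNIV. matrix_inv (coord_metric g \<phi> x) $ k $ l *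
        (partial i (\<lambda>y. coord_metric g \<phi> y $ j $ l) x
         + partial j (\<lambda>y. coord_metric g \<phi> y $ i $ l) x
         - partial l (\<lambda>y. coord_metric g \<phi> y $ i $ j) x))"

definition velocity :: "(real \<Rightarrow> 'a::real_normed_vector) \<Rightarrow> real \<Rightarrow> 'a" where
  "velocity c t = vector_derivative c (at t)"

definition geodesic :: "metric_tensor \<Rightarrow> (real \<Rightarrow> real^3) \<Rightarrow> bool" where
  "geodesic g c \<longleftrightarrow>
     smooth_on UNIV c \<and> range c \<subseteq> S2 \<and>
     (\<forall>\<phi> U t. local_parametrization \<phi> U \<and> c t \<in> \<phi> ` U \<longrightarrow>
        (let x = (\<lambda>s. inv_into U \<phi> (c s)) in
         \<forall>k. velocity (velocity x) t $ k +
             (\<Sum>i\<in>UNIV. \<Sum>j\<in>UNIV.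
                christoffel g \<phi> k i j (x t) * velocity x t $ i * velocity x t $ j) = 0))"

text \<open>The period \<open>T\<close> need not be minimal: closed geodesics may be iterated.\<close>

definition closed_geodesic :: "metric_tensor \<Rightarrow> (real \<Rightarrow> real^3) \<Rightarrow> real \<Rightarrow> bool" where
  "closed_geodesic g c T \<longleftrightarrow>
     geodesic g c \<and> T > 0 \<and> (\<forall>t. c (t + T) = c t) \<and> \<not> c constant_on UNIV"

definition curve_length :: "metric_tensor \<Rightarrow> (real \<Rightarrow> real^3) \<Rightarrow> real \<Rightarrow> real" where
  "curve_length g c T = integral {0..T} (\<lambda>t. sqrt (g (c t) (velocity c t) (velocity c t)))"

text \<open>The value is \<open>\<infinity>\<close> if there is no closed geodesic; since there is one (Lyusternik and Fet)
  and the infimum is attained, this is the length of the shortest closed geodesic.\<close>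

definition L_min :: "metric_tensor \<Rightarrow> ennreal" where
  "L_min g = Inf {ennreal (curve_length g c T) | c T. closed_geodesic g c T}"

section \<open>Area\<close>

text \<open>The value of the Riemannian area density \<open>dA\<^sub>g\<close> at \<open>p\<close> on the tangent vectors \<open>u\<close>, \<open>v\<close>.\<close>

definition area_density :: "metric_tensor \<Rightarrow> real^3 \<Rightarrow> real^3 \<Rightarrow> real^3 \<Rightarrow> real" where
  "area_density g p u v = sqrt (g p u u * g p v v - (g p u v)\<^sup>2)"

definition spherical_coords :: "real^2 \<Rightarrow> real^3" where
  "spherical_coords x =
     vector [sin (x $ 1) * cos (x $ 2), sin (x $ 1) * sin (x $ 2), cos (x $ 1)]"

text \<open>The integral of \<open>dA\<^sub>g\<close> over the sphere, computed as the integral of its pullback under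
  spherical coordinates (colatitude in \<open>(0,\<pi>)\<close>, longitude in \<open>(0,2\<pi>)\<close>). These
  parametrize the complement of a closed half great circle, which is a null set.\<close>

definition area :: "metric_tensor \<Rightarrow> ennreal" where
  "area g =
     (\<integral>\<^sup>+x\<in>box 0 (vector [pi, 2 * pi]).
        ennreal (area_density g (spherical_coords x)
          (partial 1 spherical_coords x) (partial 2 spherical_coords x)) \<partial>lborel)"

end

theory Submission
  imports Defs
begin

text \<open>The numbers \<open>r = r_min g\<close> and \<open>R = R_max g\<close> are extrema over the whole cosphere bundle, so
  \<open>r\<^sup>2 g\<^sub>0 \<le> g \<le> R\<^sup>2 g\<^sub>0\<close> everywhere. Hence the area is at least \<open>4 \<pi> r\<^sup>2\<close>, and it is enough to find a
  closed geodesic of length at most \<open>2 \<pi> R\<close>, the bound for the \<open>g\<close>-lengths of round circles: then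
  \<open>L\<^sup>2 \<le> 4 \<pi>\<^sup>2 R\<^sup>2 \<le> 4 \<pi>\<^sup>2 r\<^sup>2 / \<beta> \<le> (\<pi> / \<beta>) Area\<close>.

  The geodesic comes from Birkhoff's minimax argument for polygons with \<open>N\<close> vertices and the
  energy \<open>N \<Sum> g(x\<^sub>k)(x\<^sub>k\<^sub>+\<^sub>1 - x\<^sub>k, x\<^sub>k\<^sub>+\<^sub>1 - x\<^sub>k)\<close>, where \<open>g\<close> is extended to a quadratic form on
  three-space. Sweep out the sphere by polygons inscribed in the parallels and move the vertices
  cyclically by small gradient steps. If all polygons became short, the identity of the sphere
  would be null-homotopic; so some polygon keeps its energy between \<open>r\<^sup>2 / 16\<close> and \<open>4 \<pi>\<^sup>2 R\<^sup>2\<close>, and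
  by compactness there is a critical polygon with energy in this range. Critical polygons satisfy a
  discrete momentum equation which bounds the velocities uniformly in \<open>N\<close>, and a limit as
  \<open>N\<close> tends to infinity (along a filter provided by Tychonoff's theorem) is a closed geodesic.
  Since the limit solves the differential equation by construction, no existence theory for
  ordinary differential equations is needed.\<close>

section \<open>Calculus of smooth maps\<close>

text \<open>Chords in three-space replace geodesic arcs, so the energy is a smooth function of
  finitely many points and no geodesic has to exist beforehand. Energy replaces length because it
  also controls the parametrization: the limit has constant energy \<open>e\<close> and period 1,
  hence length \<open>sqrt e\<close>. The constant 4 \<pi>^2 R^2 is \<open>N\<close> times a sum of
  \<open>N\<close> squared chords of Euclidean length at most 2 \<pi> / N, each weighted by R^2; r^2
  / 16 belongs to the diameter 1/4 up to which a polygon counts as short, and it keeps the limit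
  from being constant. The obstacle is compactness as \<open>N\<close> grows: the energy bounds
  velocities in mean square only. But the rate of change of the momentum is quadratic in the
  velocity, so the energy bounds the total variation of the momentum over a period, and with it the
  velocity at every vertex. Giving the normal line the eigenvalue r^2 and making the form constant
  along rays preserves both bounds on the form and makes the normal part of the momentum equation
  explicit.\<close>

lemma Ck_on_cong:
  assumes "open U" "\<And>x. x \<in> U \<Longrightarrow> f x = g x" "Ck_on k U f"
  shows "Ck_on k U g"
  using assms(2,3)
proof (induction k arbitrary: f g)
  case 0
  then show ?case by (auto cong: continuous_on_cong_simp)
next
  case (Suc k)
  have d: "(g has_derivative frechet_derivative f (at x)) (at x)" if "x \<in> U" for x
    using Suc.prems that assms(1)
    by (auto intro: has_derivative_transform_within_open[where f = f and s = U]
        simp: frechet_derivative_works)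
  have "frechet_derivative g (at x) = frechet_derivative f (at x)" if "x \<in> U" for x
    using frechet_derivative_at[OF d[OF that]] by simp
  then have "Ck_on k U (\<lambda>x. frechet_derivative g (at x) v)" for v
    using Suc.IH[of "\<lambda>x. frechet_derivative f (at x) v"] Suc.prems by auto
  then show ?case
    using d by (auto simp: differentiable_def)
qed

lemma Ck_on_SucI:
  assumes "open U" "\<And>x. x \<in> U \<Longrightarrow> (f has_derivative f' x) (at x)"
    and "\<And>v. Ck_on k U (\<lambda>x. f' x v)"
  shows "Ck_on (Suc k) U f"
proof -
  have "Ck_on k U (\<lambda>x. frechet_derivative f (at x) v)" for v
    using assms frechet_derivative_at[OF assms(2)]
    by (intro Ck_on_cong[OF assms(1) _ assms(3)[of v]]) (metis frechet_derivative_at)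
  then show ?thesis
    using assms(2) by (auto simp: differentiable_def)
qed

lemma Ck_on_SucD:
  assumes "Ck_on (Suc k) U f" "x \<in> U"
  shows "(f has_derivative frechet_derivative f (at x)) (at x)"
  using assms by (simp add: frechet_derivative_works)

lemma Ck_on_Suc_imp: "Ck_on (Suc k) U f \<Longrightarrow> Ck_on k U f"
proof (induction k arbitrary: f)
  case 0
  then show ?case
    by (auto intro!: continuous_at_imp_continuous_on differentiable_imp_continuous_within)
next
  case (Suc k)
  then show ?case by (metis Ck_on.simps(2))
qed

lemma Ck_on_imp_continuous_on: "Ck_on k U f \<Longrightarrow> continuous_on U f"
  by (induction k) (use Ck_on_Suc_imp in auto)

lemma Ck_on_subset: "Ck_on k U f \<Longrightarrow> V \<subseteq> U \<Longrightarrow> Ck_on k V f"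
  by (induction k arbitrary: f) (auto intro: continuous_on_subset)

text \<open>Derivatives are taken at points and not within sets, so regularity is a local matter.
  This glues the local extensions that define smoothness on the sphere.\<close>

lemma Ck_on_local:
  assumes "\<And>x. x \<in> U \<Longrightarrow> \<exists>V. open V \<and> x \<in> V \<and> Ck_on k V f"
  shows "Ck_on k U f"
  using assms
proof (induction k arbitrary: f)
  case 0
  then show ?case
    by (metis Ck_on.simps(1) continuous_at_imp_continuous_on continuous_on_eq_continuous_at)
next
  case (Suc k)
  have "\<exists>V. open V \<and> x \<in> V \<and> Ck_on k V (\<lambda>x. frechet_derivative f (at x) v)" if "x \<in> U" for x v
    using Suc.prems[OF that] by auto
  then show ?case
    using Suc by (metis Ck_on.simps(2))
qed

lemma Ck_on_const: "Ck_on k U (\<lambda>x. c)"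
  by (induction k arbitrary: c) auto

lemma Ck_on_linear:
  assumes "open U" "bounded_linear L" "Ck_on k U f"
  shows "Ck_on k U (\<lambda>x. L (f x))"
  using assms(3)
proof (induction k arbitrary: f)
  case 0
  then show ?case
    using assms(2)
    by (simp add: bounded_linear.continuous_on)
next
  case (Suc k)
  show ?case
    by (rule Ck_on_SucI[OF assms(1) bounded_linear.has_derivative[OF assms(2) Ck_on_SucD[OF Suc.prems]]])
       (use Suc in auto)
qed

lemma Ck_on_add:
  assumes "open U" "Ck_on k U f" "Ck_on k U g"
  shows "Ck_on k U (\<lambda>x. f x + g x)"
  using assms(2,3)
proof (induction k arbitrary: f g)
  case 0
  then show ?case by (auto intro: continuous_intros)
next
  case (Suc k)
  show ?case
    by (rule Ck_on_SucI[OF assms(1) has_derivative_add[OF Ck_on_SucD[OF Suc.prems(1)] Ck_on_SucD[OF Suc.prems(2)]]])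
       (use Suc in auto)
qed

lemma Ck_on_sum:
  assumes "open U" "\<And>i. i \<in> I \<Longrightarrow> Ck_on k U (f i)"
  shows "Ck_on k U (\<lambda>x. \<Sum>i\<in>I. f i x)"
  using assms(2)
proof (induction I rule: infinite_finite_induct)
  case (insert i I)
  have "Ck_on k U (\<lambda>x. f i x + (\<Sum>i\<in>I. f i x))"
    by (rule Ck_on_add[OF assms(1)]) (use insert in auto)
  with insert show ?case by simp
qed (auto simp: Ck_on_const)

lemma Ck_on_bilinear:
  assumes "open U" "bounded_bilinear h" "Ck_on k U f" "Ck_on k U g"
  shows "Ck_on k U (\<lambda>x. h (f x) (g x))"
  using assms(3,4)
proof (induction k arbitrary: f g)
  case 0
  then show ?case by (simp add: bounded_bilinear.continuous_on[OF assms(2)])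
next
  case (Suc k)
  have "Ck_on k U (\<lambda>x. h (f x) (frechet_derivative g (at x) v) + h (frechet_derivative f (at x) v) (g x))" for v
    using Suc.prems Suc.prems[THEN Ck_on_Suc_imp] by (intro Ck_on_add[OF assms(1)] Suc.IH) auto
  then show ?case
    by (intro Ck_on_SucI[OF assms(1) bounded_bilinear.FDERIV[OF assms(2) Ck_on_SucD[OF Suc.prems(1)] Ck_on_SucD[OF Suc.prems(2)]]])
       auto
qed

text \<open>The chain rule applies the derivative of \<open>f\<close> in the moving direction Dg(x)
  v, while the induction hypothesis speaks of fixed directions. Expanding that direction in the
  basis of the middle space gives a finite sum of products to which the hypothesis applies.\<close>

lemma Ck_on_compose:
  fixes g :: "'a::real_normed_vector \<Rightarrow> 'b::euclidean_space"
  assumes "open U" "open V" "Ck_on k V f" "Ck_on k U g" "g ` U \<subseteq> V"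
  shows "Ck_on k U (\<lambda>x. f (g x))"
  using assms(3,4)
proof (induction k arbitrary: f)
  case 0
  then show ?case using assms(5) by (auto intro: continuous_on_compose2)
next
  case (Suc k)
  have d: "((\<lambda>x. f (g x)) has_derivative
      (\<lambda>v. \<Sum>b\<in>Basis. (frechet_derivative g (at x) v \<bullet> b) *\<^sub>R frechet_derivative f (at (g x)) b)) (at x)"
    if "x \<in> U" for x
  proof -
    have fd: "(f has_derivative frechet_derivative f (at (g x))) (at (g x))"
      using assms(5) that by (intro Ck_on_SucD[OF Suc.prems(1)]) auto
    then interpret bounded_linear "frechet_derivative f (at (g x))"
      by (rule has_derivative_bounded_linear)
    have D: "((\<lambda>x. f (g x)) has_derivative (\<lambda>v. frechet_derivative f (at (g x)) (frechet_derivative g (at x) v))) (at x)"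
      using has_derivative_compose[OF Ck_on_SucD[OF Suc.prems(2) that] fd] by simp
    have "frechet_derivative f (at (g x)) w =
        (\<Sum>b\<in>Basis. (w \<bullet> b) *\<^sub>R frechet_derivative f (at (g x)) b)" for w
      by (subst (1) euclidean_representation[symmetric]) (simp add: sum scaleR)
    from D this[of "frechet_derivative g (at x) _", THEN ext] show ?thesis
      by (rule back_subst[of "\<lambda>D. ((\<lambda>x. f (g x)) has_derivative D) (at x)"])
  qed
  have gk: "Ck_on k U g" using Ck_on_Suc_imp[OF Suc.prems(2)] .
  show ?case
  proof (rule Ck_on_SucI[OF assms(1) d])
    fix v
    show "Ck_on k U (\<lambda>x. \<Sum>b\<in>Basis. (frechet_derivative g (at x) v \<bullet> b) *\<^sub>R frechet_derivative f (at (g x)) b)"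
    proof (intro Ck_on_sum[OF assms(1)] Ck_on_bilinear[OF assms(1) bounded_bilinear_scaleR])
      fix b :: 'b assume "b \<in> Basis"
      show "Ck_on k U (\<lambda>x. frechet_derivative g (at x) v \<bullet> b)"
        using Suc.prems(2) by (intro Ck_on_linear[OF assms(1) bounded_linear_inner_left]) auto
      show "Ck_on k U (\<lambda>x. frechet_derivative f (at (g x)) b)"
        using Suc.prems(1) gk by (intro Suc.IH) auto
    qed
  qed auto
qed

lemma smooth_on_cong:
  "smooth_on U f \<Longrightarrow> open U \<Longrightarrow> (\<And>x. x \<in> U \<Longrightarrow> f x = g x) \<Longrightarrow> smooth_on U g"
  unfolding smooth_on_def by (auto intro: Ck_on_cong[of U f g])

lemma smooth_on_imp_continuous_on: "smooth_on U f \<Longrightarrow> continuous_on U f"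
  unfolding smooth_on_def by (auto intro: Ck_on_imp_continuous_on)

lemma smooth_on_has_derivative:
  "smooth_on U f \<Longrightarrow> x \<in> U \<Longrightarrow> (f has_derivative frechet_derivative f (at x)) (at x)"
  unfolding smooth_on_def by (rule Ck_on_SucD) auto

lemma smooth_on_frechet_derivative:
  "smooth_on U f \<Longrightarrow> smooth_on U (\<lambda>x. frechet_derivative f (at x) v)"
  unfolding smooth_on_def using Ck_on.simps(2) by blast

lemma smooth_on_subset: "smooth_on U f \<Longrightarrow> V \<subseteq> U \<Longrightarrow> smooth_on V f"
  unfolding smooth_on_def by (auto intro: Ck_on_subset)

lemma smooth_on_const: "smooth_on U (\<lambda>x. c)"
  by (simp add: smooth_on_def Ck_on_const)

lemma smooth_on_linear:
  "open U \<Longrightarrow> bounded_linear L \<Longrightarrow> smooth_on U f \<Longrightarrow> smooth_on U (\<lambda>x. L (f x))"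
  by (simp add: smooth_on_def Ck_on_linear)

lemma smooth_on_add: "open U \<Longrightarrow> smooth_on U f \<Longrightarrow> smooth_on U g \<Longrightarrow> smooth_on U (\<lambda>x. f x + g x)"
  by (simp add: smooth_on_def Ck_on_add)

lemma smooth_on_diff:
  assumes "open U" "smooth_on U f" "smooth_on U g"
  shows "smooth_on U (\<lambda>x. f x - g x)"
  using smooth_on_add[OF assms(1,2) smooth_on_linear[OF assms(1) bounded_linear_minus[OF bounded_linear_ident] assms(3)]]
  by simp

lemma smooth_on_sum:
  "open U \<Longrightarrow> (\<And>i. i \<in> I \<Longrightarrow> smooth_on U (f i)) \<Longrightarrow> smooth_on U (\<lambda>x. \<Sum>i\<in>I. f i x)"
  by (simp add: smooth_on_def Ck_on_sum)

lemma smooth_on_bilinear: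
  "open U \<Longrightarrow> bounded_bilinear h \<Longrightarrow> smooth_on U f \<Longrightarrow> smooth_on U g \<Longrightarrow> smooth_on U (\<lambda>x. h (f x) (g x))"
  by (simp add: smooth_on_def Ck_on_bilinear)

lemma smooth_on_compose:
  fixes g :: "'a::real_normed_vector \<Rightarrow> 'b::euclidean_space"
  shows "open U \<Longrightarrow> open V \<Longrightarrow> smooth_on V f \<Longrightarrow> smooth_on U g \<Longrightarrow> g ` U \<subseteq> V \<Longrightarrow> smooth_on U (\<lambda>x. f (g x))"
  unfolding smooth_on_def by (auto intro: Ck_on_compose[of U V _ f g])

lemma bounded_linear_imp_smooth_on:
  assumes "open U" "bounded_linear L"
  shows "smooth_on U L"
proof -
  have "Ck_on k U L" for k
  proof (cases k)
    case 0
    then show ?thesis using assms by (simp add: linear_continuous_on)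
  next
    case (Suc j)
    show ?thesis unfolding Suc
      by (rule Ck_on_SucI[OF assms(1) bounded_linear_imp_has_derivative[OF assms(2)] Ck_on_const])
  qed
  then show ?thesis by (simp add: smooth_on_def)
qed

lemma Ck_on_inverse: "Ck_on k (-{0}) (inverse :: real \<Rightarrow> real)"
proof (induction k)
  case 0
  then show ?case by (auto intro: continuous_intros)
next
  case (Suc k)
  have o: "open (-{0::real})" by auto
  show ?case
    by (rule Ck_on_SucI[OF o has_derivative_inverse'])
       (use Suc o in \<open>auto intro!: Ck_on_linear[OF o bounded_linear_minus[OF bounded_linear_ident]]
          Ck_on_bilinear[OF o bounded_bilinear_mult] Ck_on_const\<close>)
qed

text \<open>The derivative of s^(-1/2) is -1/2 times its own cube, so the induction never leaves
  products of this one function.\<close>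

lemma Ck_on_inverse_sqrt: "Ck_on k {0<..} (\<lambda>s::real. inverse (sqrt s))"
proof (induction k)
  case 0
  then show ?case by (auto intro!: continuous_intros)
next
  case (Suc k)
  have o: "open {0::real<..}" by auto
  have d: "((\<lambda>s. inverse (sqrt s)) has_derivative
      (\<lambda>v. v * ((-1/2) * (inverse (sqrt x) * (inverse (sqrt x) * inverse (sqrt x)))))) (at x)"
    if "x \<in> {0<..}" for x :: real
    using that by (auto intro!: derivative_eq_intros simp: field_simps fun_eq_iff)
  show ?case
  proof (rule Ck_on_SucI[OF o d])
    fix v :: real
    show "Ck_on k {0<..} (\<lambda>x. v * ((-1/2) * (inverse (sqrt x) * (inverse (sqrt x) * inverse (sqrt x)))))"
      by (intro Ck_on_bilinear[OF o bounded_bilinear_mult] Ck_on_const Suc)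
  qed
qed

text \<open>Away from the origin \<open>sgn\<close> is the radial projection to the unit sphere, the
  device that turns functions on the sphere into functions on an open set.\<close>

lemma smooth_on_sgn: "smooth_on (-{0}) (sgn :: 'a::euclidean_space \<Rightarrow> 'a)"
proof -
  have o: "open (-{0::'a})" by auto
  have id: "smooth_on (-{0}) (\<lambda>x::'a. x)"
    by (rule bounded_linear_imp_smooth_on[OF o bounded_linear_ident])
  have "smooth_on (-{0}) (\<lambda>x::'a. inverse (sqrt (x \<bullet> x)))"
  proof (rule smooth_on_compose[where V = "{0<..}" and f = "\<lambda>s. inverse (sqrt s)", OF o])
    show "smooth_on {0<..} (\<lambda>s. inverse (sqrt s))"
      by (simp add: smooth_on_def Ck_on_inverse_sqrt)
    show "smooth_on (-{0}) (\<lambda>x::'a. x \<bullet> x)"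
      by (rule smooth_on_bilinear[OF o bounded_bilinear_inner id id])
  qed auto
  from smooth_on_bilinear[OF o bounded_bilinear_scaleR this id]
  show ?thesis
    by (rule smooth_on_cong) (auto simp: sgn_div_norm norm_eq_sqrt_inner divide_inverse)
qed

lemma smooth_on_vec:
  fixes f :: "'a::real_normed_vector \<Rightarrow> 'b::euclidean_space^'n"
  assumes "open U" "\<And>i. smooth_on U (\<lambda>x. f x $ i)"
  shows "smooth_on U f"
proof -
  have "smooth_on U (\<lambda>x. \<Sum>i\<in>UNIV. axis i (f x $ i))"
  proof (rule smooth_on_sum[OF assms(1)])
    fix i :: 'n
    have "linear (axis i :: 'b \<Rightarrow> 'b^'n)"
      by (auto intro!: linearI simp: axis_def vec_eq_iff)
    then show "smooth_on U (\<lambda>x. axis i (f x $ i))"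
      using smooth_on_linear[OF assms(1) _ assms(2)] linear_conv_bounded_linear by blast
  qed
  moreover have "(\<Sum>i\<in>UNIV. axis i (w $ i)) = w" for w :: "'b^'n"
    by (simp add: vec_eq_iff axis_def)
  ultimately show ?thesis by simp
qed

lemma smooth_on_component:
  fixes f :: "'a::real_normed_vector \<Rightarrow> 'b::euclidean_space^'n"
  assumes "open U" "smooth_on U f"
  shows "smooth_on U (\<lambda>x. f x $ i)"
  by (rule smooth_on_linear[OF assms(1) bounded_linear_vec_nth assms(2)])

lemma has_vector_derivative_along_line:
  assumes "(f has_derivative D) (at (z + s *\<^sub>R w))"
  shows "((\<lambda>s. f (z + s *\<^sub>R w)) has_vector_derivative D w) (at s)"
proof -
  interpret D: bounded_linear D using assms by (rule has_derivative_bounded_linear)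
  have "((\<lambda>s. z + s *\<^sub>R w) has_derivative (\<lambda>h. h *\<^sub>R w)) (at s)"
    by (auto intro!: derivative_eq_intros)
  from has_derivative_compose[OF this assms] show ?thesis
    by (simp add: has_vector_derivative_def D.scaleR)
qed

lemma has_real_derivative_along_line:
  assumes "(f has_derivative D) (at (z + s *\<^sub>R w))"
  shows "((\<lambda>s. f (z + s *\<^sub>R w)) has_real_derivative D w) (at s)"
  using has_vector_derivative_along_line[OF assms]
  by (simp add: has_real_derivative_iff_has_vector_derivative)

text \<open>The mean value theorem is used twice: along \<open>u\<close> for the increment of
  \<open>f\<close> by \<open>h *\<^sub>R v\<close>, then along \<open>v\<close> for the derivative
  in direction \<open>u\<close>.\<close>

lemma second_difference:
  fixes f :: "'a::real_normed_vector \<Rightarrow> real"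
  assumes f: "smooth_on U f" and h: "h > 0"
    and U: "\<And>s t. 0 \<le> s \<Longrightarrow> s \<le> h \<Longrightarrow> 0 \<le> t \<Longrightarrow> t \<le> h \<Longrightarrow> x + s *\<^sub>R u + t *\<^sub>R v \<in> U"
  obtains s t where "0 \<le> s" "s \<le> h" "0 \<le> t" "t \<le> h"
    "f (x + h *\<^sub>R u + h *\<^sub>R v) - f (x + h *\<^sub>R u) - f (x + h *\<^sub>R v) + f x =
      h\<^sup>2 * frechet_derivative (\<lambda>y. frechet_derivative f (at y) u) (at (x + s *\<^sub>R u + t *\<^sub>R v)) v"
proof -
  let ?d = "\<lambda>y. frechet_derivative f (at y) u"
  have 1: "((\<lambda>s. f (x + s *\<^sub>R u + h *\<^sub>R v) - f (x + s *\<^sub>R u)) has_real_derivative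
      (?d (x + s *\<^sub>R u + h *\<^sub>R v) - ?d (x + s *\<^sub>R u))) (at s)" if "0 \<le> s" "s \<le> h" for s
  proof -
    have "(f has_derivative frechet_derivative f (at (x + s *\<^sub>R u))) (at (x + s *\<^sub>R u))"
      using U[of s 0] that h by (intro smooth_on_has_derivative[OF f]) auto
    moreover have "(f has_derivative frechet_derivative f (at (x + s *\<^sub>R u + h *\<^sub>R v))) (at ((x + h *\<^sub>R v) + s *\<^sub>R u))"
      using smooth_on_has_derivative[OF f U[of s h]] that h by (simp add: algebra_simps)
    ultimately show ?thesis
      using DERIV_diff[OF has_real_derivative_along_line[where z = "x + h *\<^sub>R v"] has_real_derivative_along_line[where z = x], of f _ s u f]
      by (simp add: algebra_simps)
  qed
  from MVT2[OF h 1] obtain s where s: "0 < s" "s < h" and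
    eq1: "f (x + h *\<^sub>R u + h *\<^sub>R v) - f (x + h *\<^sub>R u) - (f (x + h *\<^sub>R v) - f x)
      = h * (?d (x + s *\<^sub>R u + h *\<^sub>R v) - ?d (x + s *\<^sub>R u))"
    by auto
  have 2: "((\<lambda>t. ?d (x + s *\<^sub>R u + t *\<^sub>R v)) has_real_derivative
      frechet_derivative ?d (at (x + s *\<^sub>R u + t *\<^sub>R v)) v) (at t)" if "0 \<le> t" "t \<le> h" for t
    using smooth_on_has_derivative[OF smooth_on_frechet_derivative[OF f] U[of s t]] that s
    by (intro has_real_derivative_along_line) auto
  from MVT2[OF h 2] obtain t where t: "0 < t" "t < h" and
    "?d (x + s *\<^sub>R u + h *\<^sub>R v) - ?d (x + s *\<^sub>R u) = h * frechet_derivative ?d (at (x + s *\<^sub>R u + t *\<^sub>R v)) v"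
    by auto
  with eq1 have "f (x + h *\<^sub>R u + h *\<^sub>R v) - f (x + h *\<^sub>R u) - f (x + h *\<^sub>R v) + f x =
      h\<^sup>2 * frechet_derivative ?d (at (x + s *\<^sub>R u + t *\<^sub>R v)) v"
    by (simp add: power2_eq_square algebra_simps)
  with s t that show ?thesis by (metis less_imp_le)
qed

text \<open>Schwarz's theorem. The second difference over a small parallelogram is symmetric in
  \<open>u\<close> and \<open>v\<close>, and it equals h^2 times either mixed derivative at some
  point of the parallelogram; continuity moves these points to \<open>x\<close>.\<close>

lemma symmetric_second_derivative_real:
  fixes f :: "'a::real_normed_vector \<Rightarrow> real"
  assumes f: "smooth_on U f" and "open U" "x \<in> U"
  shows "frechet_derivative (\<lambda>y. frechet_derivative f (at y) u) (at x) v =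
    frechet_derivative (\<lambda>y. frechet_derivative f (at y) v) (at x) u"
proof -
  let ?D = "\<lambda>u v y. frechet_derivative (\<lambda>y. frechet_derivative f (at y) u) (at y) v"
  have cont: "isCont (?D u v) x" for u v
    using smooth_on_imp_continuous_on[OF smooth_on_frechet_derivative[OF smooth_on_frechet_derivative[OF f]]]
      assms(2,3) continuous_on_eq_continuous_at by blast
  have "\<bar>?D u v x - ?D v u x\<bar> \<le> 2 * e" if e: "e > 0" for e
  proof -
    obtain d1 where d1: "d1 > 0" "\<And>y. dist y x < d1 \<Longrightarrow> dist (?D u v y) (?D u v x) < e"
      using cont[of u v] e unfolding continuous_at_eps_delta by blast
    obtain d2 where d2: "d2 > 0" "\<And>y. dist y x < d2 \<Longrightarrow> dist (?D v u y) (?D v u x) < e"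
      using cont[of v u] e unfolding continuous_at_eps_delta by blast
    obtain d3 where d3: "d3 > 0" "ball x d3 \<subseteq> U"
      using assms(2,3) open_contains_ball by blast
    \<comment> \<open>This size keeps the whole parallelogram within all three radii; the summand 1
      avoids division by zero.\<close>
    define h where "h = min d1 (min d2 d3) / (norm u + norm v + 1)"
    have h: "h > 0" using d1 d2 d3 by (auto simp: h_def intro!: divide_pos_pos add_nonneg_pos)
    have near: "dist (x + s *\<^sub>R u + t *\<^sub>R v) x < min d1 (min d2 d3)"
      if "0 \<le> s" "s \<le> h" "0 \<le> t" "t \<le> h" for s t
    proof -
      have "dist (x + s *\<^sub>R u + t *\<^sub>R v) x = norm (s *\<^sub>R u + t *\<^sub>R v)"
        by (simp add: dist_norm)
      also have "\<dots> \<le> s * norm u + t * norm v"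
        using norm_triangle_ineq[of "s *\<^sub>R u" "t *\<^sub>R v"] that by simp
      also have "\<dots> \<le> h * norm u + h * norm v"
        using that by (intro add_mono mult_right_mono) auto
      also have "\<dots> < h * (norm u + norm v + 1)" using h by (simp add: algebra_simps)
      also have "\<dots> = min d1 (min d2 d3)"
        unfolding h_def by (metis add_nonneg_pos add_nonneg_nonneg less_numeral_extra(3) norm_ge_zero
            nonzero_mult_div_cancel_right times_divide_eq_left zero_less_one)
      finally show ?thesis .
    qed
    have inU: "x + s *\<^sub>R u + t *\<^sub>R v \<in> U" if "0 \<le> s" "s \<le> h" "0 \<le> t" "t \<le> h" for s t
      using near[OF that] d3(2) by (auto simp: dist_commute)
    have inU': "x + s *\<^sub>R v + t *\<^sub>R u \<in> U" if "0 \<le> s" "s \<le> h" "0 \<le> t" "t \<le> h" for s t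
      using inU[of t s] that by (simp add: algebra_simps)
    obtain s t where st: "0 \<le> s" "s \<le> h" "0 \<le> t" "t \<le> h" and
      1: "f (x + h *\<^sub>R u + h *\<^sub>R v) - f (x + h *\<^sub>R u) - f (x + h *\<^sub>R v) + f x =
        h\<^sup>2 * ?D u v (x + s *\<^sub>R u + t *\<^sub>R v)"
      using second_difference[OF f h inU] .
    obtain s' t' where st': "0 \<le> s'" "s' \<le> h" "0 \<le> t'" "t' \<le> h" and
      2: "f (x + h *\<^sub>R v + h *\<^sub>R u) - f (x + h *\<^sub>R v) - f (x + h *\<^sub>R u) + f x =
        h\<^sup>2 * ?D v u (x + s' *\<^sub>R v + t' *\<^sub>R u)"
      using second_difference[OF f h inU'] .
    have comm: "x + h *\<^sub>R v + h *\<^sub>R u = x + h *\<^sub>R u + h *\<^sub>R v" by simp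
    have "h\<^sup>2 * ?D u v (x + s *\<^sub>R u + t *\<^sub>R v) = h\<^sup>2 * ?D v u (x + s' *\<^sub>R v + t' *\<^sub>R u)"
      using 1 2 unfolding comm by linarith
    then have "?D u v (x + s *\<^sub>R u + t *\<^sub>R v) = ?D v u (x + s' *\<^sub>R v + t' *\<^sub>R u)"
      using h by simp
    moreover have "dist (?D u v (x + s *\<^sub>R u + t *\<^sub>R v)) (?D u v x) < e"
      using near[OF st] by (intro d1) auto
    moreover have "dist (?D v u (x + s' *\<^sub>R v + t' *\<^sub>R u)) (?D v u x) < e"
      using near[of t' s'] st' by (intro d2) (auto simp: algebra_simps)
    ultimately show ?thesis by (simp add: dist_real_def)
  qed
  \<comment> \<open>With this \<open>e\<close> a nonzero difference would be at most half of
    itself.\<close>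
  from this[of "\<bar>?D u v x - ?D v u x\<bar> / 4"] show ?thesis by (cases "?D u v x = ?D v u x") auto
qed

lemma symmetric_second_derivative:
  fixes f :: "'a::real_normed_vector \<Rightarrow> 'b::euclidean_space"
  assumes f: "smooth_on U f" and U: "open U" "x \<in> U"
  shows "frechet_derivative (\<lambda>y. frechet_derivative f (at y) u) (at x) v =
    frechet_derivative (\<lambda>y. frechet_derivative f (at y) v) (at x) u"
proof (rule euclidean_eqI)
  fix b :: 'b assume "b \<in> Basis"
  let ?g = "\<lambda>x. f x \<bullet> b"
  have g: "smooth_on U ?g" by (rule smooth_on_linear[OF U(1) bounded_linear_inner_left f])
  have 1: "frechet_derivative ?g (at y) w = frechet_derivative f (at y) w \<bullet> b" if "y \<in> U" for y w
    using has_derivative_inner_left[OF smooth_on_has_derivative[OF f that], of b]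
    by (metis frechet_derivative_at)
  have 2: "frechet_derivative (\<lambda>y. frechet_derivative ?g (at y) w) (at x) w' =
    frechet_derivative (\<lambda>y. frechet_derivative f (at y) w) (at x) w' \<bullet> b" for w w'
  proof -
    have "((\<lambda>y. frechet_derivative f (at y) w \<bullet> b) has_derivative
       (\<lambda>w'. frechet_derivative (\<lambda>y. frechet_derivative f (at y) w) (at x) w' \<bullet> b)) (at x)"
      by (intro has_derivative_inner_left smooth_on_has_derivative[OF smooth_on_frechet_derivative[OF f] U(2)])
    then have "((\<lambda>y. frechet_derivative ?g (at y) w) has_derivative
       (\<lambda>w'. frechet_derivative (\<lambda>y. frechet_derivative f (at y) w) (at x) w' \<bullet> b)) (at x)"
      by (rule has_derivative_transform_within_open[OF _ U]) (simp add: 1)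
    from frechet_derivative_at[OF this] show ?thesis by (rule fun_cong[OF sym])
  qed
  show "frechet_derivative (\<lambda>y. frechet_derivative f (at y) u) (at x) v \<bullet> b =
      frechet_derivative (\<lambda>y. frechet_derivative f (at y) v) (at x) u \<bullet> b"
    using symmetric_second_derivative_real[OF g U, of u v] unfolding 2 .
qed

text \<open>Second order Taylor estimate, the source of descent for a gradient step of fixed size.
  The set \<open>K\<close> need not be convex, so the segment is required to stay in it.\<close>

lemma quadratic_upper_bound:
  fixes f :: "'a::euclidean_space \<Rightarrow> real"
  assumes f: "smooth_on U f" and "open U" and K: "compact K" "K \<subseteq> U"
  obtains L where "L > 0"
    "\<And>z w. closed_segment z (z + w) \<subseteq> K \<Longrightarrow> f (z + w) \<le> f z + frechet_derivative f (at z) w + L * (norm w)\<^sup>2"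
proof -
  let ?d = "\<lambda>b y. frechet_derivative f (at y) b"
  let ?e = "\<lambda>b y. frechet_derivative (?d b) (at y)"
  have "\<exists>C. \<forall>y\<in>K. \<bar>?e b y b'\<bar> \<le> C" for b b'
  proof -
    have "continuous_on K (\<lambda>y. ?e b y b')"
      using continuous_on_subset[OF smooth_on_imp_continuous_on[OF smooth_on_frechet_derivative[OF smooth_on_frechet_derivative[OF f]]] K(2)] .
    from compact_imp_bounded[OF compact_continuous_image[OF this K(1)]]
    show ?thesis unfolding bounded_iff by auto
  qed
  then obtain C where C: "\<And>b b' y. y \<in> K \<Longrightarrow> \<bar>?e b y b'\<bar> \<le> C b b'" by metis
  \<comment> \<open>A crude bound for the second derivative as a bilinear form on \<open>K\<close>;
    the summand 1 makes it positive.\<close>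
  define L where "L = (\<Sum>b\<in>Basis. \<Sum>b'\<in>Basis. \<bar>C b b'\<bar>) + 1"
  have L: "L > 0" unfolding L_def by (intro add_nonneg_pos sum_nonneg) auto
  have "f (z + w) \<le> f z + frechet_derivative f (at z) w + L * (norm w)\<^sup>2"
    if seg: "closed_segment z (z + w) \<subseteq> K" for z w
  proof -
    have inK: "z + s *\<^sub>R w \<in> K" if "0 \<le> s" "s \<le> 1" for s
      using seg that by (auto simp: closed_segment_def algebra_simps)
    have inU: "z + s *\<^sub>R w \<in> U" if "0 \<le> s" "s \<le> 1" for s using inK[OF that] K by auto
    have lin: "linear (frechet_derivative g (at y))" if "smooth_on U g" "y \<in> U" for g :: "'a \<Rightarrow> real" and y
      using smooth_on_has_derivative[OF that] has_derivative_linear by blast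
    have rep: "frechet_derivative g (at y) w = (\<Sum>b\<in>Basis. (w \<bullet> b) * frechet_derivative g (at y) b)"
      if "smooth_on U g" "y \<in> U" for g :: "'a \<Rightarrow> real" and y
      using linear_sum[OF lin[OF that], of "\<lambda>b. (w \<bullet> b) *\<^sub>R b" Basis] linear_cmul[OF lin[OF that]]
      by (simp add: euclidean_representation)
    have 1: "((\<lambda>s. f (z + s *\<^sub>R w)) has_real_derivative ?d w (z + s *\<^sub>R w)) (at s)" if "0 \<le> s" "s \<le> 1" for s
      by (intro has_real_derivative_along_line smooth_on_has_derivative[OF f inU[OF that]])
    have 2: "((\<lambda>s. ?d w (z + s *\<^sub>R w)) has_real_derivative ?e w (z + s *\<^sub>R w) w) (at s)" if "0 \<le> s" "s \<le> 1" for s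
      by (intro has_real_derivative_along_line smooth_on_has_derivative[OF smooth_on_frechet_derivative[OF f] inU[OF that]])
    from MVT2[OF _ 1, of 0 1] obtain s where s: "0 < s" "s < 1" "f (z + w) - f z = ?d w (z + s *\<^sub>R w)"
      by auto
    have s1: "s' \<le> 1" if "s' \<le> s" for s' using that s by linarith
    from MVT2[OF s(1) 2[OF _ s1]] obtain s' where s': "0 < s'" "s' < s"
        "?d w (z + s *\<^sub>R w) - ?d w z = s * ?e w (z + s' *\<^sub>R w) w"
      by auto
    let ?y = "z + s' *\<^sub>R w"
    have y: "?y \<in> U" "?y \<in> K" using inU[of s'] inK[of s'] s s' by auto
    have sd: "smooth_on U (?d b)" for b by (rule smooth_on_frechet_derivative[OF f])
    have "?e w ?y v = (\<Sum>b\<in>Basis. (w \<bullet> b) * ?e b ?y v)" for v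
    proof -
      have "((\<lambda>y. \<Sum>b\<in>Basis. (w \<bullet> b) * ?d b y) has_derivative (\<lambda>v. \<Sum>b\<in>Basis. (w \<bullet> b) * ?e b ?y v)) (at ?y)"
        by (intro has_derivative_sum has_derivative_mult_right smooth_on_has_derivative[OF sd y(1)])
      then have "(?d w has_derivative (\<lambda>v. \<Sum>b\<in>Basis. (w \<bullet> b) * ?e b ?y v)) (at ?y)"
        by (rule has_derivative_transform_within_open[OF _ assms(2) y(1)]) (rule rep[OF f, symmetric])
      from frechet_derivative_at[OF this] show ?thesis by (rule fun_cong[OF sym])
    qed
    then have "?e w ?y w = (\<Sum>b\<in>Basis. (w \<bullet> b) * ?e b ?y w)" .
    also have "\<dots> = (\<Sum>b\<in>Basis. (w \<bullet> b) * (\<Sum>b'\<in>Basis. (w \<bullet> b') * ?e b ?y b'))"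
      by (intro sum.cong refl arg_cong2[where f = "(*)"] rep[OF sd y(1)])
    also have "\<dots> = (\<Sum>b\<in>Basis. \<Sum>b'\<in>Basis. (w \<bullet> b) * ((w \<bullet> b') * ?e b ?y b'))"
      by (simp only: sum_distrib_left)
    also have "\<dots> \<le> (\<Sum>b\<in>Basis. \<Sum>b'\<in>Basis. norm w * (norm w * \<bar>C b b'\<bar>))"
    proof (rule sum_mono, rule sum_mono, rule order_trans[OF abs_ge_self])
      fix b b' :: 'a assume b: "b \<in> Basis" "b' \<in> Basis"
      have "\<bar>?e b ?y b'\<bar> \<le> \<bar>C b b'\<bar>" using C[OF y(2), of b b'] by linarith
      then show "\<bar>(w \<bullet> b) * ((w \<bullet> b') * ?e b ?y b')\<bar> \<le> norm w * (norm w * \<bar>C b b'\<bar>)"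
        unfolding abs_mult using Basis_le_norm[OF b(1)] Basis_le_norm[OF b(2)]
        by (intro mult_mono) auto
    qed
    also have "\<dots> \<le> L * (norm w)\<^sup>2"
      by (simp add: L_def power2_eq_square sum_distrib_left[symmetric] algebra_simps)
    finally have e: "?e w ?y w \<le> L * (norm w)\<^sup>2" .
    have "s * ?e w ?y w \<le> s * (L * (norm w)\<^sup>2)" using e s by (intro mult_left_mono) auto
    also have "\<dots> \<le> 1 * (L * (norm w)\<^sup>2)" using L s by (intro mult_right_mono) auto
    finally show ?thesis using s s' by simp
  qed
  with L that show ?thesis by blast
qed

section \<open>Limits along filters finer than the sequential one\<close>

text \<open>Convergence is wanted at every real time at once, which a choice of subsequence does not
  give directly. The sequence lives in a product of copies of \<open>K\<close> and has a cluster
  point there; \<open>F\<close> is generated by the tails and by the sets of indices at which the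
  sequence is near that point.\<close>

lemma cluster_filter:
  fixes X :: "nat \<Rightarrow> 'i \<Rightarrow> 'a::topological_space"
  assumes K: "compact K" and X: "\<And>n i. X n i \<in> K"
  obtains F x where "F \<le> sequentially" "F \<noteq> bot" "\<forall>i. x i \<in> K" "\<forall>i. ((\<lambda>n. X n i) \<longlongrightarrow> x i) F"
proof -
  have "compactin (product_topology (\<lambda>i. euclidean) UNIV) (PiE UNIV (\<lambda>i::'i. K))"
    using K by (simp add: compactin_PiE compactin_euclidean_iff)
  then have "compact (PiE UNIV (\<lambda>i::'i. K))"
    by (simp add: euclidean_product_topology compactin_euclidean_iff)
  moreover have "filtermap X sequentially \<noteq> bot" "eventually (\<lambda>x. x \<in> PiE UNIV (\<lambda>i. K)) (filtermap X sequentially)"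
    using X by (auto simp: filtermap_bot_iff eventually_filtermap PiE_UNIV_domain)
  ultimately obtain x where x: "x \<in> PiE UNIV (\<lambda>i. K)" "inf (nhds x) (filtermap X sequentially) \<noteq> bot"
    unfolding compact_filter by blast
  define F where "F = inf sequentially (filtercomap X (nhds x))"
  have "F \<noteq> bot"
  proof
    assume "F = bot"
    then have "eventually (\<lambda>_. False) F" by simp
    then obtain P Q where PQ: "eventually P sequentially" "eventually Q (filtercomap X (nhds x))"
        "\<And>n. \<not> (P n \<and> Q n)"
      unfolding F_def eventually_inf by auto
    obtain S where S: "eventually S (nhds x)" "\<And>n. S (X n) \<Longrightarrow> Q n"
      using PQ(2) unfolding eventually_filtercomap by auto
    have "eventually (\<lambda>y. \<not> S y) (filtermap X sequentially)"
      unfolding eventually_filtermap using PQ(1) by eventually_elim (use PQ(3) S(2) in blast)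
    with S(1) have "eventually (\<lambda>_. False) (inf (nhds x) (filtermap X sequentially))"
      unfolding eventually_inf by blast
    with x(2) show False by (simp add: eventually_False)
  qed
  moreover have "F \<le> sequentially" by (simp add: F_def)
  moreover have "((\<lambda>n. X n i) \<longlongrightarrow> x i) F" for i
  proof -
    have "(X \<longlongrightarrow> x) F" by (simp add: F_def filterlim_iff_le_filtercomap)
    then show ?thesis
      using continuous_on_tendsto_compose[where s = UNIV and f = "\<lambda>x. x i" and g = X and l = x and F = F]
        continuous_on_product_coordinates by simp
  qed
  moreover have "x i \<in> K" for i using x(1) by auto
  ultimately show ?thesis using that by blast
qed

lemma floor_mult_div_tendsto:
  "((\<lambda>N. real_of_int \<lfloor>real N * t\<rfloor> / real N) \<longlongrightarrow> t) sequentially"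
proof (rule tendsto_sandwich[where f = "\<lambda>N. t - 1 / real N" and h = "\<lambda>N. t"])
  show "\<forall>\<^sub>F N in sequentially. t - 1 / real N \<le> real_of_int \<lfloor>real N * t\<rfloor> / real N"
    using eventually_gt_at_top[of 0]
  proof eventually_elim
    case (elim N)
    have "real N * t - 1 \<le> real_of_int \<lfloor>real N * t\<rfloor>" by linarith
    from divide_right_mono[OF this, of "real N"] elim show ?case by (simp add: diff_divide_distrib)
  qed
  show "\<forall>\<^sub>F N in sequentially. real_of_int \<lfloor>real N * t\<rfloor> / real N \<le> t"
    using eventually_gt_at_top[of 0]
    by eventually_elim (simp add: divide_le_eq mult.commute)
  show "((\<lambda>N. t - 1 / real N) \<longlongrightarrow> t) sequentially"
    using tendsto_diff[OF tendsto_const lim_const_over_n[of 1]] by simp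
qed auto

text \<open>Equicontinuity of the step functions sending a time t to
  \<open>y N \<lfloor>real N * t\<rfloor>\<close>. Index distances are measured in units of
  \<open>N\<close> and only large \<open>N\<close> count, so jumps between neighbouring indices are
  allowed as long as they shrink.\<close>

definition equicont :: "(nat \<Rightarrow> int \<Rightarrow> 'a::real_normed_vector) \<Rightarrow> bool" where
  "equicont y \<longleftrightarrow> (\<forall>e>0. \<exists>d>0. \<forall>\<^sub>F N in sequentially.
      \<forall>i j. \<bar>real_of_int i - real_of_int j\<bar> \<le> d * real N \<longrightarrow> norm (y N i - y N j) \<le> e)"

text \<open>Over a short time equicontinuity keeps all slopes \<open>w N k\<close> within
  \<open>e\<close> of the slope at t, so the increment of \<open>z\<close> differs from the linear
  one by at most \<open>e\<close> times the elapsed time. This inequality survives the limit and is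
  the definition of the derivative; no integral equation enters.\<close>

lemma euler_scheme_limit:
  fixes z w :: "nat \<Rightarrow> int \<Rightarrow> 'a::real_normed_vector"
  assumes F: "F \<le> sequentially" "F \<noteq> bot"
    and rec: "\<forall>\<^sub>F N in sequentially. \<forall>k. z N (k + 1) = z N k + (1 / real N) *\<^sub>R w N k"
    and equi: "equicont w"
    and limz: "\<forall>t. ((\<lambda>N. z N \<lfloor>real N * t\<rfloor>) \<longlongrightarrow> zl t) F"
    and limw: "\<forall>t. ((\<lambda>N. w N \<lfloor>real N * t\<rfloor>) \<longlongrightarrow> wl t) F"
  shows "(zl has_vector_derivative wl t) (at t)"
  unfolding has_vector_derivative_def has_derivative_at_alt
proof (intro conjI allI impI)
  show "bounded_linear (\<lambda>h. h *\<^sub>R wl t)" by (rule bounded_linear_scaleR_left)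
  fix e :: real assume "e > 0"
  with equi obtain d where d: "d > 0" and
    eqd: "\<forall>\<^sub>F N in sequentially. \<forall>i j. \<bar>real_of_int i - real_of_int j\<bar> \<le> d * real N \<longrightarrow> norm (w N i - w N j) \<le> e"
    unfolding equicont_def by blast
  have "norm (zl s - zl t - (s - t) *\<^sub>R wl t) \<le> e * norm (s - t)" if st: "norm (s - t) < d / 2" for s
  proof -
    let ?i = "\<lambda>N. \<lfloor>real N * t\<rfloor>" and ?j = "\<lambda>N. \<lfloor>real N * s\<rfloor>"
    have big: "\<forall>\<^sub>F N in sequentially. real N \<ge> 2 / d"
      using filterlim_real_sequentially by (simp add: filterlim_at_top)
    have ev: "\<forall>\<^sub>F N in sequentially. norm (z N (?j N) - z N (?i N) - ((?j N - ?i N) / real N) *\<^sub>R w N (?i N))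
        \<le> e * \<bar>(?j N - ?i N) / real N\<bar>"
      using rec eqd big
    proof eventually_elim
      case (elim N)
      \<comment> \<open>The reference index \<open>c\<close> is independent of the interval, so that
        one estimate serves times on either side of t.\<close>
      have step: "norm (z N b - z N a - ((b - a) / real N) *\<^sub>R w N c) \<le> e * ((b - a) / real N)"
        if "a \<le> b" and c: "\<And>k. a \<le> k \<Longrightarrow> k \<le> b \<Longrightarrow> \<bar>real_of_int k - real_of_int c\<bar> \<le> d * real N" for a b c :: int
        using that
      proof (induction b rule: int_ge_induct)
        case base
        then show ?case by simp
      next
        case (step b)
        have IH: "norm (z N b - z N a - ((b - a) / real N) *\<^sub>R w N c) \<le> e * ((b - a) / real N)"
          using step.prems by (intro step.IH) auto
        have "norm (w N b - w N c) \<le> e" using elim(2) step.prems[of b] step.hyps by auto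
        then have w: "norm ((1 / real N) *\<^sub>R (w N b - w N c)) \<le> e * (1 / real N)"
          by (simp add: divide_right_mono)
        have eqn: "z N (b + 1) - z N a - ((real_of_int (b + 1) - a) / real N) *\<^sub>R w N c =
            (z N b - z N a - ((b - a) / real N) *\<^sub>R w N c) + (1 / real N) *\<^sub>R (w N b - w N c)"
          unfolding elim(1)[rule_format, of b] by (simp add: algebra_simps add_divide_distrib diff_divide_distrib)
        have "norm (z N (b + 1) - z N a - ((real_of_int (b + 1) - a) / real N) *\<^sub>R w N c) \<le>
            e * ((b - a) / real N) + e * (1 / real N)"
          unfolding eqn by (rule norm_triangle_mono[OF IH w])
        also have "\<dots> = e * ((real_of_int (b + 1) - a) / real N)"
          by (simp add: algebra_simps add_divide_distrib diff_divide_distrib)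
        finally show ?case by simp
      qed
      have "N > 0" using elim(3) d by (cases "N = 0") (auto simp: field_simps)
      \<comment> \<open>Rounding the two times costs at most one index, and
        \<open>2 / d \<le> real N\<close> absorbs it into one half of
        \<open>d * real N\<close>.\<close>
      have close: "\<bar>real_of_int k - real_of_int (?i N)\<bar> \<le> d * real N"
        if "min (?i N) (?j N) \<le> k" "k \<le> max (?i N) (?j N)" for k
      proof -
        have "\<bar>real_of_int k - real_of_int (?i N)\<bar> \<le> \<bar>real_of_int (?j N) - real_of_int (?i N)\<bar>"
          using that by linarith
        also have "\<dots> \<le> \<bar>real N * s - real N * t\<bar> + 1" by linarith
        also have "\<dots> = real N * \<bar>s - t\<bar> + 1"
          by (simp add: abs_mult flip: right_diff_distrib)
        also have "\<dots> \<le> real N * (d / 2) + real N * (d / 2)"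
          using st elim(3) d by (intro add_mono mult_left_mono) (auto simp: field_simps)
        finally show ?thesis by (simp add: algebra_simps)
      qed
      show ?case
      proof (cases "?i N \<le> ?j N")
        case True
        then show ?thesis using step[of "?i N" "?j N" "?i N"] close by auto
      next
        case False
        then have "norm (z N (?i N) - z N (?j N) - ((?i N - ?j N) / real N) *\<^sub>R w N (?i N)) \<le> e * ((?i N - ?j N) / real N)"
          using close by (intro step) auto
        moreover have "z N (?i N) - z N (?j N) - ((?i N - ?j N) / real N) *\<^sub>R w N (?i N) =
          - (z N (?j N) - z N (?i N) - ((?j N - ?i N) / real N) *\<^sub>R w N (?i N))"
          by (simp add: algebra_simps diff_divide_distrib)
        moreover have "\<bar>(?j N - ?i N) / real N\<bar> = (?i N - ?j N) / real N"
          using False by (simp add: abs_if divide_simps)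
        ultimately show ?thesis by (metis norm_minus_cancel)
      qed
    qed
    have q: "((\<lambda>N. (?j N - ?i N) / real N) \<longlongrightarrow> s - t) F"
      using tendsto_mono[OF F(1) tendsto_diff[OF floor_mult_div_tendsto[of s] floor_mult_div_tendsto[of t]]]
      by (simp add: diff_divide_distrib)
    have "norm (zl s - zl t - (s - t) *\<^sub>R wl t) \<le> e * \<bar>s - t\<bar>"
    proof (rule tendsto_le[OF F(2)])
      show "((\<lambda>N. e * \<bar>(?j N - ?i N) / real N\<bar>) \<longlongrightarrow> e * \<bar>s - t\<bar>) F"
        by (intro tendsto_intros q)
      show "((\<lambda>N. norm (z N (?j N) - z N (?i N) - ((?j N - ?i N) / real N) *\<^sub>R w N (?i N)))
        \<longlongrightarrow> norm (zl s - zl t - (s - t) *\<^sub>R wl t)) F"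
        by (intro tendsto_intros q limz[rule_format] limw[rule_format])
    qed (use ev F(1) in \<open>auto simp: le_filter_def\<close>)
    then show ?thesis by simp
  qed
  with d show "\<exists>d>0. \<forall>s. norm (s - t) < d \<longrightarrow> norm (zl s - zl t - (s - t) *\<^sub>R wl t) \<le> e * norm (s - t)"
    by (intro exI[of _ "d/2"]) auto
qed

section \<open>Sweepouts of the sphere by polygons\<close>

text \<open>As a sum of clamped increments the interpolation is visibly continuous in the vertices
  and in \<open>u\<close> jointly, with no gluing of segments.\<close>

definition piecewise_linear :: "(nat \<Rightarrow> 'a::real_vector) \<Rightarrow> nat \<Rightarrow> real \<Rightarrow> 'a" where
  "piecewise_linear y n u = y 0 + (\<Sum>j<n. max 0 (min 1 (u - real j)) *\<^sub>R (y (Suc j) - y j))"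

lemma piecewise_linear_beyond:
  "u \<ge> real n \<Longrightarrow> piecewise_linear y n u = y n"
  by (induction n) (auto simp: piecewise_linear_def min_def max_def add.assoc[symmetric])

lemma piecewise_linear_segment:
  assumes "k < n" "real k \<le> u" "u \<le> real k + 1"
  shows "piecewise_linear y n u = y k + (u - real k) *\<^sub>R (y (Suc k) - y k)"
  using assms(1)
proof (induction n)
  case (Suc n)
  have s: "piecewise_linear y (Suc n) u = piecewise_linear y n u + max 0 (min 1 (u - real n)) *\<^sub>R (y (Suc n) - y n)"
    by (simp add: piecewise_linear_def add.assoc)
  show ?case
  proof (cases "k = n")
    case True
    then show ?thesis using assms piecewise_linear_beyond[of n u y] by (simp add: s min_def max_def)
  next
    case False
    then have "real k + 1 \<le> real n" using Suc.prems by linarith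
    then have "max 0 (min 1 (u - real n)) = 0" using assms by (simp add: min_def max_def)
    moreover have "k < n" using False Suc.prems by simp
    ultimately show ?thesis using Suc.IH by (simp add: s)
  qed
qed simp

lemma norm_piecewise_linear_diff_le:
  fixes y :: "nat \<Rightarrow> 'a::real_normed_vector"
  assumes "k < n" "real k \<le> u" "u \<le> real k + 1"
  shows "norm (piecewise_linear y n u - y k) \<le> norm (y (Suc k) - y k)"
proof -
  have "norm (piecewise_linear y n u - y k) = \<bar>u - real k\<bar> * norm (y (Suc k) - y k)"
    by (simp add: piecewise_linear_segment[OF assms])
  also have "\<dots> \<le> 1 * norm (y (Suc k) - y k)"
    using assms by (intro mult_right_mono) auto
  finally show ?thesis by simp
qed

lemma ex_segment:
  assumes "0 \<le> u" "u \<le> real n" "n > 0"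
  obtains k where "k < n" "real k \<le> u" "u \<le> real k + 1"
proof (cases "u = real n")
  case True
  then show ?thesis using assms that[of "n - 1"] by (simp add: of_nat_diff)
next
  case False
  then have "nat \<lfloor>u\<rfloor> < n" using assms by linarith
  moreover have "real (nat \<lfloor>u\<rfloor>) \<le> u" "u \<le> real (nat \<lfloor>u\<rfloor>) + 1" using assms by linarith+
  ultimately show ?thesis using that by blast
qed

text \<open>A continuous map from a compact space to a metric space is closed, hence a quotient map
  onto its image: preimages of closed sets under \<open>h\<close> are \<open>q\<close>-images of
  compact sets.\<close>

lemma continuous_on_quotient:
  fixes q :: "'a::metric_space \<Rightarrow> 'b::metric_space" and f :: "'a \<Rightarrow> 'c::metric_space"
  assumes K: "compact K" and q: "continuous_on K q" and f: "continuous_on K f"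
    and fib: "\<And>a b. a \<in> K \<Longrightarrow> b \<in> K \<Longrightarrow> q a = q b \<Longrightarrow> f a = f b"
  obtains h where "continuous_on (q ` K) h" "\<And>a. a \<in> K \<Longrightarrow> h (q a) = f a"
proof
  define h where "h y = f (SOME a. a \<in> K \<and> q a = y)" for y
  show hq: "h (q a) = f a" if "a \<in> K" for a
  proof -
    have "(SOME b. b \<in> K \<and> q b = q a) \<in> K \<and> q (SOME b. b \<in> K \<and> q b = q a) = q a"
      by (rule someI[of "\<lambda>b. b \<in> K \<and> q b = q a" a]) (simp add: that)
    then show ?thesis unfolding h_def using fib that by blast
  qed
  have "compact (q ` K)" by (rule compact_continuous_image[OF q K])
  then have "closed (q ` K)" by (rule compact_imp_closed)
  then show "continuous_on (q ` K) h"
  proof (subst continuous_on_closed_vimage, assumption, intro allI impI)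
    fix B :: "'c set" assume "closed B"
    then have "closed (f -` B \<inter> K)"
      using continuous_on_closed_vimage[OF compact_imp_closed[OF K], of f] f by simp
    then have "compact (f -` B \<inter> K)"
      using closed_Int_compact[OF _ K, of "f -` B \<inter> K"] by (simp add: Int_assoc)
    then have "compact (q ` (f -` B \<inter> K))"
      by (intro compact_continuous_image[OF continuous_on_subset[OF q]]) auto
    moreover have "h -` B \<inter> q ` K = q ` (f -` B \<inter> K)" using hq by auto
    ultimately show "closed (h -` B \<inter> q ` K)" by (simp add: compact_imp_closed)
  qed
qed

section \<open>Parallels of the sphere, in height and longitude\<close>

definition circle_point :: "real \<Rightarrow> real \<Rightarrow> real^3" where
  "circle_point t a = vector [sqrt (1 - t\<^sup>2) * cos a, sqrt (1 - t\<^sup>2) * sin a, t]"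

lemma sq_le_1: "t \<in> {-1..1} \<Longrightarrow> t\<^sup>2 \<le> (1::real)"
  by (simp add: abs_square_le_1 abs_le_iff)

lemma inner_real3: "(x::real^3) \<bullet> y = x $ 1 * y $ 1 + x $ 2 * y $ 2 + x $ 3 * y $ 3"
  by (simp add: inner_vec_def sum_3)

lemma circle_point_in_S2:
  assumes "t \<in> {-1..1}"
  shows "circle_point t a \<in> S2"
proof -
  have "circle_point t a \<bullet> circle_point t a = (sqrt (1 - t\<^sup>2))\<^sup>2 * ((cos a)\<^sup>2 + (sin a)\<^sup>2) + t\<^sup>2"
    unfolding inner_real3 circle_point_def vector_3 by algebra
  also have "\<dots> = 1" using sq_le_1[OF assms] by simp
  finally have "circle_point t a \<bullet> circle_point t a = 1" .
  then show ?thesis by (simp add: norm_eq_sqrt_inner)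
qed

text \<open>A chord is no longer than its arc, and the parallel has radius at most 1. The bound is
  independent of the height, so it serves all polygons of the sweepout at once.\<close>

lemma norm_circle_point_diff:
  assumes "t \<in> {-1..1}"
  shows "norm (circle_point t a - circle_point t b) \<le> \<bar>a - b\<bar>"
proof -
  have "(circle_point t a - circle_point t b) \<bullet> (circle_point t a - circle_point t b) =
      (sqrt (1 - t\<^sup>2))\<^sup>2 * ((cos a - cos b)\<^sup>2 + (sin a - sin b)\<^sup>2)"
    unfolding inner_real3 circle_point_def vector_3 vector_minus_component by algebra
  also have "\<dots> = (1 - t\<^sup>2) * ((cos a - cos b)\<^sup>2 + (sin a - sin b)\<^sup>2)"
    using sq_le_1[OF assms] by simp
  also have "\<dots> \<le> 1 * ((cos a - cos b)\<^sup>2 + (sin a - sin b)\<^sup>2)"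
    by (intro mult_right_mono) auto
  also have "(cos a - cos b)\<^sup>2 + (sin a - sin b)\<^sup>2 = 2 - 2 * cos (a - b)"
  proof -
    have "(cos a - cos b)\<^sup>2 + (sin a - sin b)\<^sup>2 =
      ((cos a)\<^sup>2 + (sin a)\<^sup>2) + ((cos b)\<^sup>2 + (sin b)\<^sup>2) - 2 * (cos a * cos b + sin a * sin b)"
      by (simp add: power2_eq_square algebra_simps)
    then show ?thesis by (simp add: cos_diff)
  qed
  also have "2 - 2 * cos (a - b) = (2 * sin ((a - b) / 2))\<^sup>2"
    using cos_double_sin[of "(a - b) / 2"] unfolding mult_2 by (simp add: power_mult_distrib)
  also have "\<dots> \<le> (a - b)\<^sup>2"
    using abs_sin_x_le_abs_x[of "(a - b) / 2"] by (subst abs_le_square_iff[symmetric]) simp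
  finally show ?thesis
    by (simp add: norm_eq_sqrt_inner real_sqrt_le_iff flip: real_sqrt_abs)
qed

lemma continuous_on_vec_components:
  fixes f :: "'a::topological_space \<Rightarrow> 'b::real_normed_vector^'n"
  assumes "\<And>i. continuous_on A (\<lambda>x. f x $ i)"
  shows "continuous_on A f"
  using continuous_on_vec_lambda[where f = "\<lambda>i x. f x $ i", OF assms] by simp

lemma continuous_on_circle_point:
  fixes f g :: "'a::t2_space \<Rightarrow> real"
  assumes "continuous_on A f" "continuous_on A g"
  shows "continuous_on A (\<lambda>x. circle_point (f x) (g x))"
proof (rule continuous_on_vec_components)
  fix i :: 3
  have "continuous_on A (\<lambda>x. cos (g x))" "continuous_on A (\<lambda>x. sin (g x))"
    by (rule continuous_on_cos[OF assms(2)] continuous_on_sin[OF assms(2)])+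
  then show "continuous_on A (\<lambda>x. circle_point (f x) (g x) $ i)"
    using exhaust_3[of i] assms(1)
    by (elim disjE) (auto simp: circle_point_def vector_3 intro!: continuous_on_mult continuous_on_real_sqrt
        continuous_on_diff continuous_on_power continuous_on_const)
qed

lemma circle_point_surj:
  assumes "p \<in> S2"
  obtains t a where "t \<in> {-1..1}" "0 \<le> a" "a < 2 * pi" "circle_point t a = p"
proof -
  have n: "(p $ 1)\<^sup>2 + (p $ 2)\<^sup>2 + (p $ 3)\<^sup>2 = 1"
    using assms by (simp add: norm_eq_sqrt_inner inner_real3 power2_eq_square)
  then have "(p $ 3)\<^sup>2 \<le> 1" using zero_le_power2[of "p $ 1"] zero_le_power2[of "p $ 2"] by linarith
  then have t: "p $ 3 \<in> {-1..1}" by (simp add: abs_square_le_1 abs_le_iff)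
  define \<rho> where "\<rho> = sqrt (1 - (p $ 3)\<^sup>2)"
  have rho2: "\<rho>\<^sup>2 = (p $ 1)\<^sup>2 + (p $ 2)\<^sup>2" using n \<open>(p $ 3)\<^sup>2 \<le> 1\<close> by (simp add: \<rho>_def)
  have "\<exists>a. 0 \<le> a \<and> a < 2 * pi \<and> p $ 1 = \<rho> * cos a \<and> p $ 2 = \<rho> * sin a"
  proof (cases "\<rho> = 0")
    case True
    then show ?thesis using rho2 by (intro exI[of _ 0]) (auto simp: sum_power2_eq_zero_iff)
  next
    case False
    have "(p $ 1 / \<rho>)\<^sup>2 + (p $ 2 / \<rho>)\<^sup>2 = ((p $ 1)\<^sup>2 + (p $ 2)\<^sup>2) / \<rho>\<^sup>2"
      by (simp add: power_divide add_divide_distrib)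
    also have "\<dots> = 1" unfolding rho2[symmetric] using False by simp
    finally have "(p $ 1 / \<rho>)\<^sup>2 + (p $ 2 / \<rho>)\<^sup>2 = 1" .
    from sincos_total_2pi[OF this] show ?thesis using False by (metis nonzero_mult_div_cancel_left times_divide_eq_right)
  qed
  then obtain a where a: "0 \<le> a" "a < 2 * pi" "p $ 1 = \<rho> * cos a" "p $ 2 = \<rho> * sin a" by blast
  have "circle_point (p $ 3) a = p"
    using a by (simp add: vec_eq_iff forall_3 circle_point_def vector_3 \<rho>_def)
  with that t a show ?thesis by blast
qed

lemma circle_point_eqD:
  assumes "circle_point t a = circle_point t' a'" "t \<in> {-1..1}"
    and "0 \<le> a" "a \<le> 2 * pi" "0 \<le> a'" "a' \<le> 2 * pi"
  shows "t = t' \<and> (t = 1 \<or> t = -1 \<or> a = a' \<or> a = 0 \<and> a' = 2 * pi \<or> a = 2 * pi \<and> a' = 0)"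
proof (intro conjI)
  have eq: "circle_point t a $ i = circle_point t' a' $ i" for i using assms(1) by simp
  show t: "t = t'" using eq[of 3] by (simp add: circle_point_def vector_3)
  show "t = 1 \<or> t = -1 \<or> a = a' \<or> a = 0 \<and> a' = 2 * pi \<or> a = 2 * pi \<and> a' = 0"
  proof (cases "t = 1 \<or> t = -1")
    case False
    then have "1 - t\<^sup>2 \<noteq> 0" by (simp add: power2_eq_1_iff)
    then have "cos a = cos a'" "sin a = sin a'"
      using eq[of 1] eq[of 2] t by (auto simp: circle_point_def vector_3)
    then obtain n :: int where n: "a = a' + 2 * pi * n" using sin_cos_eq_iff by metis
    have le: "2 * pi * real_of_int n \<le> 2 * pi * 1" "2 * pi * (-1) \<le> 2 * pi * real_of_int n"
      using n assms(3-6) by linarith+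
    have "real_of_int n \<le> 1" "-1 \<le> real_of_int n"
      using mult_left_le_imp_le[OF le(1)] mult_left_le_imp_le[OF le(2)] by auto
    then have "n \<le> 1" "-1 \<le> n" by linarith+
    then consider "n = 0" | "n = 1" | "n = -1" by linarith
    then show ?thesis by cases (use n assms in auto)
  qed auto
qed

text \<open>Points with positive inner product are not antipodal, so the segment between them misses
  the origin and projects to the sphere.\<close>

lemma homotopic_maps_S2:
  assumes f: "continuous_on S2 f" "f ` S2 \<subseteq> S2" and g: "continuous_on S2 g" "g ` S2 \<subseteq> (S2 :: (real^3) set)"
    and pos: "\<And>p. p \<in> S2 \<Longrightarrow> f p \<bullet> g p > 0"
  shows "homotopic_with_canon (\<lambda>_. True) S2 S2 f g"
proof -
  have "homotopic_with_canon (\<lambda>_. True) S2 (-{0}) f g"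
  proof (rule homotopic_with_linear[OF f(1) g(1)])
    fix p :: "real^3" assume p: "p \<in> S2"
    have n: "f p \<bullet> f p = 1" "g p \<bullet> g p = 1"
      using f(2) g(2) p by (auto simp: dot_square_norm image_subset_iff)
    \<comment> \<open>Pairing with the sum of the endpoints gives the same positive number all along
      the segment.\<close>
    have "((1 - s) *\<^sub>R f p + s *\<^sub>R g p) \<bullet> (f p + g p) = 1 + f p \<bullet> g p" for s
      using n by (simp add: inner_add inner_commute algebra_simps)
    with pos[OF p] show "closed_segment (f p) (g p) \<subseteq> -{0}"
      by (auto simp: closed_segment_def) (metis add_pos_pos inner_zero_left less_irrefl zero_less_one)
  qed
  then have "homotopic_with_canon (\<lambda>_. True) S2 S2 (sgn \<circ> f) (sgn \<circ> g)"
    by (rule homotopic_with_compose_continuous_left)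
       (use smooth_on_imp_continuous_on[OF smooth_on_sgn] in \<open>auto simp: norm_sgn\<close>)
  then show ?thesis
    by (rule homotopic_with_eq) (use f(2) g(2) in \<open>auto simp: sgn_div_norm image_subset_iff\<close>)
qed

text \<open>The worst case is 1 - 2/5 - 2/5 - 4/25 = 1/25. The tolerances of the sweepout argument
  are chosen to stay within 2/5 of a common vertex.\<close>

lemma inner_pos_if_close:
  fixes a u v :: "'a::real_inner"
  assumes "norm a = 1" "norm (u - a) \<le> 2/5" "norm (v - a) \<le> 2/5"
  shows "u \<bullet> v > 0"
proof -
  have "a \<bullet> a = 1" using assms by (simp add: dot_square_norm)
  then have eq: "u \<bullet> v = 1 + a \<bullet> (v - a) + (u - a) \<bullet> a + (u - a) \<bullet> (v - a)"
    by (simp add: inner_diff algebra_simps)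
  have "\<bar>a \<bullet> (v - a)\<bar> \<le> 2/5" using Cauchy_Schwarz_ineq2[of a "v - a"] assms by simp
  moreover have "\<bar>(u - a) \<bullet> a\<bar> \<le> 2/5" using Cauchy_Schwarz_ineq2[of "u - a" a] assms by simp
  moreover have "\<bar>(u - a) \<bullet> (v - a)\<bar> \<le> (2/5) * (2/5)"
    using Cauchy_Schwarz_ineq2[of "u - a" "v - a"] mult_mono[OF assms(2,3)] by simp
  ultimately show ?thesis unfolding eq by linarith
qed


lemma inner_sgn_pos:
  fixes u v :: "'a::real_inner"
  assumes "u \<bullet> v > 0"
  shows "sgn u \<bullet> sgn v > 0"
proof -
  have "u \<noteq> 0" "v \<noteq> 0" using assms by auto
  then show ?thesis using assms by (simp add: sgn_div_norm)
qed

text \<open>The polygons \<open>X m t\<close> are the sections of a map from the sphere to itself which is homotopic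
  to the identity; if they were all short, this map would factor up to homotopy through an interval.\<close>

lemma sweepout_not_short:
  fixes X :: "nat \<Rightarrow> real \<Rightarrow> nat \<Rightarrow> real^3"
  assumes N: "N > 0" "2 * pi / real N \<le> 1/10"
    and inS: "\<And>m t j. t \<in> {-1..1} \<Longrightarrow> j < N \<Longrightarrow> X m t j \<in> S2"
    and cont: "\<And>m j. j < N \<Longrightarrow> continuous_on {-1..1} (\<lambda>t. X m t j)"
    and init: "\<And>t j. t \<in> {-1..1} \<Longrightarrow> j < N \<Longrightarrow> X 0 t j = circle_point t (2 * pi * (real j / real N))"
    and ends: "\<And>m t j. t = 1 \<or> t = -1 \<Longrightarrow> j < N \<Longrightarrow> X m t j = X m t 0"
    and step: "\<And>m t j. t \<in> {-1..1} \<Longrightarrow> j < N \<Longrightarrow> norm (X (Suc m) t j - X m t j) \<le> 1/10"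
    and edge: "\<And>m t j. t \<in> {-1..1} \<Longrightarrow> j < N \<Longrightarrow> norm (X m t (Suc j mod N) - X m t j) \<le> 1/10"
  shows "\<exists>t\<in>{-1..1}. \<exists>j<N. norm (X m t j - X m t 0) > 1/4"
proof (rule ccontr)
  assume "\<not> ?thesis"
  then have short: "norm (X m t j - X m t 0) \<le> 1/4" if "t \<in> {-1..1}" "j < N" for t j
    using that by force
  define Y where "Y m t j = X m t (j mod N)" for m t j
  define P where "P m x = piecewise_linear (Y m (fst x)) N (snd x)" for m and x :: "real \<times> real"
  \<comment> \<open>\<open>q\<close> wraps the rectangle of heights and vertex parameters around the
    sphere: it identifies the sides u = 0 and u = N and collapses the sides t = 1 and t = -1 to the
    poles. Maps that are constant on its fibres descend to the sphere.\<close>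
  define q where "q x = circle_point (fst x) (2 * pi * (snd x / real N))" for x :: "real \<times> real"
  define K where "K = ({-1..1} :: real set) \<times> {0..real N}"
  have K: "compact K" unfolding K_def by (intro compact_Times) auto
  have unit: "norm (X m t j) = 1" if "t \<in> {-1..1}" "j < N" for m t j
    using inS[OF that] by simp
  have near: "norm (P m (t, u) - X m t k) \<le> 1/10"
    if "t \<in> {-1..1}" "k < N" "real k \<le> u" "u \<le> real k + 1" for m t u k
    using norm_piecewise_linear_diff_le[OF that(2-4), of "Y m t"] edge[OF that(1,2), of m] that(2)
    by (simp add: P_def Y_def)
  have qcont: "continuous_on K q"
    unfolding q_def by (intro continuous_on_circle_point continuous_intros) (use N in auto)
  have Pcont: "continuous_on K (P m)" for m
  proof -
    have "continuous_on K (\<lambda>x. Y m (fst x) j)" for j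
      unfolding Y_def using N
      by (intro continuous_on_compose2[OF cont[of "j mod N" m], of K fst]) (auto simp: K_def intro!: continuous_intros)
    then show ?thesis
      unfolding P_def piecewise_linear_def by (intro continuous_intros)
  qed
  have Pnz: "P m x \<noteq> 0" if "x \<in> K" for m x
  proof
    assume 0: "P m x = 0"
    obtain t u where tu: "x = (t, u)" by fastforce
    with that have x: "x = (t, u)" "t \<in> {-1..1}" "0 \<le> u" "u \<le> real N" by (auto simp: K_def)
    obtain k where k: "k < N" "real k \<le> u" "u \<le> real k + 1" using ex_segment x N by metis
    show False using near[OF x(2) k, of m] 0 x unit[OF x(2) k(1), of m] by simp
  qed
  have qK: "q ` K = S2"
  proof (intro set_eqI iffI)
    fix p assume "p \<in> q ` K"
    then show "p \<in> S2" unfolding q_def K_def using circle_point_in_S2 by auto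
  next
    fix p :: "real^3" assume "p \<in> S2"
    then obtain t a where ta: "t \<in> {-1..1}" "0 \<le> a" "a < 2 * pi" "circle_point t a = p"
      using circle_point_surj by metis
    then have "(t, real N * (a / (2 * pi))) \<in> K" "q (t, real N * (a / (2 * pi))) = p"
      using N mult_left_mono[of "a / (2 * pi)" 1 "real N"] by (auto simp: K_def q_def)
    then show "p \<in> q ` K" by force
  qed
  \<comment> \<open>A polygon closes up because vertex indices are taken modulo \<open>N\<close>,
    and at the poles it is constant by \<open>ends\<close>.\<close>
  have fib: "sgn (P m x) = sgn (P m y)" if "x \<in> K" "y \<in> K" "q x = q y" for m x y
  proof -
    obtain t u t' u' where x: "x = (t, u)" and y: "y = (t', u')" by fastforce
    have t: "t \<in> {-1..1}" and u: "0 \<le> u" "u \<le> real N" "0 \<le> u'" "u' \<le> real N"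
      using that by (auto simp: K_def x y)
    have a: "0 \<le> 2 * pi * (v / real N)" "2 * pi * (v / real N) \<le> 2 * pi" if "0 \<le> v" "v \<le> real N" for v
      using that N by (auto simp: divide_le_eq)
    have eqs: "2 * pi * (v / real N) = 0 \<longleftrightarrow> v = 0" "2 * pi * (v / real N) = 2 * pi \<longleftrightarrow> v = real N"
      "2 * pi * (v / real N) = 2 * pi * (v' / real N) \<longleftrightarrow> v = v'" for v v'
      using N by (auto simp: field_simps)
    have tt: "t = t'" and cs: "t = 1 \<or> t = -1 \<or> u = u' \<or> u = 0 \<and> u' = real N \<or> u = real N \<and> u' = 0"
      using circle_point_eqD[OF that(3)[unfolded q_def x y fst_conv snd_conv] t a[OF u(1,2)] a[OF u(3,4)]]
      unfolding eqs by auto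
    have P0: "P m (t, 0) = X m t 0" using N by (simp add: P_def Y_def piecewise_linear_segment[of 0])
    have PN: "P m (t, real N) = X m t 0" using N by (simp add: P_def Y_def piecewise_linear_beyond)
    have Pe: "P m (t, v) = X m t 0" if "t = 1 \<or> t = -1" for v
    proof -
      have "Y m t j = X m t 0" for j unfolding Y_def by (rule ends[OF that]) (use N in simp)
      then show ?thesis by (simp add: P_def piecewise_linear_def)
    qed
    show ?thesis
      using cs P0 PN Pe[of u] Pe[of u'] unfolding x y tt[symmetric] by auto
  qed
  have "\<exists>h. continuous_on S2 h \<and> (\<forall>x\<in>K. h (q x) = sgn (P m x))" for m
  proof -
    have "continuous_on K (\<lambda>x. sgn (P m x))"
      using Pnz by (intro continuous_intros Pcont) auto
    from continuous_on_quotient[OF K qcont this fib] show ?thesis unfolding qK by metis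
  qed
  then obtain h where hc: "\<And>m. continuous_on S2 (h m)" and hq: "\<And>m x. x \<in> K \<Longrightarrow> h m (q x) = sgn (P m x)"
    by metis
  have rep: "\<exists>t u k. t \<in> {-1..1} \<and> (t, u) \<in> K \<and> p = q (t, u) \<and> k < N \<and> real k \<le> u \<and> u \<le> real k + 1"
    if "p \<in> S2" for p
  proof -
    have "p \<in> q ` K" using that by (simp only: qK)
    then obtain t u where tu: "(t, u) \<in> K" "p = q (t, u)" by auto
    then have "t \<in> {-1..1}" "0 \<le> u" "u \<le> real N" by (auto simp: K_def)
    moreover obtain k where "k < N" "real k \<le> u" "u \<le> real k + 1"
      using ex_segment[of u N] calculation N by metis
    ultimately show ?thesis using tu by blast
  qed
  have hS: "h m ` S2 \<subseteq> S2" for m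
  proof -
    have "h m p \<in> S2" if p: "p \<in> S2" for p
    proof -
      obtain x where "x \<in> K" "p = q x" using p qK by blast
      then show ?thesis using hq Pnz by (simp add: norm_sgn)
    qed
    then show ?thesis by blast
  qed
  \<comment> \<open>Vertex \<open>k\<close> of the inscribed polygon is within 1/10 both of the
    point of the parallel and of the point of the polygon.\<close>
  have start: "homotopic_with_canon (\<lambda>_. True) S2 S2 id (h 0)"
  proof (rule homotopic_maps_S2)
    fix p :: "real^3" assume "p \<in> S2"
    then obtain t u k where *: "t \<in> {-1..1}" "(t, u) \<in> K" "p = q (t, u)" "k < N" "real k \<le> u" "u \<le> real k + 1"
      using rep by blast
    have "norm (p - X 0 t k) \<le> \<bar>2 * pi * (u / real N) - 2 * pi * (real k / real N)\<bar>"
      unfolding *(3) q_def init[OF *(1,4)] fst_conv snd_conv by (rule norm_circle_point_diff[OF *(1)])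
    also have "2 * pi * (u / real N) - 2 * pi * (real k / real N) = (2 * pi / real N) * (u - real k)"
      by (simp add: right_diff_distrib)
    also have "\<bar>(2 * pi / real N) * (u - real k)\<bar> = (2 * pi / real N) * (u - real k)" using * by simp
    also have "\<dots> \<le> (1/10) * 1" using * N by (intro mult_mono) auto
    finally have "sgn p \<bullet> sgn (P 0 (t, u)) > 0"
      using near[OF *(1,4-6), of 0] unit[OF *(1,4), of 0]
      by (intro inner_sgn_pos inner_pos_if_close[of "X 0 t k"]) auto
    then show "id p \<bullet> h 0 p > 0" using hq[OF *(2), of 0] *(3) \<open>p \<in> S2\<close> by (simp add: sgn_div_norm)
  qed (use hc hS in auto)
  \<comment> \<open>Vertex \<open>k\<close> before the step is the common reference; the polygon
    after the step stays within 1/10 + 1/10 of it.\<close>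
  have next_m: "homotopic_with_canon (\<lambda>_. True) S2 S2 (h m) (h (Suc m))" for m
  proof (rule homotopic_maps_S2)
    fix p :: "real^3" assume "p \<in> S2"
    then obtain t u k where *: "t \<in> {-1..1}" "(t, u) \<in> K" "p = q (t, u)" "k < N" "real k \<le> u" "u \<le> real k + 1"
      using rep by blast
    have "norm (P (Suc m) (t, u) - X m t k) \<le> 1/10 + 1/10"
      using norm_triangle_mono[OF near[OF *(1,4-6), of "Suc m"] step[OF *(1,4), of m]] by simp
    then have "sgn (P m (t, u)) \<bullet> sgn (P (Suc m) (t, u)) > 0"
      using near[OF *(1,4-6), of m] unit[OF *(1,4), of m]
      by (intro inner_sgn_pos inner_pos_if_close[of "X m t k"]) auto
    then show "h m p \<bullet> h (Suc m) p > 0" using hq[OF *(2)] *(3) by simp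
  qed (use hc hS in auto)
  have all_m: "homotopic_with_canon (\<lambda>_. True) S2 S2 id (h m)" for m
    by (induction m) (use start next_m homotopic_with_trans in blast)+
  \<comment> \<open>If all polygons are short, each is close to its vertex 0. Sending the whole
    parallel at height t to that vertex gives a map that factors through an interval, hence is
    null-homotopic.\<close>
  define c where "c = (\<lambda>t. X m t 0) \<circ> (\<lambda>p::real^3. p $ 3)"
  have p3: "p $ 3 \<in> {-1..1}" if "p \<in> S2" for p :: "real^3"
    using component_le_norm_cart[of p 3] that by auto
  have ccont: "continuous_on S2 c"
    unfolding c_def o_def using p3 N
    by (intro continuous_on_compose2[OF cont[of 0 m]]) (auto intro!: continuous_intros)
  have "homotopic_with_canon (\<lambda>_. True) S2 S2 (h m) c"
  proof (rule homotopic_maps_S2)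
    fix p :: "real^3" assume "p \<in> S2"
    then obtain t u k where *: "t \<in> {-1..1}" "(t, u) \<in> K" "p = q (t, u)" "k < N" "real k \<le> u" "u \<le> real k + 1"
      using rep by blast
    have cp: "c p = X m t 0" by (simp add: c_def *(3) q_def circle_point_def vector_3)
    have "sgn (P m (t, u)) \<bullet> sgn (X m t 0) > 0"
      using near[OF *(1,4-6), of m] unit[OF *(1,4), of m] short[OF *(1,4)] norm_minus_commute[of "X m t 0" "X m t k"]
      by (intro inner_sgn_pos inner_pos_if_close[of "X m t k"]) auto
    moreover have "sgn (X m t 0) = X m t 0" using unit[OF *(1) N(1), of m] by (simp add: sgn_div_norm)
    ultimately show "h m p \<bullet> c p > 0" using hq[OF *(2), of m] *(3) cp by simp
  qed (use hc hS ccont inS p3 N in \<open>auto simp: c_def\<close>)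
  then have "homotopic_with_canon (\<lambda>_. True) S2 S2 id c"
    using all_m homotopic_with_trans by blast
  moreover obtain a where "homotopic_with_canon (\<lambda>h. True) S2 S2 c (\<lambda>x. a)"
    unfolding c_def
  proof (rule nullhomotopic_through_contractible)
    show "continuous_on S2 (\<lambda>p::real^3. p $ 3)" by (intro continuous_intros)
    show "(\<lambda>p. p $ 3) \<in> S2 \<rightarrow> {-1..1}" using p3 by blast
    show "continuous_on {-1..1} (\<lambda>t. X m t 0)" using cont N by blast
    show "(\<lambda>t. X m t 0) \<in> {-1..1} \<rightarrow> S2" using inS N by blast
    show "contractible {-1..1::real}" by (intro convex_imp_contractible) auto
  qed
  ultimately have "contractible S2"
    unfolding contractible_def using homotopic_with_trans by blast
  then show False by (simp add: contractible_sphere)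
qed

section \<open>Shortening a polygon at one vertex\<close>

lemma bounded_bilinear_matrix_vector_mult:
  "bounded_bilinear (\<lambda>(A::real^'n^'m) v. A *v v)"
  unfolding bilinear_conv_bounded_bilinear[symmetric] bilinear_def
  by (auto intro!: linearI simp: matrix_vector_mult_add_rdistrib matrix_vector_right_distrib
      scaleR_matrix_vector_assoc matrix_vector_mult_scaleR)

lemma matrix_vector_mult_minus: "(A::real^'n^'m) *v (- v) = - (A *v v)"
  using matrix_vector_mult_diff_distrib[of A 0 v] by simp

lemma S2_nonzero: "x \<in> S2 \<Longrightarrow> x \<noteq> 0"
  by auto

text \<open>Constancy along rays makes \<open>M\<close> a smooth field on an open set, with no
  variation in the normal direction. The eigenvalue \<open>r\<^sup>2\<close> on the normal line is
  compatible with both bounds and makes the normal component of the momentum computable.\<close>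

locale metric_matrix =
  fixes M :: "real^3 \<Rightarrow> real^3^3" and r R :: real
  assumes smooth_M: "smooth_on (-{0}) M"
    and M_scale: "\<And>s x. 0 < s \<Longrightarrow> M (s *\<^sub>R x) = M x"
    and M_sym: "\<And>x u w. x \<in> S2 \<Longrightarrow> u \<bullet> (M x *v w) = w \<bullet> (M x *v u)"
    and r_pos: "0 < r"
    and M_lower: "\<And>x u. x \<in> S2 \<Longrightarrow> r\<^sup>2 * (u \<bullet> u) \<le> u \<bullet> (M x *v u)"
    and M_upper: "\<And>x u. x \<in> S2 \<Longrightarrow> u \<bullet> (M x *v u) \<le> R\<^sup>2 * (u \<bullet> u)"
    and M_normal: "\<And>x. x \<in> S2 \<Longrightarrow> M x *v x = r\<^sup>2 *\<^sub>R x"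
begin

text \<open>The form is frozen at the initial vertex, so the chord is not symmetric in its ends; the
  two versions differ by third order in the edge.\<close>

definition chord :: "real^3 \<Rightarrow> real^3 \<Rightarrow> real" where
  "chord a b = (b - a) \<bullet> (M a *v (b - a))"

definition DM :: "real^3 \<Rightarrow> real^3 \<Rightarrow> real^3^3" where
  "DM x \<xi> = frechet_derivative M (at x) \<xi>"

lemma M_has_derivative: "x \<noteq> 0 \<Longrightarrow> (M has_derivative DM x) (at x)"
  unfolding DM_def using smooth_on_has_derivative[OF smooth_M, of x] by simp

lemma chord_nonneg: "a \<in> S2 \<Longrightarrow> 0 \<le> chord a b"
  unfolding chord_def using M_lower[of a "b - a"] by (smt (verit) inner_ge_zero mult_nonneg_nonneg zero_le_power2)

lemma norm_le_chord: "a \<in> S2 \<Longrightarrow> r\<^sup>2 * (norm (b - a))\<^sup>2 \<le> chord a b"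
  unfolding chord_def using M_lower[of a "b - a"] by (simp add: dot_square_norm)

lemma chord_le_norm: "a \<in> S2 \<Longrightarrow> chord a b \<le> R\<^sup>2 * (norm (b - a))\<^sup>2"
  unfolding chord_def using M_upper[of a "b - a"] by (simp add: dot_square_norm)

text \<open>Normalizing the middle vertex inside the function gives a smooth function on an open
  subset of Euclidean space that is constant in the radial direction of \<open>y\<close>; its
  ordinary gradient in \<open>y\<close> is then tangent to the sphere.\<close>

definition vertex_energy :: "(real^3) \<times> (real^3) \<times> (real^3) \<Rightarrow> real" where
  "vertex_energy = (\<lambda>(a, y, b). chord a (sgn y) + chord (sgn y) b)"

lemma M_sgn: "y \<noteq> 0 \<Longrightarrow> M (sgn y) = M y"
  unfolding sgn_div_norm using M_scale[of "inverse (norm y)" y] by simp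

lemma smooth_vertex_energy: "smooth_on {z. fst z \<noteq> 0 \<and> fst (snd z) \<noteq> 0} vertex_energy"
proof -
  let ?U = "{z::(real^3) \<times> (real^3) \<times> (real^3). fst z \<noteq> 0 \<and> fst (snd z) \<noteq> 0}"
  have o: "open ?U"
    unfolding Collect_conj_eq by (intro open_Int open_Collect_neq continuous_intros)
  have p: "smooth_on ?U (\<lambda>z. fst z)" "smooth_on ?U (\<lambda>z. fst (snd z))" "smooth_on ?U (\<lambda>z. snd (snd z))"
    by (intro bounded_linear_imp_smooth_on[OF o] bounded_linear_intros)+
  have s: "smooth_on ?U (\<lambda>z. sgn (fst (snd z)))"
    by (rule smooth_on_compose[OF o _ smooth_on_sgn p(2)]) auto
  have M1: "smooth_on ?U (\<lambda>z. M (fst z))"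
    by (rule smooth_on_compose[OF o _ smooth_M p(1)]) auto
  have M2: "smooth_on ?U (\<lambda>z. M (fst (snd z)))"
    by (rule smooth_on_compose[OF o _ smooth_M p(2)]) auto
  have d: "smooth_on ?U (\<lambda>z. sgn (fst (snd z)) - fst z)" "smooth_on ?U (\<lambda>z. snd (snd z) - sgn (fst (snd z)))"
    by (intro smooth_on_diff[OF o] p s)+
  have "smooth_on ?U (\<lambda>z. (sgn (fst (snd z)) - fst z) \<bullet> (M (fst z) *v (sgn (fst (snd z)) - fst z)) +
      (snd (snd z) - sgn (fst (snd z))) \<bullet> (M (fst (snd z)) *v (snd (snd z) - sgn (fst (snd z)))))"
    by (intro smooth_on_add[OF o] smooth_on_bilinear[OF o bounded_bilinear_inner]
        smooth_on_bilinear[OF o bounded_bilinear_matrix_vector_mult] d M1 M2)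
  then show ?thesis
    by (rule smooth_on_cong[OF _ o]) (auto simp: vertex_energy_def chord_def M_sgn)
qed

text \<open>The vertex moves along \<open>sgn (y + s *\<^sub>R \<xi>)\<close>, which has velocity
  \<open>\<xi>\<close> at 0 because \<open>\<xi>\<close> is tangent. Since \<open>M\<close> is
  constant along rays it may be evaluated at the unnormalized point, whose path is a line.\<close>

lemma vertex_energy_derivative:
  assumes y: "y \<in> S2" and a: "a \<in> S2" and \<xi>: "\<xi> \<bullet> y = 0"
  shows "frechet_derivative vertex_energy (at (a, y, b)) (0, \<xi>, 0) =
    (b - y) \<bullet> (DM y \<xi> *v (b - y)) - 2 * (\<xi> \<bullet> (M y *v (b - y))) + 2 * (\<xi> \<bullet> (M a *v (y - a)))"
proof -
  define \<sigma> where "\<sigma> s = inverse (sqrt (1 + s\<^sup>2 * (\<xi> \<bullet> \<xi>))) *\<^sub>R (y + s *\<^sub>R \<xi>)" for s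
  have yy: "y \<bullet> y = 1" using y by (simp add: dot_square_norm)
  have nrm: "norm (y + s *\<^sub>R \<xi>) = sqrt (1 + s\<^sup>2 * (\<xi> \<bullet> \<xi>))" for s
    using \<xi> yy by (simp add: norm_eq_sqrt_inner inner_add inner_commute power2_eq_square algebra_simps)
  have nz: "y + s *\<^sub>R \<xi> \<noteq> 0" for s
    using nrm[of s] by (smt (verit) inner_ge_zero mult_nonneg_nonneg norm_zero real_sqrt_eq_zero_cancel_iff zero_le_power2)
  have sg: "sgn (y + s *\<^sub>R \<xi>) = \<sigma> s" for s by (simp add: sgn_div_norm nrm \<sigma>_def)
  have d\<sigma>: "(\<sigma> has_vector_derivative \<xi>) (at 0)"
    unfolding \<sigma>_def has_vector_derivative_def
    by (auto intro!: derivative_eq_intros simp: fun_eq_iff)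
  have dM: "((\<lambda>s. M (y + s *\<^sub>R \<xi>)) has_vector_derivative DM y \<xi>) (at 0)"
    using y by (intro has_vector_derivative_along_line) (use M_has_derivative[OF S2_nonzero[OF y]] in simp)
  have \<sigma>0: "\<sigma> 0 = y" by (simp add: \<sigma>_def)
  have d1: "((\<lambda>s. \<sigma> s - a) has_vector_derivative \<xi>) (at 0)" "((\<lambda>s. b - \<sigma> s) has_vector_derivative (- \<xi>)) (at 0)"
    using has_vector_derivative_diff[OF d\<sigma> has_vector_derivative_const[of a]]
      has_vector_derivative_diff[OF has_vector_derivative_const[of b] d\<sigma>] by simp_all
  have d2: "((\<lambda>s. (\<sigma> s - a) \<bullet> (M a *v (\<sigma> s - a))) has_vector_derivative
      (y - a) \<bullet> (M a *v \<xi>) + \<xi> \<bullet> (M a *v (y - a))) (at 0)"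
    using bounded_bilinear.has_vector_derivative[OF bounded_bilinear_inner d1(1)
        bounded_bilinear.has_vector_derivative[OF bounded_bilinear_matrix_vector_mult has_vector_derivative_const[of "M a"] d1(1)]]
    by (simp add: \<sigma>0)
  have d3: "((\<lambda>s. (b - \<sigma> s) \<bullet> (M (y + s *\<^sub>R \<xi>) *v (b - \<sigma> s))) has_vector_derivative
      (b - y) \<bullet> (M y *v (- \<xi>) + DM y \<xi> *v (b - y)) + (- \<xi>) \<bullet> (M y *v (b - y))) (at 0)"
    using bounded_bilinear.has_vector_derivative[OF bounded_bilinear_inner d1(2)
        bounded_bilinear.has_vector_derivative[OF bounded_bilinear_matrix_vector_mult dM d1(2)]]
    by (simp add: \<sigma>0)
  have eq: "vertex_energy ((a, y, b) + s *\<^sub>R (0, \<xi>, 0)) =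
      (\<sigma> s - a) \<bullet> (M a *v (\<sigma> s - a)) + (b - \<sigma> s) \<bullet> (M (y + s *\<^sub>R \<xi>) *v (b - \<sigma> s))" for s
    using M_sgn[OF nz[of s]] by (simp add: vertex_energy_def chord_def sg)
  have "((\<lambda>s. vertex_energy ((a, y, b) + s *\<^sub>R (0, \<xi>, 0))) has_real_derivative
      frechet_derivative vertex_energy (at (a, y, b)) (0, \<xi>, 0)) (at 0)"
    by (intro has_real_derivative_along_line)
       (use smooth_on_has_derivative[OF smooth_vertex_energy, of "(a, y, b)"] S2_nonzero[OF a] S2_nonzero[OF y] in simp)
  moreover have "((\<lambda>s. vertex_energy ((a, y, b) + s *\<^sub>R (0, \<xi>, 0))) has_real_derivative
      ((y - a) \<bullet> (M a *v \<xi>) + \<xi> \<bullet> (M a *v (y - a))) +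
      ((b - y) \<bullet> (M y *v (- \<xi>) + DM y \<xi> *v (b - y)) + (- \<xi>) \<bullet> (M y *v (b - y)))) (at 0)"
    unfolding eq has_real_derivative_iff_has_vector_derivative by (rule has_vector_derivative_add[OF d2 d3])
  ultimately have "frechet_derivative vertex_energy (at (a, y, b)) (0, \<xi>, 0) =
      ((y - a) \<bullet> (M a *v \<xi>) + \<xi> \<bullet> (M a *v (y - a))) +
      ((b - y) \<bullet> (M y *v (- \<xi>) + DM y \<xi> *v (b - y)) + (- \<xi>) \<bullet> (M y *v (b - y)))"
    by (rule DERIV_unique)
  also have "(y - a) \<bullet> (M a *v \<xi>) = \<xi> \<bullet> (M a *v (y - a))" by (rule M_sym[OF a])
  also have "(b - y) \<bullet> (M y *v (- \<xi>) + DM y \<xi> *v (b - y)) =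
      (b - y) \<bullet> (DM y \<xi> *v (b - y)) - \<xi> \<bullet> (M y *v (b - y))"
    unfolding matrix_vector_mult_minus inner_add_right inner_minus_right M_sym[OF y, of "b - y" \<xi>] by simp
  finally show ?thesis by simp
qed

text \<open>A gradient step of fixed size is followed by projection to the sphere. It loses at least
  \<open>\<tau> / 2\<close> times the squared gradient, so equal energies force a critical vertex;
  the fixed size makes the step continuous in all three vertices.\<close>

lemma vertex_step:
  obtains S :: "real^3 \<Rightarrow> real^3 \<Rightarrow> real^3 \<Rightarrow> real^3" where
    "\<And>a y b. a \<in> S2 \<Longrightarrow> y \<in> S2 \<Longrightarrow> b \<in> S2 \<Longrightarrow> S a y b \<in> S2"
    "continuous_on (S2 \<times> S2 \<times> S2) (\<lambda>(a, y, b). S a y b)"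
    "\<And>a y b. a \<in> S2 \<Longrightarrow> y \<in> S2 \<Longrightarrow> b \<in> S2 \<Longrightarrow> chord a (S a y b) + chord (S a y b) b \<le> chord a y + chord y b"
    "\<And>a y b. a \<in> S2 \<Longrightarrow> y \<in> S2 \<Longrightarrow> b \<in> S2 \<Longrightarrow> chord a (S a y b) + chord (S a y b) b = chord a y + chord y b \<Longrightarrow> S a y b = y"
    "\<And>a y b \<xi>. a \<in> S2 \<Longrightarrow> y \<in> S2 \<Longrightarrow> b \<in> S2 \<Longrightarrow> S a y b = y \<Longrightarrow> \<xi> \<bullet> y = 0 \<Longrightarrow>
      (b - y) \<bullet> (DM y \<xi> *v (b - y)) - 2 * (\<xi> \<bullet> (M y *v (b - y))) + 2 * (\<xi> \<bullet> (M a *v (y - a))) = 0"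
    "\<And>a y b. a \<in> S2 \<Longrightarrow> y \<in> S2 \<Longrightarrow> b \<in> S2 \<Longrightarrow> norm (S a y b - y) \<le> 1/10"
proof -
  let ?U = "{z::(real^3) \<times> (real^3) \<times> (real^3). fst z \<noteq> 0 \<and> fst (snd z) \<noteq> 0}"
  let ?E = "vertex_energy"
  let ?S3 = "S2 \<times> S2 \<times> S2"
  have o: "open ?U"
    unfolding Collect_conj_eq by (intro open_Int open_Collect_neq continuous_intros)
  \<comment> \<open>Subtracting a tangent vector from a unit vector does not shorten it, and the
    step is short; hence the segments of all steps stay in the shell of radii 1 and 2.\<close>
  define K where "K = S2 \<times> (cball 0 2 - ball 0 1 :: (real^3) set) \<times> S2"
  have K: "compact K" "K \<subseteq> ?U"
    unfolding K_def by (auto intro!: compact_Times compact_diff)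
  obtain L where L: "L > 0" and
    Lb: "\<And>z w. closed_segment z (z + w) \<subseteq> K \<Longrightarrow> ?E (z + w) \<le> ?E z + frechet_derivative ?E (at z) w + L * (norm w)\<^sup>2"
    using quadratic_upper_bound[OF smooth_vertex_energy o K] by metis
  define \<eta> where "\<eta> z = (\<Sum>i\<in>Basis. frechet_derivative ?E (at z) (0, i, 0) *\<^sub>R i)" for z
  have \<eta>D: "frechet_derivative ?E (at z) (0, w, 0) = \<eta> z \<bullet> w" if "z \<in> ?U" for z w
  proof -
    have l: "linear (frechet_derivative ?E (at z))"
      using smooth_on_has_derivative[OF smooth_vertex_energy that] has_derivative_linear by blast
    have "linear (\<lambda>w::real^3. (0::real^3, w, 0::real^3))" by (rule linearI) auto
    from linear_compose[OF this l] have l2: "linear (\<lambda>w. frechet_derivative ?E (at z) (0, w, 0))"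
      by (simp add: o_def)
    have "frechet_derivative ?E (at z) (0, w, 0) = frechet_derivative ?E (at z) (0, (\<Sum>i\<in>Basis. (w \<bullet> i) *\<^sub>R i), 0)"
      by (simp add: euclidean_representation)
    also have "\<dots> = (\<Sum>i\<in>Basis. (w \<bullet> i) * frechet_derivative ?E (at z) (0, i, 0))"
      using linear_sum[OF l2, of "\<lambda>i. (w \<bullet> i) *\<^sub>R i" Basis] linear_cmul[OF l2] by simp
    also have "\<dots> = \<eta> z \<bullet> w"
      unfolding \<eta>_def inner_sum_left inner_scaleR_left
      by (intro sum.cong refl) (simp only: inner_commute mult.commute)
    finally show ?thesis .
  qed
  have inU: "(a, y, b) \<in> ?U" if "a \<in> S2" "y \<in> S2" for a y b
    using S2_nonzero[OF that(1)] S2_nonzero[OF that(2)] by simp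
  have \<eta>cont: "continuous_on ?S3 \<eta>"
    unfolding \<eta>_def
    by (intro continuous_on_sum continuous_on_scaleR continuous_on_const
        continuous_on_subset[OF smooth_on_imp_continuous_on[OF smooth_on_frechet_derivative[OF smooth_vertex_energy]]])
       auto
  have "compact ?S3" by (intro compact_Times) auto
  from compact_imp_bounded[OF compact_continuous_image[OF \<eta>cont this]]
  obtain B where B: "B > 0" "\<And>z. z \<in> ?S3 \<Longrightarrow> norm (\<eta> z) \<le> B"
    unfolding bounded_pos by auto
  \<comment> \<open>The first bound makes the quadratic error at most half of the gain; the second
    keeps the step within 1/20, hence within 1/10 after projection.\<close>
  define \<tau> where "\<tau> = min (1 / (2 * L)) (1 / (20 * B))"
  have \<tau>: "\<tau> > 0" "L * \<tau> \<le> 1/2" "\<tau> * B \<le> 1/20"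
    using L B by (auto simp: \<tau>_def min_def field_simps)
  \<comment> \<open>The energy is constant in the radial direction of \<open>y\<close>, so the
    gradient is tangent.\<close>
  have \<eta>y: "\<eta> (a, y, b) \<bullet> y = 0" if "a \<in> S2" "y \<in> S2" for a y b
  proof -
    have "((\<lambda>s. ?E ((a, y, b) + s *\<^sub>R (0, y, 0))) has_real_derivative
        frechet_derivative ?E (at (a, y, b)) (0, y, 0)) (at 0)"
      by (intro has_real_derivative_along_line)
         (use smooth_on_has_derivative[OF smooth_vertex_energy, of "(a, y, b)"] S2_nonzero[OF that(1)] S2_nonzero[OF that(2)] in simp)
    moreover have "((\<lambda>s. ?E ((a, y, b) + s *\<^sub>R (0, y, 0))) has_real_derivative 0) (at 0)"
    proof (rule has_field_derivative_transform_within_open[of "\<lambda>s. ?E (a, y, b)" _ _ "{-1<..}"])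
      fix s :: real assume "s \<in> {-1<..}"
      then have s: "0 < 1 + s" by simp
      have "sgn (y + s *\<^sub>R y) = sgn ((1 + s) *\<^sub>R y)" by (simp add: algebra_simps)
      also have "\<dots> = sgn y" using s by (simp only: sgn_scaleR sgn_pos scaleR_one)
      finally show "?E (a, y, b) = ?E ((a, y, b) + s *\<^sub>R (0, y, 0))" by (simp add: vertex_energy_def)
    qed auto
    ultimately have "frechet_derivative ?E (at (a, y, b)) (0, y, 0) = 0" by (rule DERIV_unique)
    then show ?thesis using \<eta>D[OF inU[OF that], of b y] by simp
  qed
  define S where "S a y b = sgn (y - \<tau> *\<^sub>R \<eta> (a, y, b))" for a y b
  have nrm: "norm (y - s *\<^sub>R \<eta> (a, y, b)) \<ge> 1" if "a \<in> S2" "y \<in> S2" for a y b s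
  proof -
    let ?e = "\<eta> (a, y, b)"
    have "(y - s *\<^sub>R ?e) \<bullet> (y - s *\<^sub>R ?e) = y \<bullet> y - 2 * s * (?e \<bullet> y) + (s * s) * (?e \<bullet> ?e)"
      by (simp add: inner_diff inner_commute algebra_simps)
    then have "1 \<le> (norm (y - s *\<^sub>R ?e))\<^sup>2"
      using \<eta>y[OF that, of b] that by (simp add: power2_norm_eq_inner norm_eq_1)
    then show ?thesis using abs_le_square_iff[of 1 "norm (y - s *\<^sub>R ?e)"] by simp
  qed
  have nz: "y - s *\<^sub>R \<eta> (a, y, b) \<noteq> 0" if "a \<in> S2" "y \<in> S2" for a y b s
    using nrm[OF that, of s b] by auto
  have SS: "S a y b \<in> S2" if "a \<in> S2" "y \<in> S2" "b \<in> S2" for a y b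
    using nz[OF that(1,2), of \<tau> b] by (simp add: S_def norm_sgn)
  have small: "norm (\<tau> *\<^sub>R \<eta> (a, y, b)) \<le> 1/20" if "a \<in> S2" "y \<in> S2" "b \<in> S2" for a y b
  proof -
    have "norm (\<eta> (a, y, b)) \<le> B" using that by (intro B(2)) auto
    then have "\<tau> * norm (\<eta> (a, y, b)) \<le> \<tau> * B" using \<tau>(1) by (intro mult_left_mono) auto
    moreover have "norm (\<tau> *\<^sub>R \<eta> (a, y, b)) = \<tau> * norm (\<eta> (a, y, b))" using \<tau>(1) by simp
    ultimately show ?thesis using \<tau>(3) by linarith
  qed
  have dec: "chord a (S a y b) + chord (S a y b) b \<le> chord a y + chord y b - \<tau> / 2 * (norm (\<eta> (a, y, b)))\<^sup>2"
    if "a \<in> S2" "y \<in> S2" "b \<in> S2" for a y b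
  proof -
    let ?e = "\<eta> (a, y, b)"
    have "closed_segment (a, y, b) ((a, y, b) + (0, - \<tau> *\<^sub>R ?e, 0)) \<subseteq> K"
    proof
      fix z assume "z \<in> closed_segment (a, y, b) ((a, y, b) + (0, - \<tau> *\<^sub>R ?e, 0))"
      then obtain u where u: "0 \<le> u" "u \<le> 1" "z = (1 - u) *\<^sub>R (a, y, b) + u *\<^sub>R ((a, y, b) + (0, - \<tau> *\<^sub>R ?e, 0))"
        by (auto simp: closed_segment_def)
      then have z: "z = (a, y - (u * \<tau>) *\<^sub>R ?e, b)" by (simp add: algebra_simps)
      have "norm ((u * \<tau>) *\<^sub>R ?e) = u * norm (\<tau> *\<^sub>R ?e)" using u \<tau> by (simp add: abs_mult)
      also have "\<dots> \<le> 1 * 1" using u small[OF that] by (intro mult_mono) auto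
      finally have "norm (y - (u * \<tau>) *\<^sub>R ?e) \<le> 2"
        using norm_triangle_ineq4[of y "(u * \<tau>) *\<^sub>R ?e"] that by simp
      then show "z \<in> K" using that nrm[OF that(1,2), of "u * \<tau>" b] by (simp add: K_def z)
    qed
    from Lb[OF this] have "?E (a, y - \<tau> *\<^sub>R ?e, b) \<le> ?E (a, y, b) - \<tau> * (?e \<bullet> ?e) + L * (\<tau> * norm ?e)\<^sup>2"
      using \<eta>D[OF inU[OF that(1,2)], of b "- \<tau> *\<^sub>R ?e"] \<tau> by (simp add: norm_Pair)
    also have "\<dots> = ?E (a, y, b) - \<tau> * (norm ?e)\<^sup>2 + (L * \<tau>) * (\<tau> * (norm ?e)\<^sup>2)"
      by (simp add: dot_square_norm power2_eq_square algebra_simps)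
    also have "\<dots> \<le> ?E (a, y, b) - \<tau> * (norm ?e)\<^sup>2 + (1/2) * (\<tau> * (norm ?e)\<^sup>2)"
      using \<tau> by (intro add_left_mono mult_right_mono) auto
    finally have "?E (a, y - \<tau> *\<^sub>R ?e, b) \<le> ?E (a, y, b) - \<tau> / 2 * (norm ?e)\<^sup>2" by simp
    then show ?thesis using that by (simp add: vertex_energy_def S_def sgn_div_norm)
  qed
  have stay: "S a y b = y \<Longrightarrow> \<eta> (a, y, b) = 0" if "a \<in> S2" "y \<in> S2" "b \<in> S2" for a y b
    using dec[OF that] \<tau> by (simp add: mult_le_0_iff)
  have stay': "S a y b = y" if "\<eta> (a, y, b) = 0" "y \<in> S2" for a y b
    using that by (simp add: S_def sgn_div_norm)
  show ?thesis
  proof (rule that[of S])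
    show "continuous_on ?S3 (\<lambda>(a, y, b). S a y b)"
      unfolding S_def case_prod_unfold using nz
      by (intro continuous_intros continuous_on_compose2[OF \<eta>cont]) (auto simp: mem_Times_iff)
  next
    fix a y b :: "real^3" assume *: "a \<in> S2" "y \<in> S2" "b \<in> S2"
    show "S a y b \<in> S2" using SS * by blast
    show "chord a (S a y b) + chord (S a y b) b \<le> chord a y + chord y b"
      using dec[OF *] \<tau> by (smt (verit) divide_pos_pos mult_nonneg_nonneg zero_le_power2)
    { assume "chord a (S a y b) + chord (S a y b) b = chord a y + chord y b"
      then have "\<tau> / 2 * (norm (\<eta> (a, y, b)))\<^sup>2 \<le> 0" using dec[OF *] by linarith
      then have "\<eta> (a, y, b) = 0" using \<tau> by (simp add: mult_le_0_iff)
      then show "S a y b = y" using stay' * by blast }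
    { fix \<xi> assume "S a y b = y" "\<xi> \<bullet> y = 0"
      then show "(b - y) \<bullet> (DM y \<xi> *v (b - y)) - 2 * (\<xi> \<bullet> (M y *v (b - y))) + 2 * (\<xi> \<bullet> (M a *v (y - a))) = 0"
        using vertex_energy_derivative[OF *(2,1), of \<xi> b] \<eta>D[OF inU[OF *(1,2)], of b \<xi>] stay[OF *] by simp }
    let ?w = "y - \<tau> *\<^sub>R \<eta> (a, y, b)"
    have wy: "norm (?w - y) \<le> 1/20" using small[OF *] by simp
    \<comment> \<open>Projection moves the point radially by the difference of the norms, at most
      another 1/20.\<close>
    have "norm ?w *\<^sub>R sgn ?w = ?w" using nz[OF *(1,2), of \<tau> b] by (simp add: sgn_div_norm)
    then have "S a y b - ?w = (1 - norm ?w) *\<^sub>R sgn ?w"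
      by (simp add: S_def scaleR_left_diff_distrib)
    then have "norm (S a y b - ?w) = \<bar>norm y - norm ?w\<bar>"
      using nz[OF *(1,2), of \<tau> b] * by (simp add: norm_sgn)
    also have "\<dots> \<le> 1/20" using wy norm_triangle_ineq3[of y ?w] by (simp add: norm_minus_commute)
    finally show "norm (S a y b - y) \<le> 1/10"
      using norm_triangle_mono[OF _ wy, of "S a y b - ?w" "1/20"] by simp
  qed
qed

end

section \<open>Critical polygons\<close>

definition vertex_update :: "('a \<Rightarrow> 'a \<Rightarrow> 'a \<Rightarrow> 'a) \<Rightarrow> nat \<Rightarrow> nat \<Rightarrow> (nat \<Rightarrow> 'a) \<Rightarrow> nat \<Rightarrow> 'a" where
  "vertex_update S N k x = x(k := S (x ((k + N - 1) mod N)) (x k) (x (Suc k mod N)))"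

text \<open>\<open>m\<close> counts moves of single vertices in cyclic order, so \<open>N\<close>
  moves make one round.\<close>

primrec vertex_sweep :: "('a \<Rightarrow> 'a \<Rightarrow> 'a \<Rightarrow> 'a) \<Rightarrow> nat \<Rightarrow> nat \<Rightarrow> (nat \<Rightarrow> 'a) \<Rightarrow> nat \<Rightarrow> 'a" where
  "vertex_sweep S N 0 x = x"
| "vertex_sweep S N (Suc m) x = vertex_update S N (m mod N) (vertex_sweep S N m x)"

lemma vertex_sweep_add:
  "vertex_sweep S N (m + i * N) x = vertex_sweep S N m (vertex_sweep S N (i * N) x)"
  by (induction m) auto

text \<open>Convergence and invariance of \<open>A\<close> go through one induction because
  \<open>S\<close> is continuous on \<open>A\<close> only. A general filter covers both continuity
  in the sweepout parameter and passage to a limit polygon.\<close>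

lemma tendsto_vertex_sweep:
  fixes S :: "'a::topological_space \<Rightarrow> 'a \<Rightarrow> 'a \<Rightarrow> 'a"
  assumes S: "\<forall>a\<in>A. \<forall>y\<in>A. \<forall>b\<in>A. S a y b \<in> A"
    and cont: "continuous_on (A \<times> A \<times> A) (\<lambda>(a, y, b). S a y b)"
    and lim: "\<forall>j. ((\<lambda>n. z n j) \<longlongrightarrow> z0 j) F"
    and ev: "\<forall>\<^sub>F n in F. \<forall>j. z n j \<in> A" and z0: "\<forall>j. z0 j \<in> A"
  shows "((\<lambda>n. vertex_sweep S N m (z n) j) \<longlongrightarrow> vertex_sweep S N m z0 j) F \<and>
    (\<forall>\<^sub>F n in F. \<forall>j. vertex_sweep S N m (z n) j \<in> A) \<and> (\<forall>j. vertex_sweep S N m z0 j \<in> A)"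
proof (induction m arbitrary: j)
  case 0
  then show ?case using assms by simp
next
  case (Suc m)
  let ?k = "m mod N" and ?x = "\<lambda>n. vertex_sweep S N m (z n)" and ?lim = "vertex_sweep S N m z0"
  have l: "((\<lambda>n. ?x n j) \<longlongrightarrow> ?lim j) F" for j using Suc by blast
  have e: "\<forall>\<^sub>F n in F. \<forall>j. ?x n j \<in> A" and x0: "?lim j \<in> A" for j using Suc by blast+
  have "((\<lambda>n. (\<lambda>(a, y, b). S a y b) (?x n i, ?x n j, ?x n k)) \<longlongrightarrow> (\<lambda>(a, y, b). S a y b) (?lim i, ?lim j, ?lim k)) F" for i j k
    by (rule continuous_on_tendsto_compose[OF cont])
       (use x0 e in \<open>auto intro!: tendsto_Pair l elim: eventually_mono\<close>)
  then have "((\<lambda>n. vertex_sweep S N (Suc m) (z n) j) \<longlongrightarrow> vertex_sweep S N (Suc m) z0 j) F"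
    using l by (simp add: vertex_update_def)
  moreover have "\<forall>\<^sub>F n in F. \<forall>j. vertex_sweep S N (Suc m) (z n) j \<in> A"
    using e by eventually_elim (auto simp: vertex_update_def S)
  moreover have "\<forall>j. vertex_sweep S N (Suc m) z0 j \<in> A"
    using x0 S by (auto simp: vertex_update_def)
  ultimately show ?case by blast
qed

lemma Suc_mod_eq: "k < N \<Longrightarrow> Suc k mod N = (if Suc k = N then 0 else Suc k)"
  by auto

lemma pred_mod_eq: "(k::nat) < N \<Longrightarrow> (k + N - 1) mod N = (if k = 0 then N - 1 else k - 1)"
proof (cases "k = 0")
  case False
  assume "k < N"
  from False have "k + N - 1 = (k - 1) + N" by arith
  then have "(k + N - 1) mod N = (k - 1) mod N" by (simp only: mod_add_self2)
  with \<open>k < N\<close> show ?thesis using False by simp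
qed auto

context metric_matrix
begin

definition polygon_energy :: "nat \<Rightarrow> (nat \<Rightarrow> real^3) \<Rightarrow> real" where
  "polygon_energy N x = (\<Sum>k<N. chord (x k) (x (Suc k mod N)))"

text \<open>Only the edges entering and leaving vertex \<open>k\<close> change;
  \<open>N \<ge> 2\<close> keeps these edges distinct and the vertex different from its
  neighbours.\<close>

lemma polygon_energy_update:
  assumes "N \<ge> 2" "k < N"
  shows "polygon_energy N (x(k := y)) = polygon_energy N x +
    (chord (x ((k + N - 1) mod N)) y + chord y (x (Suc k mod N))) -
    (chord (x ((k + N - 1) mod N)) (x k) + chord (x k) (x (Suc k mod N)))"
proof -
  let ?p = "(k + N - 1) mod N"
  have p: "?p < N" "?p \<noteq> k" "Suc ?p mod N = k" "Suc k mod N \<noteq> k"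
    using assms unfolding pred_mod_eq[OF assms(2)] by (auto simp: Suc_mod_eq)
  have other: "Suc j mod N \<noteq> k" if "j < N" "j \<noteq> ?p" for j
    using that assms unfolding pred_mod_eq[OF assms(2)] by (auto simp: Suc_mod_eq split: if_splits)
  have split: "polygon_energy N w = chord (w k) (w (Suc k mod N)) + (chord (w ?p) (w k) +
      (\<Sum>j\<in>{..<N} - {k} - {?p}. chord (w j) (w (Suc j mod N))))" for w
    unfolding polygon_energy_def
    using sum.remove[of "{..<N}" k "\<lambda>j. chord (w j) (w (Suc j mod N))"]
      sum.remove[of "{..<N} - {k}" ?p "\<lambda>j. chord (w j) (w (Suc j mod N))"] assms p by simp
  have "(\<Sum>j\<in>{..<N} - {k} - {?p}. chord ((x(k := y)) j) ((x(k := y)) (Suc j mod N))) =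
      (\<Sum>j\<in>{..<N} - {k} - {?p}. chord (x j) (x (Suc j mod N)))"
    by (intro sum.cong refl) (use other in auto)
  then show ?thesis using p by (simp add: split)
qed

lemma polygon_energy_nonneg: "\<forall>k. x k \<in> S2 \<Longrightarrow> 0 \<le> polygon_energy N x"
  unfolding polygon_energy_def by (intro sum_nonneg chord_nonneg) simp

lemma chord_le_polygon_energy:
  "\<forall>k. x k \<in> S2 \<Longrightarrow> k < N \<Longrightarrow> chord (x k) (x (Suc k mod N)) \<le> polygon_energy N x"
  unfolding polygon_energy_def
  by (intro member_le_sum[of k "{..<N}" "\<lambda>k. chord (x k) (x (Suc k mod N))"] chord_nonneg) auto

text \<open>The distance is at most the sum of all edges, and Cauchy-Schwarz over \<open>N\<close>
  edges produces the factor \<open>N\<close>.\<close>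

lemma diameter_le_polygon_energy:
  assumes x: "\<forall>k. x k \<in> S2" and "j < N"
  shows "r\<^sup>2 * (norm (x j - x 0))\<^sup>2 \<le> real N * polygon_energy N x"
proof -
  let ?d = "\<lambda>k. norm (x (Suc k mod N) - x k)"
  have "x j - x 0 = (\<Sum>k<j. x (Suc k) - x k)" by (rule sum_lessThan_telescope[symmetric])
  also have "\<dots> = (\<Sum>k<j. x (Suc k mod N) - x k)"
    using \<open>j < N\<close> by (intro sum.cong) auto
  finally have "norm (x j - x 0) \<le> (\<Sum>k<j. ?d k)" by (simp only: norm_sum)
  also have "\<dots> \<le> (\<Sum>k<N. ?d k)" using \<open>j < N\<close> by (intro sum_mono2) auto
  finally have "(norm (x j - x 0))\<^sup>2 \<le> (\<Sum>k<N. ?d k)\<^sup>2" by (intro power_mono) auto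
  also have "\<dots> \<le> (\<Sum>k<N. (?d k)\<^sup>2) * real N"
    using sum_squared_le_sum_of_squares[of ?d "{..<N}"] by simp
  finally have "r\<^sup>2 * (norm (x j - x 0))\<^sup>2 \<le> r\<^sup>2 * ((\<Sum>k<N. (?d k)\<^sup>2) * real N)"
    by (intro mult_left_mono) auto
  also have "\<dots> = real N * (\<Sum>k<N. r\<^sup>2 * (?d k)\<^sup>2)" by (simp add: sum_distrib_left mult_ac)
  also have "\<dots> \<le> real N * polygon_energy N x"
    unfolding polygon_energy_def by (intro mult_left_mono sum_mono norm_le_chord x[rule_format]) auto
  finally show ?thesis .
qed

lemma tendsto_M:
  assumes "(f \<longlongrightarrow> x) F" "x \<in> S2"
  shows "((\<lambda>n. M (f n)) \<longlongrightarrow> M x) F"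
proof -
  have "isCont M x"
    using has_derivative_continuous[OF M_has_derivative[OF S2_nonzero[OF assms(2)]]] .
  then show ?thesis using assms(1) by (rule isCont_tendsto_compose)
qed

lemma tendsto_polygon_energy:
  assumes "\<And>j. ((\<lambda>n. z n j) \<longlongrightarrow> z0 j) F" "\<forall>j. z0 j \<in> S2"
  shows "((\<lambda>n. polygon_energy N (z n)) \<longlongrightarrow> polygon_energy N z0) F"
  unfolding polygon_energy_def chord_def
  by (intro tendsto_sum tendsto_inner bounded_bilinear.tendsto[OF bounded_bilinear_matrix_vector_mult]
      tendsto_M tendsto_diff assms(1) assms(2)[rule_format])

text \<open>The minimax argument for fixed \<open>N\<close>. After n + 1 rounds some polygon of the
  sweepout is still long; along its history the energy stays between 0 and \<open>C\<close>, so one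
  of the rounds cost at most C / (n + 1). A cluster point of the polygons before such cheap rounds
  loses nothing in a whole round, hence is fixed by every single move.\<close>

lemma ex_fixed_polygon:
  assumes S_S2: "\<And>a y b. a \<in> S2 \<Longrightarrow> y \<in> S2 \<Longrightarrow> b \<in> S2 \<Longrightarrow> S a y b \<in> S2"
    and S_cont: "continuous_on (S2 \<times> S2 \<times> S2) (\<lambda>(a, y, b). S a y b)"
    and S_le: "\<And>a y b. a \<in> S2 \<Longrightarrow> y \<in> S2 \<Longrightarrow> b \<in> S2 \<Longrightarrow> chord a (S a y b) + chord (S a y b) b \<le> chord a y + chord y b"
    and S_eq: "\<And>a y b. a \<in> S2 \<Longrightarrow> y \<in> S2 \<Longrightarrow> b \<in> S2 \<Longrightarrow> chord a (S a y b) + chord (S a y b) b = chord a y + chord y b \<Longrightarrow> S a y b = y"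
    and S_small: "\<And>a y b. a \<in> S2 \<Longrightarrow> y \<in> S2 \<Longrightarrow> b \<in> S2 \<Longrightarrow> norm (S a y b - y) \<le> 1/10"
    and N: "N \<ge> 2" "2 * pi / real N \<le> 1/10" "4 * pi\<^sup>2 * R\<^sup>2 / real N \<le> r\<^sup>2 / 100"
  obtains z where "\<And>k. z k \<in> S2" "r\<^sup>2 / 16 \<le> real N * polygon_energy N z"
    "real N * polygon_energy N z \<le> 4 * pi\<^sup>2 * R\<^sup>2"
    "\<And>k. k < N \<Longrightarrow> S (z ((k + N - 1) mod N)) (z k) (z (Suc k mod N)) = z k"
proof -
  have S_S2': "\<forall>a\<in>S2. \<forall>y\<in>S2. \<forall>b\<in>S2. S a y b \<in> S2" using S_S2 by blast
  let ?sw = "vertex_sweep S N" and ?E = "polygon_energy N"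
  define C where "C = 4 * pi\<^sup>2 * R\<^sup>2 / real N"
  \<comment> \<open>With the trivial filter the convergence hypotheses are void and only the
    invariance statement remains.\<close>
  have sw_S2: "\<forall>j. ?sw m x j \<in> S2" if "\<forall>j. x j \<in> S2" for m x
    using tendsto_vertex_sweep[OF S_S2' S_cont, where z = "\<lambda>n. x" and ?z0.0 = x and F = bot and m = m and N = N] that by simp
  have upd_le: "?E (vertex_update S N k x) \<le> ?E x" if "\<forall>j. x j \<in> S2" "k < N" for k x
    using S_le[OF that(1)[rule_format] that(1)[rule_format] that(1)[rule_format]] polygon_energy_update[OF N(1) that(2), of x]
    unfolding vertex_update_def by (smt (verit))
  have upd_eq: "vertex_update S N k x = x" if "\<forall>j. x j \<in> S2" "k < N" "?E (vertex_update S N k x) = ?E x" for k x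
  proof -
    have "S (x ((k + N - 1) mod N)) (x k) (x (Suc k mod N)) = x k"
      using that(3) polygon_energy_update[OF N(1) that(2), of x "S (x ((k + N - 1) mod N)) (x k) (x (Suc k mod N))"]
      unfolding vertex_update_def by (intro S_eq that(1)[rule_format]) linarith
    then show ?thesis by (simp add: vertex_update_def)
  qed
  have N0: "N > 0" using N by simp
  have sw_Suc: "?E (?sw (Suc m) x) \<le> ?E (?sw m x)" if "\<forall>j. x j \<in> S2" for m x
    using upd_le[of "?sw m x" "m mod N"] sw_S2[OF that] N0 by simp
  have sw_mono: "?E (?sw n x) \<le> ?E (?sw m x)" if "\<forall>j. x j \<in> S2" "m \<le> n" for m n x
    using that(2)
  proof (induction n rule: dec_induct)
    case (step n)
    then show ?case using sw_Suc[OF that(1), of n] by linarith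
  qed simp
  define x0 where "x0 t j = circle_point t (2 * pi * (real j / real N))" for t j
  have x0S: "\<forall>j. x0 t j \<in> S2" if "t \<in> {-1..1}" for t
    unfolding x0_def using circle_point_in_S2[OF that] by simp
  \<comment> \<open>There are \<open>N\<close> edges, each of squared Euclidean length at most (2
    \<pi> / N)^2.\<close>
  have x0E: "?E (x0 t) \<le> C" if t: "t \<in> {-1..1}" for t
  proof -
    have "chord (x0 t k) (x0 t (Suc k mod N)) \<le> R\<^sup>2 * (2 * pi / real N)\<^sup>2" if "k < N" for k
    proof -
      have "x0 t (Suc k mod N) = circle_point t (2 * pi * (real (Suc k) / real N))"
        using that N0 by (auto simp: Suc_mod_eq x0_def circle_point_def)
      then have "norm (x0 t (Suc k mod N) - x0 t k) \<le> \<bar>2 * pi * (real (Suc k) / real N) - 2 * pi * (real k / real N)\<bar>"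
        using norm_circle_point_diff[OF t] by (simp only: x0_def)
      also have "2 * pi * (real (Suc k) / real N) - 2 * pi * (real k / real N) = 2 * pi / real N"
        by (simp add: add_divide_distrib distrib_left)
      finally have "(norm (x0 t (Suc k mod N) - x0 t k))\<^sup>2 \<le> (2 * pi / real N)\<^sup>2"
        by (intro power_mono) auto
      then show ?thesis
        using mult_left_mono[of "(norm (x0 t (Suc k mod N) - x0 t k))\<^sup>2" "(2 * pi / real N)\<^sup>2" "R\<^sup>2"]
          order_trans[OF chord_le_norm[OF x0S[OF t, rule_format]]] by simp
    qed
    then have "?E (x0 t) \<le> (\<Sum>k<N. R\<^sup>2 * (2 * pi / real N)\<^sup>2)"
      unfolding polygon_energy_def by (intro sum_mono) auto
    also have "\<dots> = C" using N0 by (simp add: C_def power2_eq_square field_simps)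
    finally show ?thesis .
  qed
  define X where "X m t = ?sw m (x0 t)" for m t
  have XS: "\<forall>j. X m t j \<in> S2" if "t \<in> {-1..1}" for m t
    unfolding X_def by (rule sw_S2[OF x0S[OF that]])
  have XE: "?E (X m t) \<le> C" if "t \<in> {-1..1}" for m t
    using sw_mono[OF x0S[OF that], of 0 m] x0E[OF that] unfolding X_def by simp
  have long: "\<exists>t\<in>{-1..1}. r\<^sup>2 / 16 \<le> real N * ?E (X m t)" for m
  proof -
    have "\<exists>t\<in>{-1..1}. \<exists>j<N. norm (X m t j - X m t 0) > 1/4"
    proof (rule sweepout_not_short[OF N0 N(2)])
      fix m j
      show "continuous_on {-1..1} (\<lambda>t. X m t j)"
        unfolding continuous_on_def
      proof
        fix t :: real assume t: "t \<in> {-1..1}"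
        have "continuous_on {-1..1} (\<lambda>t. x0 t j)" for j
          unfolding x0_def by (intro continuous_on_circle_point continuous_intros)
        then have "((\<lambda>t. x0 t j) \<longlongrightarrow> x0 t j) (at t within {-1..1})" for j
          using t unfolding continuous_on_def by blast
        moreover have "\<forall>\<^sub>F t in at t within {-1..1}. \<forall>j. x0 t j \<in> S2"
          using x0S by (auto simp: eventually_at_filter)
        ultimately show "((\<lambda>t. X m t j) \<longlongrightarrow> X m t j) (at t within {-1..1})"
          unfolding X_def using tendsto_vertex_sweep[OF S_S2' S_cont _ _ x0S[OF t], of x0 _ N m] by blast
      qed
    next
      fix m :: nat and t :: real and j assume t: "t = 1 \<or> t = -1"
      then have t': "t \<in> {-1..1}" by auto
      have c: "x0 t i = x0 t 0" for i
        using t by (auto simp: x0_def circle_point_def)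
      \<comment> \<open>The polygons at the poles are constant and have energy 0. No move can raise
        or lower this, so no move changes them.\<close>
      have "?E (x0 t) = 0" unfolding polygon_energy_def by (subst (1 2) c) (simp add: chord_def)
      have "X m t = x0 t"
      proof (induction m)
        case (Suc m)
        have "?E (X (Suc m) t) \<le> 0" "0 \<le> ?E (X (Suc m) t)"
          using sw_mono[OF x0S[OF t'], of 0 "Suc m"] \<open>?E (x0 t) = 0\<close> polygon_energy_nonneg[OF XS[OF t'], of N "Suc m"]
          unfolding X_def by auto
        then have "?E (vertex_update S N (m mod N) (X m t)) = ?E (X m t)"
          using \<open>?E (x0 t) = 0\<close> Suc by (simp add: X_def)
        then have "vertex_update S N (m mod N) (X m t) = X m t"
          using N0 by (intro upd_eq XS[OF t']) auto
        then show ?case using Suc by (simp add: X_def)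
      qed (simp add: X_def)
      then show "X m t j = X m t 0" using c[of j] by simp
    next
      fix m :: nat and t :: real and j assume t: "t \<in> {-1..1}" "j < N"
      show "norm (X (Suc m) t j - X m t j) \<le> 1/10"
      proof (cases "j = m mod N")
        case True
        then have "X (Suc m) t j = S (X m t ((j + N - 1) mod N)) (X m t j) (X m t (Suc j mod N))"
          by (simp add: X_def vertex_update_def)
        then show ?thesis using S_small[OF XS[OF t(1), rule_format] XS[OF t(1), rule_format] XS[OF t(1), rule_format]] by simp
      qed (simp add: X_def vertex_update_def)
      \<comment> \<open>One edge costs no more than the whole energy, hence at most
        \<open>C\<close>, and \<open>N\<close> is large enough that \<open>C\<close> is at most
        \<open>r\<^sup>2 / 100\<close>.\<close>
      have "r\<^sup>2 * (norm (X m t (Suc j mod N) - X m t j))\<^sup>2 \<le> r\<^sup>2 / 100"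
        using norm_le_chord[OF XS[OF t(1), rule_format]] chord_le_polygon_energy[OF XS[OF t(1)] t(2), of m] XE[OF t(1), of m] N(3)
        unfolding C_def by (meson order_trans)
      then have "(norm (X m t (Suc j mod N) - X m t j))\<^sup>2 \<le> (1/10)\<^sup>2"
        using r_pos by (simp add: power2_eq_square field_simps)
      then show "norm (X m t (Suc j mod N) - X m t j) \<le> 1/10"
        by (rule power2_le_imp_le) simp
    qed (use XS in \<open>auto simp: X_def x0_def\<close>)
    then obtain t j where t: "t \<in> {-1..1}" "j < N" and "norm (X m t j - X m t 0) > 1/4" by blast
    then have "(1/4)\<^sup>2 \<le> (norm (X m t j - X m t 0))\<^sup>2" by (intro power_mono) auto
    then have "r\<^sup>2 * (1/4)\<^sup>2 \<le> r\<^sup>2 * (norm (X m t j - X m t 0))\<^sup>2" by (intro mult_left_mono) auto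
    also have "\<dots> \<le> real N * ?E (X m t)" by (rule diameter_le_polygon_energy[OF XS[OF t(1)] t(2)])
    finally show ?thesis using t by (auto simp: power2_eq_square)
  qed
  have "\<exists>z. (\<forall>j. z j \<in> S2) \<and> r\<^sup>2 / 16 \<le> real N * ?E z \<and> ?E z \<le> C \<and> ?E z - ?E (?sw N z) \<le> C / real (Suc n)" for n
  proof -
    obtain t where t: "t \<in> {-1..1}" and l: "r\<^sup>2 / 16 \<le> real N * ?E (X (Suc n * N) t)" using long by blast
    \<comment> \<open>Pigeonhole over the rounds: the losses telescope to at most
      \<open>C\<close>.\<close>
    have "\<exists>i<Suc n. ?E (X (i * N) t) - ?E (X (Suc i * N) t) \<le> C / real (Suc n)"
    proof (rule ccontr)
      assume "\<not> ?thesis"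
      then have "(\<Sum>i<Suc n. ?E (X (i * N) t) - ?E (X (Suc i * N) t)) > (\<Sum>i<Suc n. C / real (Suc n))"
        by (intro sum_strict_mono) (auto simp: not_le simp del: mult_Suc of_nat_Suc)
      moreover have "(\<Sum>i<Suc n. ?E (X (i * N) t) - ?E (X (Suc i * N) t)) = ?E (X (0 * N) t) - ?E (X (Suc n * N) t)"
        by (rule sum_lessThan_telescope'[of "\<lambda>i. ?E (X (i * N) t)"])
      moreover have "?E (X (0 * N) t) \<le> C" "0 \<le> ?E (X (Suc n * N) t)"
        using XE[OF t] polygon_energy_nonneg[OF XS[OF t], of N "Suc n * N"] by auto
      ultimately show False by (simp del: mult_Suc of_nat_Suc)
    qed
    then obtain i where i: "i < Suc n" "?E (X (i * N) t) - ?E (X (Suc i * N) t) \<le> C / real (Suc n)" by blast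
    have "X (Suc i * N) t = ?sw N (X (i * N) t)" unfolding X_def using vertex_sweep_add[of S N N i] by simp
    \<comment> \<open>Energy never increases, so the earlier polygon inherits the lower bound from
      the long polygon at the end.\<close>
    moreover have "i * N \<le> Suc n * N" using i by (intro mult_le_mono1) simp
    then have "?E (X (Suc n * N) t) \<le> ?E (X (i * N) t)"
      unfolding X_def by (rule sw_mono[OF x0S[OF t]])
    then have "real N * ?E (X (Suc n * N) t) \<le> real N * ?E (X (i * N) t)"
      by (rule mult_left_mono) simp
    ultimately show ?thesis
      using i(2) l XS[OF t] XE[OF t] by (intro exI[of _ "X (i * N) t"]) auto
  qed
  from choice[OF allI[OF this]] obtain z where "\<forall>n. (\<forall>j. z n j \<in> S2) \<and> r\<^sup>2 / 16 \<le> real N * ?E (z n) \<and>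
      ?E (z n) \<le> C \<and> ?E (z n) - ?E (?sw N (z n)) \<le> C / real (Suc n)" ..
  then have z: "\<forall>j. z n j \<in> S2" "r\<^sup>2 / 16 \<le> real N * ?E (z n)" "?E (z n) \<le> C"
    "?E (z n) - ?E (?sw N (z n)) \<le> C / real (Suc n)" for n by blast+
  have zS: "z n j \<in> S2" for n j using z(1) by blast
  obtain F z0 where F: "F \<le> sequentially" "F \<noteq> bot" and z0: "\<forall>j. z0 j \<in> S2" and lim: "\<forall>j. ((\<lambda>n. z n j) \<longlongrightarrow> z0 j) F"
    using cluster_filter[of S2 z, OF compact_sphere zS] by blast
  have limE: "((\<lambda>n. ?E (z n)) \<longlongrightarrow> ?E z0) F" by (rule tendsto_polygon_energy[OF lim[rule_format] z0])
  have "((\<lambda>n. ?sw N (z n) j) \<longlongrightarrow> ?sw N z0 j) F" for j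
    using tendsto_vertex_sweep[OF S_S2' S_cont _ _ z0, of z F N N] lim z(1) by simp
  then have limE': "((\<lambda>n. ?E (?sw N (z n))) \<longlongrightarrow> ?E (?sw N z0)) F"
    by (rule tendsto_polygon_energy) (rule sw_S2[OF z0])
  have limC: "((\<lambda>n. C / real (Suc n)) \<longlongrightarrow> 0) F"
    using tendsto_mono[OF F(1) LIMSEQ_Suc[OF lim_const_over_n[of C]]] by simp
  have "?E z0 - ?E (?sw N z0) \<le> 0"
    using tendsto_le[OF F(2) limC tendsto_diff[OF limE limE']] z(4) by simp
  then have const: "?E (?sw m z0) = ?E z0" if "m \<le> N" for m
    using sw_mono[OF z0, of m N] sw_mono[OF z0, of 0 m] that by simp
  \<comment> \<open>No move of the round changes the energy, so by the equality case no move changes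
    the polygon, and each vertex gets its turn while the polygon is still \<open>z0\<close>.\<close>
  have fixed: "?sw m z0 = z0" if "m \<le> N" for m
    using that
  proof (induction m)
    case (Suc m)
    then have IH: "?sw m z0 = z0" by simp
    then have "vertex_update S N (m mod N) z0 = z0"
      using const[of "Suc m"] Suc.prems N0 by (intro upd_eq z0) auto
    then show ?case using IH by simp
  qed simp
  have "S (z0 ((k + N - 1) mod N)) (z0 k) (z0 (Suc k mod N)) = z0 k" if "k < N" for k
    using fixed[of k] fixed[of "Suc k"] that by (simp add: vertex_update_def fun_upd_idem_iff)
  moreover have "r\<^sup>2 / 16 \<le> real N * ?E z0"
    by (rule tendsto_lowerbound[OF tendsto_mult_left[OF limE] always_eventually F(2)]) (use z(2) in blast)
  moreover have "?E z0 \<le> C"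
    by (rule tendsto_upperbound[OF limE always_eventually F(2)]) (use z(3) in blast)
  then have "real N * ?E z0 \<le> 4 * pi\<^sup>2 * R\<^sup>2" using N0 by (simp add: C_def field_simps)
  ultimately show ?thesis using that z0 by blast
qed

end

section \<open>Discrete geodesics\<close>

text \<open>This is for the shifted index \<open>\<lfloor>real N * t\<rfloor> + 1\<close> and for
  evaluation times that themselves depend on \<open>N\<close>.\<close>

lemma equicont_limit_moving:
  fixes y :: "nat \<Rightarrow> int \<Rightarrow> 'a::real_normed_vector"
  assumes F: "F \<le> sequentially"
    and equi: "equicont y"
    and lim: "((\<lambda>N. y N \<lfloor>real N * t\<rfloor>) \<longlongrightarrow> l) F"
    and s: "(s \<longlongrightarrow> t) F"
  shows "((\<lambda>N. y N \<lfloor>real N * s N\<rfloor>) \<longlongrightarrow> l) F"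
proof -
  have "((\<lambda>N. y N \<lfloor>real N * s N\<rfloor> - y N \<lfloor>real N * t\<rfloor>) \<longlongrightarrow> 0) F"
  proof (rule tendstoI)
    fix e :: real assume "e > 0"
    then have "e / 2 > 0" by simp
    with equi obtain d where d: "d > 0" and
      ev: "\<forall>\<^sub>F N in sequentially. \<forall>i j. \<bar>real_of_int i - real_of_int j\<bar> \<le> d * real N \<longrightarrow> norm (y N i - y N j) \<le> e / 2"
      unfolding equicont_def by blast
    have "\<forall>\<^sub>F N in sequentially. real N \<ge> 2 / d"
      using filterlim_real_sequentially by (simp add: filterlim_at_top)
    then have big: "\<forall>\<^sub>F N in F. real N \<ge> 2 / d" using F(1) by (simp add: le_filter_def)
    have ev': "\<forall>\<^sub>F N in F. \<forall>i j. \<bar>real_of_int i - real_of_int j\<bar> \<le> d * real N \<longrightarrow> norm (y N i - y N j) \<le> e / 2"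
      using ev F(1) by (simp add: le_filter_def)
    have "\<forall>\<^sub>F N in F. dist (s N) t < d / 2" using tendstoD[OF s, of "d / 2"] d by simp
    with big ev' show "\<forall>\<^sub>F N in F. dist (y N \<lfloor>real N * s N\<rfloor> - y N \<lfloor>real N * t\<rfloor>) 0 < e"
    proof eventually_elim
      case (elim N)
      have "\<bar>real_of_int \<lfloor>real N * s N\<rfloor> - real_of_int \<lfloor>real N * t\<rfloor>\<bar> \<le> \<bar>real N * s N - real N * t\<bar> + 1" by linarith
      also have "\<dots> = real N * \<bar>s N - t\<bar> + 1" by (simp add: abs_mult flip: right_diff_distrib)
      also have "\<dots> \<le> real N * (d / 2) + real N * (d / 2)"
        using elim d by (intro add_mono mult_left_mono) (auto simp: dist_real_def field_simps)
      finally have "\<bar>real_of_int \<lfloor>real N * s N\<rfloor> - real_of_int \<lfloor>real N * t\<rfloor>\<bar> \<le> d * real N"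
        by (simp add: algebra_simps)
      then have "norm (y N \<lfloor>real N * s N\<rfloor> - y N \<lfloor>real N * t\<rfloor>) \<le> e / 2" using elim by blast
      then show ?case using \<open>e > 0\<close> by simp
    qed
  qed
  from tendsto_add[OF this lim] show ?thesis by simp
qed

lemma int_step_bound:
  fixes y :: "int \<Rightarrow> 'a::real_normed_vector"
  assumes "\<And>k. norm (y (k + 1) - y k) \<le> B"
  shows "norm (y i - y j) \<le> B * \<bar>real_of_int i - real_of_int j\<bar>"
proof -
  have *: "norm (y i - y j) \<le> B * (real_of_int i - real_of_int j)" if "j \<le> i" for i j
    using that
  proof (induction i rule: int_ge_induct)
    case (step i)
    have "norm (y (i + 1) - y j) \<le> norm (y (i + 1) - y i) + norm (y i - y j)"
      using norm_triangle_ineq[of "y (i + 1) - y i" "y i - y j"] by simp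
    also have "\<dots> \<le> B + B * (real_of_int i - real_of_int j)" using assms step by (intro add_mono) auto
    finally show ?case by (simp add: algebra_simps)
  qed simp
  show ?thesis
    using *[of i j] *[of j i] by (cases "i \<le> j") (auto simp: norm_minus_commute abs_if)
qed

lemma ex_index_le_average:
  fixes f :: "nat \<Rightarrow> real"
  assumes "N > 0" "(\<Sum>k<N. f k) \<le> real N * c"
  shows "\<exists>k<N. f k \<le> c"
proof (rule ccontr)
  assume "\<not> ?thesis"
  then have "(\<Sum>k<N. f k) > (\<Sum>k<N. c)" using assms(1) by (intro sum_strict_mono) auto
  then show False using assms(2) by simp
qed

lemma nat_mod_shift:
  assumes "N > 0"
  shows "nat ((k + 1) mod int N) = Suc (nat (k mod int N)) mod N"
    "nat ((k - 1) mod int N) = (nat (k mod int N) + N - 1) mod N"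
proof -
  define m where "m = nat (k mod int N)"
  have m: "int m = k mod int N" using assms by (simp add: m_def)
  have "(k + 1) mod int N = int (Suc m) mod int N" by (simp add: m mod_simps add.commute)
  then show "nat ((k + 1) mod int N) = Suc (nat (k mod int N)) mod N"
    unfolding m_def[symmetric] by (simp only: zmod_int[symmetric] nat_int)
  have "(k - 1) mod int N = (int m + int N - 1) mod int N"
    by (metis m mod_diff_left_eq mod_add_self2)
  also have "int m + int N - 1 = int (m + N - 1)" using assms by simp
  finally show "nat ((k - 1) mod int N) = (nat (k mod int N) + N - 1) mod N"
    unfolding m_def[symmetric] by (simp only: zmod_int[symmetric] nat_int)
qed

context metric_matrix
begin

text \<open>The cyclic polygon is unrolled to a periodic sequence over the integers. The equation is
  the discrete Euler-Lagrange equation of the energy, tested on vectors tangent at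
  \<open>x k\<close>.\<close>

definition discrete_geodesic :: "nat \<Rightarrow> (int \<Rightarrow> real^3) \<Rightarrow> bool" where
  "discrete_geodesic N x \<longleftrightarrow> (\<forall>k. x k \<in> S2) \<and> (\<forall>k. x (k mod int N) = x k) \<and>
    (\<forall>k \<xi>. \<xi> \<bullet> x k = 0 \<longrightarrow>
      (x (k + 1) - x k) \<bullet> (DM (x k) \<xi> *v (x (k + 1) - x k)) - 2 * (\<xi> \<bullet> (M (x k) *v (x (k + 1) - x k))) +
      2 * (\<xi> \<bullet> (M (x (k - 1)) *v (x k - x (k - 1)))) = 0)"

lemma ex_discrete_geodesic:
  "\<exists>N0>0. \<forall>N\<ge>N0. \<exists>x. discrete_geodesic N x \<and>
    r\<^sup>2 / 16 \<le> real N * (\<Sum>k<N. chord (x (int k)) (x (int k + 1))) \<and>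
    real N * (\<Sum>k<N. chord (x (int k)) (x (int k + 1))) \<le> 4 * pi\<^sup>2 * R\<^sup>2"
proof -
  obtain S :: "real^3 \<Rightarrow> real^3 \<Rightarrow> real^3 \<Rightarrow> real^3" where S:
    "\<And>a y b. a \<in> S2 \<Longrightarrow> y \<in> S2 \<Longrightarrow> b \<in> S2 \<Longrightarrow> S a y b \<in> S2"
    "continuous_on (S2 \<times> S2 \<times> S2) (\<lambda>(a, y, b). S a y b)"
    "\<And>a y b. a \<in> S2 \<Longrightarrow> y \<in> S2 \<Longrightarrow> b \<in> S2 \<Longrightarrow> chord a (S a y b) + chord (S a y b) b \<le> chord a y + chord y b"
    "\<And>a y b. a \<in> S2 \<Longrightarrow> y \<in> S2 \<Longrightarrow> b \<in> S2 \<Longrightarrow> chord a (S a y b) + chord (S a y b) b = chord a y + chord y b \<Longrightarrow> S a y b = y"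
    "\<And>a y b \<xi>. a \<in> S2 \<Longrightarrow> y \<in> S2 \<Longrightarrow> b \<in> S2 \<Longrightarrow> S a y b = y \<Longrightarrow> \<xi> \<bullet> y = 0 \<Longrightarrow>
      (b - y) \<bullet> (DM y \<xi> *v (b - y)) - 2 * (\<xi> \<bullet> (M y *v (b - y))) + 2 * (\<xi> \<bullet> (M a *v (y - a))) = 0"
    "\<And>a y b. a \<in> S2 \<Longrightarrow> y \<in> S2 \<Longrightarrow> b \<in> S2 \<Longrightarrow> norm (S a y b - y) \<le> 1/10"
    by (rule vertex_step) blast
  have "\<forall>\<^sub>F N in sequentially. N \<ge> 2 \<and> 2 * pi / real N < 1/10 \<and> 4 * pi\<^sup>2 * R\<^sup>2 / real N < r\<^sup>2 / 100"
    using order_tendstoD(2)[OF lim_const_over_n[of "2 * pi"], of "1/10"]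
      order_tendstoD(2)[OF lim_const_over_n[of "4 * pi\<^sup>2 * R\<^sup>2"], of "r\<^sup>2 / 100"] r_pos
    by (intro eventually_conj eventually_ge_at_top) auto
  then obtain N0 where N0: "\<And>N. N \<ge> N0 \<Longrightarrow> N \<ge> 2 \<and> 2 * pi / real N < 1/10 \<and> 4 * pi\<^sup>2 * R\<^sup>2 / real N < r\<^sup>2 / 100"
    unfolding eventually_sequentially by blast
  have "\<exists>x. discrete_geodesic N x \<and>
    r\<^sup>2 / 16 \<le> real N * (\<Sum>k<N. chord (x (int k)) (x (int k + 1))) \<and>
    real N * (\<Sum>k<N. chord (x (int k)) (x (int k + 1))) \<le> 4 * pi\<^sup>2 * R\<^sup>2" if "N \<ge> N0" for N
  proof -
    have N: "N \<ge> 2" "2 * pi / real N \<le> 1/10" "4 * pi\<^sup>2 * R\<^sup>2 / real N \<le> r\<^sup>2 / 100"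
      using N0[OF that] by auto
    obtain z where z: "\<And>k. z k \<in> S2" "r\<^sup>2 / 16 \<le> real N * polygon_energy N z"
      "real N * polygon_energy N z \<le> 4 * pi\<^sup>2 * R\<^sup>2"
      "\<And>k. k < N \<Longrightarrow> S (z ((k + N - 1) mod N)) (z k) (z (Suc k mod N)) = z k"
      using ex_fixed_polygon[OF S(1-4) S(6) N] by blast
    define x where "x k = z (nat (k mod int N))" for k
    have N': "N > 0" using N by simp
    have xs: "x (k + 1) = z (Suc (nat (k mod int N)) mod N)" "x (k - 1) = z ((nat (k mod int N) + N - 1) mod N)" for k
      unfolding x_def nat_mod_shift[OF N'] by (rule refl)+
    have "discrete_geodesic N x"
      unfolding discrete_geodesic_def
    proof (intro conjI allI impI)
      fix k and \<xi> :: "real^3"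
      show "x k \<in> S2" "x (k mod int N) = x k" using z(1) by (auto simp: x_def)
      assume xi: "\<xi> \<bullet> x k = 0"
      have "nat (k mod int N) < N" using N' by (simp add: nat_less_iff)
      from z(4)[OF this] have "S (x (k - 1)) (x k) (x (k + 1)) = x k" unfolding xs by (simp only: x_def)
      then show "(x (k + 1) - x k) \<bullet> (DM (x k) \<xi> *v (x (k + 1) - x k)) - 2 * (\<xi> \<bullet> (M (x k) *v (x (k + 1) - x k))) +
        2 * (\<xi> \<bullet> (M (x (k - 1)) *v (x k - x (k - 1)))) = 0"
        by (intro S(5) xi) (auto simp: x_def z(1)[simplified])
    qed
    moreover have "(\<Sum>k<N. chord (x (int k)) (x (int k + 1))) = polygon_energy N z"
      unfolding polygon_energy_def xs by (intro sum.cong) (auto simp: x_def)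
    ultimately show ?thesis using z(2,3) by (intro exI[of _ x]) simp
  qed
  then have "\<forall>N\<ge>Suc N0. \<exists>x. discrete_geodesic N x \<and>
    r\<^sup>2 / 16 \<le> real N * (\<Sum>k<N. chord (x (int k)) (x (int k + 1))) \<and>
    real N * (\<Sum>k<N. chord (x (int k)) (x (int k + 1))) \<le> 4 * pi\<^sup>2 * R\<^sup>2" using Suc_leD by blast
  then show ?thesis by blast
qed

text \<open>The gradient in \<open>x\<close> of the kinetic energy
  \<open>1/2 * (v \<bullet> (M x *v v))\<close>.\<close>

definition force :: "real^3 \<Rightarrow> real^3 \<Rightarrow> real^3" where
  "force x v = (\<Sum>i\<in>Basis. (1/2 * (v \<bullet> (DM x i *v v))) *\<^sub>R i)"

lemma DM_linear: "x \<noteq> 0 \<Longrightarrow> linear (DM x)"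
  using M_has_derivative has_derivative_linear by blast

lemma inner_force:
  assumes "x \<noteq> 0"
  shows "force x v \<bullet> \<xi> = 1/2 * (v \<bullet> (DM x \<xi> *v v))"
proof -
  have "DM x \<xi> = DM x (\<Sum>i\<in>Basis. (\<xi> \<bullet> i) *\<^sub>R i)" by (simp add: euclidean_representation)
  also have "\<dots> = (\<Sum>i\<in>Basis. (\<xi> \<bullet> i) *\<^sub>R DM x i)"
    by (simp only: linear_sum[OF DM_linear[OF assms]] linear_cmul[OF DM_linear[OF assms]])
  finally have "DM x \<xi> *v v = (\<Sum>i\<in>Basis. (\<xi> \<bullet> i) *\<^sub>R (DM x i *v v))"
    by (simp add: bounded_bilinear.sum_left[OF bounded_bilinear_matrix_vector_mult] scaleR_matrix_vector_assoc)
  then have "1/2 * (v \<bullet> (DM x \<xi> *v v)) = (\<Sum>i\<in>Basis. 1/2 * ((\<xi> \<bullet> i) * (v \<bullet> (DM x i *v v))))"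
    by (simp add: inner_sum_right sum_divide_distrib)
  also have "\<dots> = force x v \<bullet> \<xi>"
    unfolding force_def inner_sum_left inner_scaleR_left by (intro sum.cong) (auto simp: inner_commute)
  finally show ?thesis ..
qed

text \<open>\<open>M\<close> is constant along rays. As a consequence the force has no component
  normal to the sphere.\<close>

lemma DM_radial:
  assumes "x \<noteq> 0"
  shows "DM x x = 0"
proof -
  have "((\<lambda>s. M (x + s *\<^sub>R x)) has_vector_derivative DM x x) (at 0)"
    using M_has_derivative[OF assms] by (intro has_vector_derivative_along_line) simp
  moreover have "((\<lambda>s. M (x + s *\<^sub>R x)) has_vector_derivative 0) (at 0)"
  proof (rule has_vector_derivative_transform_within_open[of "\<lambda>s. M x" _ _ "{-1<..}"])
    fix s :: real assume "s \<in> {-1<..}"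
    then show "M x = M (x + s *\<^sub>R x)" using M_scale[of "1 + s" x] by (simp add: scaleR_left_distrib)
  qed auto
  ultimately show ?thesis using vector_derivative_at by metis
qed

lemma force_normal: "x \<noteq> 0 \<Longrightarrow> force x v \<bullet> x = 0"
  by (simp add: inner_force DM_radial)

lemma continuous_on_M: "continuous_on S2 M"
  by (rule continuous_on_subset[OF smooth_on_imp_continuous_on[OF smooth_M]]) auto

lemma continuous_on_DM: "continuous_on S2 (\<lambda>x. DM x i)"
  unfolding DM_def
  by (rule continuous_on_subset[OF smooth_on_imp_continuous_on[OF smooth_on_frechet_derivative[OF smooth_M]]]) auto

lemma norm_bounds:
  obtains \<Lambda> where "\<Lambda> > 0" "\<And>x v. x \<in> S2 \<Longrightarrow> norm (M x *v v) \<le> \<Lambda> * norm v"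
    "\<And>x v. x \<in> S2 \<Longrightarrow> norm (force x v) \<le> \<Lambda> * (norm v)\<^sup>2"
proof -
  obtain B where B: "B > 0" "\<And>(A::real^3^3) (v::real^3). norm (A *v v) \<le> norm A * norm v * B"
    using bounded_bilinear.pos_bounded[OF bounded_bilinear_matrix_vector_mult] by blast
  have bd: "\<exists>C. \<forall>x\<in>S2. norm (f x) \<le> C" if "continuous_on S2 f" for f :: "real^3 \<Rightarrow> real^3^3"
    using compact_imp_bounded[OF compact_continuous_image[OF that compact_sphere]] by (auto simp: bounded_iff)
  obtain C where C: "\<And>x. x \<in> S2 \<Longrightarrow> norm (M x) \<le> C" using bd[OF continuous_on_M] by blast
  obtain D where D: "\<And>i x. x \<in> S2 \<Longrightarrow> norm (DM x i) \<le> D i" using bd[OF continuous_on_DM] by metis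
  define \<Lambda> where "\<Lambda> = \<bar>C\<bar> * B + (\<Sum>i\<in>(Basis::(real^3) set). \<bar>D i\<bar> * B) + 1"
  have s0: "(\<Sum>i\<in>(Basis::(real^3) set). \<bar>D i\<bar> * B) \<ge> 0" using B by (intro sum_nonneg) auto
  have c0: "\<bar>C\<bar> * B \<ge> 0" using B by simp
  have "norm (M x *v v) \<le> \<Lambda> * norm v" if "x \<in> S2" for x v
  proof -
    have "norm (M x *v v) \<le> norm (M x) * norm v * B" by (rule B)
    also have "\<dots> \<le> \<bar>C\<bar> * norm v * B"
      using C[OF that] B by (intro mult_right_mono) auto
    also have "\<dots> = (\<bar>C\<bar> * B) * norm v" by simp
    also have "\<dots> \<le> \<Lambda> * norm v" using s0 by (intro mult_right_mono) (auto simp: \<Lambda>_def)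
    finally show ?thesis .
  qed
  moreover have "norm (force x v) \<le> \<Lambda> * (norm v)\<^sup>2" if x: "x \<in> S2" for x v
  proof -
    have "norm (force x v) \<le> (\<Sum>i\<in>Basis. norm ((1/2 * (v \<bullet> (DM x i *v v))) *\<^sub>R i))"
      unfolding force_def by (rule norm_sum)
    also have "\<dots> \<le> (\<Sum>i\<in>(Basis::(real^3) set). (\<bar>D i\<bar> * B) * (norm v)\<^sup>2)"
    proof (rule sum_mono)
      fix i :: "real^3" assume "i \<in> Basis"
      have "\<bar>v \<bullet> (DM x i *v v)\<bar> \<le> norm v * norm (DM x i *v v)" by (rule Cauchy_Schwarz_ineq2)
      also have "\<dots> \<le> norm v * (norm (DM x i) * norm v * B)" by (intro mult_left_mono B) auto
      also have "\<dots> \<le> norm v * (\<bar>D i\<bar> * norm v * B)"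
        using D[OF x, of i] B by (intro mult_left_mono mult_right_mono) auto
      finally have "\<bar>v \<bullet> (DM x i *v v)\<bar> \<le> (\<bar>D i\<bar> * B) * (norm v)\<^sup>2"
        by (simp add: power2_eq_square algebra_simps)
      then show "norm ((1/2 * (v \<bullet> (DM x i *v v))) *\<^sub>R i) \<le> (\<bar>D i\<bar> * B) * (norm v)\<^sup>2"
        using \<open>i \<in> Basis\<close> by simp
    qed
    also have "\<dots> = (\<Sum>i\<in>(Basis::(real^3) set). \<bar>D i\<bar> * B) * (norm v)\<^sup>2" by (simp add: sum_distrib_right)
    also have "\<dots> \<le> \<Lambda> * (norm v)\<^sup>2" using c0 by (intro mult_right_mono) (auto simp: \<Lambda>_def)
    finally show ?thesis .
  qed
  moreover have "\<Lambda> > 0" using s0 c0 by (simp add: \<Lambda>_def)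
  ultimately show ?thesis using that by blast
qed

definition discrete_velocity :: "nat \<Rightarrow> (int \<Rightarrow> real^3) \<Rightarrow> int \<Rightarrow> real^3" where
  "discrete_velocity N x k = real N *\<^sub>R (x (k + 1) - x k)"

definition discrete_momentum :: "nat \<Rightarrow> (int \<Rightarrow> real^3) \<Rightarrow> int \<Rightarrow> real^3" where
  "discrete_momentum N x k = M (x k) *v discrete_velocity N x k"

text \<open>The momentum equation of the critical polygon, with the component normal to the sphere worked out.\<close>

definition momentum_rate :: "((real^3) \<times> (real^3)) \<times> ((real^3) \<times> (real^3)) \<Rightarrow> real^3" where
  "momentum_rate = (\<lambda>((x', v'), (x, v)).
    force x' v' - (v \<bullet> (M x *v v) + r\<^sup>2 / 2 * (v' \<bullet> v' - v \<bullet> v)) *\<^sub>R x')"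

text \<open>Criticality fixes the increment of the momentum on tangent vectors. The normal component
  is determined as well: for a secant of the unit sphere \<open>x j \<bullet> v j\<close> equals
  \<open>- (v j \<bullet> v j) / (2 * real N)\<close>, and \<open>M\<close> scales the normal, so
  both momenta have explicit products with \<open>x (k + 1)\<close>.\<close>

lemma discrete_momentum_step:
  assumes x: "discrete_geodesic N x" and N: "N > 0"
  defines "v \<equiv> discrete_velocity N x" and "p \<equiv> discrete_momentum N x"
  shows "p (k + 1) - p k = (1 / real N) *\<^sub>R momentum_rate ((x (k + 1), v (k + 1)), (x k, v k))"
proof -
  let ?n = "real N"
  have n: "?n > 0" using N by simp
  have S: "x j \<in> S2" for j using x by (simp add: discrete_geodesic_def)
  have xx: "x j \<bullet> x j = 1" for j using S[of j] by (simp add: dot_square_norm)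
  have \<Delta>: "x (j + 1) - x j = (1 / ?n) *\<^sub>R v j" for j using n by (simp add: v_def discrete_velocity_def)
  have xv: "x j \<bullet> v j = - (v j \<bullet> v j) / (2 * ?n)" for j
  proof -
    have A: "v j \<bullet> v j = ?n * ?n * (2 - 2 * (x j \<bullet> x (j + 1)))"
      using xx[of j] xx[of "j + 1"]
      by (simp add: v_def discrete_velocity_def inner_diff inner_commute)
    have B: "x j \<bullet> v j = ?n * (x j \<bullet> x (j + 1) - 1)"
      using xx[of j] by (simp add: v_def discrete_velocity_def inner_diff)
    have "v j \<bullet> v j = - (2 * ?n) * (x j \<bullet> v j)" unfolding A B by (simp add: algebra_simps)
    then show ?thesis using n by simp
  qed
  have px: "p j \<bullet> x j = - r\<^sup>2 * (v j \<bullet> v j) / (2 * ?n)" for j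
  proof -
    have "p j \<bullet> x j = x j \<bullet> (M (x j) *v v j)" by (simp add: p_def discrete_momentum_def v_def inner_commute)
    also have "\<dots> = v j \<bullet> (M (x j) *v x j)" by (rule M_sym[OF S])
    also have "\<dots> = r\<^sup>2 * (x j \<bullet> v j)" by (simp add: M_normal[OF S] inner_commute)
    finally show ?thesis by (simp add: xv)
  qed
  have pv: "p j \<bullet> v j = v j \<bullet> (M (x j) *v v j)" for j
    by (simp add: p_def discrete_momentum_def v_def inner_commute)
  define m where "m = momentum_rate ((x (k + 1), v (k + 1)), (x k, v k))"
  \<comment> \<open>The defect of the claimed equation. It is orthogonal to
    \<open>x (k + 1)\<close>, hence tangent there, and orthogonal to all tangent vectors, hence to
    itself.\<close>
  define d where "d = p (k + 1) - p k - (1 / ?n) *\<^sub>R m"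
  have nz: "x (k + 1) \<noteq> 0" by (rule S2_nonzero[OF S])
  have xk: "x (k + 1) = x k + (1 / ?n) *\<^sub>R v k" using \<Delta>[of k] by (simp add: algebra_simps)
  have "p k \<bullet> x (k + 1) = p k \<bullet> x k + (1 / ?n) * (p k \<bullet> v k)"
    unfolding xk by (simp add: inner_add_right)
  then have pk: "p k \<bullet> x (k + 1) = - r\<^sup>2 * (v k \<bullet> v k) / (2 * ?n) + (v k \<bullet> (M (x k) *v v k)) / ?n"
    unfolding px pv by simp
  have m1: "m \<bullet> x (k + 1) = - (v k \<bullet> (M (x k) *v v k) + r\<^sup>2 / 2 * (v (k + 1) \<bullet> v (k + 1) - v k \<bullet> v k))"
    by (simp add: m_def momentum_rate_def inner_diff_left force_normal[OF nz] xx)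
  have d1: "d \<bullet> x (k + 1) = 0"
    unfolding d_def inner_diff_left inner_scaleR_left px pk m1 using n by (simp add: field_simps)
  have d2: "d \<bullet> \<xi> = 0" if \<xi>: "\<xi> \<bullet> x (k + 1) = 0" for \<xi>
  proof -
    have crit: "(1 / ?n) * ((1 / ?n) * (v (k + 1) \<bullet> (DM (x (k + 1)) \<xi> *v v (k + 1)))) - 2 * ((1 / ?n) * (\<xi> \<bullet> p (k + 1))) + 2 * ((1 / ?n) * (\<xi> \<bullet> p k)) = 0"
    proof -
      have "(x (k + 1 + 1) - x (k + 1)) \<bullet> (DM (x (k + 1)) \<xi> *v (x (k + 1 + 1) - x (k + 1))) -
        2 * (\<xi> \<bullet> (M (x (k + 1)) *v (x (k + 1 + 1) - x (k + 1)))) +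
        2 * (\<xi> \<bullet> (M (x (k + 1 - 1)) *v (x (k + 1) - x (k + 1 - 1)))) = 0"
        using x \<xi> unfolding discrete_geodesic_def by blast
      then show ?thesis
        unfolding add_diff_cancel_right' \<Delta> p_def discrete_momentum_def v_def[symmetric]
        by (simp only: matrix_vector_mult_scaleR inner_scaleR_left inner_scaleR_right)
    qed
    have "\<xi> \<bullet> (p (k + 1) - p k) = (1 / ?n) * (1/2 * (v (k + 1) \<bullet> (DM (x (k + 1)) \<xi> *v v (k + 1))))"
      using crit n by (simp add: inner_diff_right field_simps)
    moreover have "m \<bullet> \<xi> = 1/2 * (v (k + 1) \<bullet> (DM (x (k + 1)) \<xi> *v v (k + 1)))"
      using \<xi> by (simp add: m_def momentum_rate_def inner_diff_left inner_force[OF nz] inner_commute[of "x (k + 1)"])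
    ultimately have "\<xi> \<bullet> (p (k + 1) - p k) = (1 / ?n) * (m \<bullet> \<xi>)" by (simp only:)
    then show ?thesis
      unfolding d_def inner_diff_left[of "p (k + 1) - p k"] inner_scaleR_left inner_commute[of "p (k + 1) - p k" \<xi>]
      by simp
  qed
  have "d \<bullet> d = 0" using d1 d2[of d] by simp
  then show ?thesis by (simp add: d_def m_def)
qed

end

section \<open>Rules for equicontinuity\<close>

lemma equicont_lipschitz:
  assumes "K > 0" "\<forall>\<^sub>F N in sequentially. \<forall>k. norm (y N (k + 1) - y N k) \<le> K / real N"
  shows "equicont y"
  unfolding equicont_def
proof (intro allI impI)
  fix e :: real assume "e > 0"
  have "\<forall>\<^sub>F N in sequentially. \<forall>i j. \<bar>real_of_int i - real_of_int j\<bar> \<le> e / K * real N \<longrightarrow> norm (y N i - y N j) \<le> e"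
    using assms(2) eventually_gt_at_top[of 0]
  proof eventually_elim
    case (elim N)
    show ?case
    proof (intro allI impI)
      fix i j assume ij: "\<bar>real_of_int i - real_of_int j\<bar> \<le> e / K * real N"
      have "norm (y N i - y N j) \<le> K / real N * \<bar>real_of_int i - real_of_int j\<bar>"
        using elim by (intro int_step_bound) auto
      also have "\<dots> \<le> K / real N * (e / K * real N)"
        using ij assms(1) by (intro mult_left_mono) auto
      also have "\<dots> = e" using assms(1) elim by simp
      finally show "norm (y N i - y N j) \<le> e" .
    qed
  qed
  then show "\<exists>d>0. \<forall>\<^sub>F N in sequentially. \<forall>i j. \<bar>real_of_int i - real_of_int j\<bar> \<le> d * real N \<longrightarrow> norm (y N i - y N j) \<le> e"
    using assms(1) \<open>e > 0\<close> by (intro exI[of _ "e / K"]) auto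
qed

lemma equicont_Pair:
  assumes "equicont y" "equicont z"
  shows "equicont (\<lambda>N k. (y N k, z N k))"
  unfolding equicont_def
proof (intro allI impI)
  fix e :: real assume "e > 0"
  then have e: "e / 2 > 0" by simp
  obtain d1 where d1: "d1 > 0" "\<forall>\<^sub>F N in sequentially. \<forall>i j. \<bar>real_of_int i - real_of_int j\<bar> \<le> d1 * real N \<longrightarrow> norm (y N i - y N j) \<le> e / 2"
    using assms(1) e unfolding equicont_def by blast
  obtain d2 where d2: "d2 > 0" "\<forall>\<^sub>F N in sequentially. \<forall>i j. \<bar>real_of_int i - real_of_int j\<bar> \<le> d2 * real N \<longrightarrow> norm (z N i - z N j) \<le> e / 2"
    using assms(2) e unfolding equicont_def by blast
  have "\<forall>\<^sub>F N in sequentially. \<forall>i j. \<bar>real_of_int i - real_of_int j\<bar> \<le> min d1 d2 * real N \<longrightarrow>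
      norm ((y N i, z N i) - (y N j, z N j)) \<le> e"
    using d1(2) d2(2)
  proof eventually_elim
    case (elim N)
    show ?case
    proof (intro allI impI)
      fix i j assume "\<bar>real_of_int i - real_of_int j\<bar> \<le> min d1 d2 * real N"
      moreover have "min d1 d2 * real N \<le> d1 * real N" "min d1 d2 * real N \<le> d2 * real N"
        by (auto intro: mult_right_mono)
      ultimately have "norm (y N i - y N j) \<le> e / 2" "norm (z N i - z N j) \<le> e / 2"
        using elim by (meson order_trans)+
      then show "norm ((y N i, z N i) - (y N j, z N j)) \<le> e"
        using norm_Pair_le[of "y N i - y N j" "z N i - z N j"] by simp
    qed
  qed
  with d1(1) d2(1) show "\<exists>d>0. \<forall>\<^sub>F N in sequentially. \<forall>i j. \<bar>real_of_int i - real_of_int j\<bar> \<le> d * real N \<longrightarrow>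
      norm ((y N i, z N i) - (y N j, z N j)) \<le> e"
    by (intro exI[of _ "min d1 d2"]) auto
qed

lemma equicont_shift:
  assumes "equicont y"
  shows "equicont (\<lambda>N k. y N (k + 1))"
  unfolding equicont_def
proof (intro allI impI)
  fix e :: real assume "e > 0"
  then obtain d where d: "d > 0" "\<forall>\<^sub>F N in sequentially. \<forall>i j. \<bar>real_of_int i - real_of_int j\<bar> \<le> d * real N \<longrightarrow> norm (y N i - y N j) \<le> e"
    using assms unfolding equicont_def by blast
  have "\<forall>\<^sub>F N in sequentially. \<forall>i j. \<bar>real_of_int i - real_of_int j\<bar> \<le> d * real N \<longrightarrow> norm (y N (i + 1) - y N (j + 1)) \<le> e"
    using d(2)
  proof eventually_elim
    case (elim N)
    show ?case
    proof (intro allI impI)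
      fix i j assume "\<bar>real_of_int i - real_of_int j\<bar> \<le> d * real N"
      then have "\<bar>real_of_int (i + 1) - real_of_int (j + 1)\<bar> \<le> d * real N" by simp
      then show "norm (y N (i + 1) - y N (j + 1)) \<le> e" using elim by blast
    qed
  qed
  with d(1) show "\<exists>d>0. \<forall>\<^sub>F N in sequentially. \<forall>i j. \<bar>real_of_int i - real_of_int j\<bar> \<le> d * real N \<longrightarrow> norm (y N (i + 1) - y N (j + 1)) \<le> e"
    by blast
qed

lemma equicont_compose:
  assumes y: "equicont y" "\<forall>N k. y N k \<in> A" and f: "continuous_on A f" "compact A"
  shows "equicont (\<lambda>N k. f (y N k))"
  unfolding equicont_def
proof (intro allI impI)
  fix e :: real assume "e > 0"
  then obtain d where d: "d > 0" "\<And>x x'. x \<in> A \<Longrightarrow> x' \<in> A \<Longrightarrow> dist x' x < d \<Longrightarrow> dist (f x') (f x) < e"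
    using compact_uniformly_continuous[OF f] unfolding uniformly_continuous_on_def by metis
  then have "d / 2 > 0" by simp
  then obtain b where b: "b > 0" "\<forall>\<^sub>F N in sequentially. \<forall>i j. \<bar>real_of_int i - real_of_int j\<bar> \<le> b * real N \<longrightarrow> norm (y N i - y N j) \<le> d / 2"
    using y(1) unfolding equicont_def by blast
  have "\<forall>\<^sub>F N in sequentially. \<forall>i j. \<bar>real_of_int i - real_of_int j\<bar> \<le> b * real N \<longrightarrow> norm (f (y N i) - f (y N j)) \<le> e"
    using b(2)
  proof eventually_elim
    case (elim N)
    show ?case
    proof (intro allI impI)
      fix i j assume "\<bar>real_of_int i - real_of_int j\<bar> \<le> b * real N"
      then have "dist (y N i) (y N j) < d" using elim d(1) by (fastforce simp: dist_norm)
      then have "dist (f (y N i)) (f (y N j)) < e" using d(2) y(2) by blast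
      then show "norm (f (y N i) - f (y N j)) \<le> e" by (simp add: dist_norm)
    qed
  qed
  with b(1) show "\<exists>d>0. \<forall>\<^sub>F N in sequentially. \<forall>i j. \<bar>real_of_int i - real_of_int j\<bar> \<le> d * real N \<longrightarrow> norm (f (y N i) - f (y N j)) \<le> e"
    by blast
qed

context metric_matrix
begin

lemma discrete_velocity_mod:
  assumes "discrete_geodesic N x"
  shows "discrete_velocity N x (k mod int N) = discrete_velocity N x k"
proof -
  have x: "x (j mod int N) = x j" for j using assms by (simp add: discrete_geodesic_def)
  have "x (k mod int N + 1) = x ((k mod int N + 1) mod int N)" by (rule x[symmetric])
  also have "\<dots> = x (k + 1)" by (simp add: mod_add_left_eq x)
  finally show ?thesis by (simp add: discrete_velocity_def x)
qed

lemma sum_discrete_energy: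
  assumes "N > 0"
  shows "real N * (real N * (\<Sum>k<N. chord (x (int k)) (x (int k + 1)))) =
    (\<Sum>k<N. discrete_velocity N x (int k) \<bullet> discrete_momentum N x (int k))"
  by (simp add: discrete_momentum_def discrete_velocity_def chord_def sum_distrib_left matrix_vector_mult_scaleR mult.assoc)

text \<open>Quadratic growth is the point: it lets the energy, a sum of squared velocities, control
  the total variation of the momentum.\<close>

lemma norm_momentum_rate_le:
  assumes x: "x \<in> S2" "x' \<in> S2" and \<Lambda>: "\<Lambda> > 0" "\<And>x v. x \<in> S2 \<Longrightarrow> norm (M x *v v) \<le> \<Lambda> * norm v"
    "\<And>x v. x \<in> S2 \<Longrightarrow> norm (force x v) \<le> \<Lambda> * (norm v)\<^sup>2"
  shows "norm (momentum_rate ((x', v'), (x, v))) \<le> (\<Lambda> + r\<^sup>2) * ((norm v')\<^sup>2 + (norm v)\<^sup>2)"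
proof -
  have "\<bar>v \<bullet> (M x *v v)\<bar> \<le> norm v * norm (M x *v v)" by (rule Cauchy_Schwarz_ineq2)
  also have "\<dots> \<le> norm v * (\<Lambda> * norm v)" by (intro mult_left_mono \<Lambda> x) auto
  finally have 1: "\<bar>v \<bullet> (M x *v v)\<bar> \<le> \<Lambda> * (norm v)\<^sup>2" by (simp add: power2_eq_square algebra_simps)
  have "\<bar>v' \<bullet> v' - v \<bullet> v\<bar> \<le> (norm v')\<^sup>2 + (norm v)\<^sup>2"
    by (simp add: power2_norm_eq_inner abs_le_iff)
  then have "\<bar>r\<^sup>2 / 2 * (v' \<bullet> v' - v \<bullet> v)\<bar> \<le> r\<^sup>2 / 2 * ((norm v')\<^sup>2 + (norm v)\<^sup>2)"
    unfolding abs_mult by (intro mult_mono) auto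
  also have "\<dots> \<le> r\<^sup>2 * ((norm v')\<^sup>2 + (norm v)\<^sup>2)" by (intro mult_right_mono) auto
  finally have 2: "\<bar>r\<^sup>2 / 2 * (v' \<bullet> v' - v \<bullet> v)\<bar> \<le> r\<^sup>2 * ((norm v')\<^sup>2 + (norm v)\<^sup>2)" .
  have "norm (momentum_rate ((x', v'), (x, v))) \<le> norm (force x' v') +
      norm ((v \<bullet> (M x *v v) + r\<^sup>2 / 2 * (v' \<bullet> v' - v \<bullet> v)) *\<^sub>R x')"
    unfolding momentum_rate_def case_prod_conv by (rule norm_triangle_ineq4)
  also have "\<dots> = norm (force x' v') + \<bar>v \<bullet> (M x *v v) + r\<^sup>2 / 2 * (v' \<bullet> v' - v \<bullet> v)\<bar>"
    using x by simp
  also have "\<dots> \<le> \<Lambda> * (norm v')\<^sup>2 + (\<Lambda> * (norm v)\<^sup>2 + r\<^sup>2 * ((norm v')\<^sup>2 + (norm v)\<^sup>2))"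
    using \<Lambda>(3)[OF x(2), of v'] 1 2 by linarith
  finally show ?thesis by (simp add: algebra_simps)
qed

text \<open>The increments of the momentum within one period sum to at most a constant times the
  mean squared velocity, which the energy bounds. At some vertex the squared velocity is no larger
  than that bound on its mean, so the momentum is bounded there and thus everywhere; definiteness of
  \<open>M\<close> turns this into a bound for the velocity.\<close>

lemma discrete_velocity_bound:
  obtains K where "K > 0"
    "\<And>N x k. N > 0 \<Longrightarrow> discrete_geodesic N x \<Longrightarrow>
      real N * (\<Sum>k<N. chord (x (int k)) (x (int k + 1))) \<le> C \<Longrightarrow> norm (discrete_velocity N x k) \<le> K"
    "\<And>N x k. N > 0 \<Longrightarrow> discrete_geodesic N x \<Longrightarrow>
      real N * (\<Sum>k<N. chord (x (int k)) (x (int k + 1))) \<le> C \<Longrightarrow>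
      norm (momentum_rate ((x (k + 1), discrete_velocity N x (k + 1)), (x k, discrete_velocity N x k))) \<le> K"
proof -
  obtain \<Lambda> where \<Lambda>: "\<Lambda> > 0" "\<And>x v. x \<in> S2 \<Longrightarrow> norm (M x *v v) \<le> \<Lambda> * norm v"
    "\<And>x v. x \<in> S2 \<Longrightarrow> norm (force x v) \<le> \<Lambda> * (norm v)\<^sup>2"
    using norm_bounds by blast
  define A where "A = \<Lambda> + r\<^sup>2"
  define c where "c = \<bar>C\<bar> / r\<^sup>2"
  have A: "A > 0" using \<Lambda> by (simp add: A_def add_pos_nonneg)
  have c: "c \<ge> 0" by (simp add: c_def)
  \<comment> \<open>\<open>\<Lambda> * sqrt c\<close> bounds the momentum at a slow vertex. The rest
    is twice the variation bound \<open>2 * A * c\<close>: once from the slow vertex to vertex 0 and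
    once from there on.\<close>
  define B where "B = \<Lambda> * sqrt c + 4 * A * c"
  define K1 where "K1 = B / r\<^sup>2"
  have B: "B \<ge> 0" "K1 \<ge> 0" using \<Lambda> A c by (auto simp: B_def K1_def)
  have vel: "norm (discrete_velocity N x k) \<le> K1"
    and rate: "norm (momentum_rate ((x (k + 1), discrete_velocity N x (k + 1)), (x k, discrete_velocity N x k))) \<le> A * (K1\<^sup>2 + K1\<^sup>2)"
    if N: "N > 0" and x: "discrete_geodesic N x"
      and E: "real N * (\<Sum>k<N. chord (x (int k)) (x (int k + 1))) \<le> C" for N x k
  proof -
    let ?v = "discrete_velocity N x" and ?p = "discrete_momentum N x"
    have S: "x j \<in> S2" for j using x by (simp add: discrete_geodesic_def)
    have n: "real N > 0" using N by simp
    let ?f = "\<lambda>k. (norm (?v (int k)))\<^sup>2"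
    have low: "r\<^sup>2 * (norm (?v j))\<^sup>2 \<le> ?v j \<bullet> ?p j" for j
      using M_lower[OF S, of "?v j" j] by (simp add: discrete_momentum_def dot_square_norm)
    have "r\<^sup>2 * (\<Sum>k<N. ?f k) \<le> (\<Sum>k<N. ?v (int k) \<bullet> ?p (int k))"
      unfolding sum_distrib_left by (intro sum_mono low)
    also have "\<dots> \<le> real N * C"
      unfolding sum_discrete_energy[OF N, symmetric] using E n by (intro mult_left_mono) auto
    also have "\<dots> \<le> real N * (r\<^sup>2 * c)" using r_pos by (intro mult_left_mono) (auto simp: c_def)
    finally have "r\<^sup>2 * (\<Sum>k<N. ?f k) \<le> r\<^sup>2 * (real N * c)" by (simp add: mult_ac)
    then have V: "(\<Sum>k<N. ?f k) \<le> real N * c"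
      using r_pos mult_le_cancel_left_pos[of "r\<^sup>2"] by simp
    obtain k0 where k0: "k0 < N" "?f k0 \<le> c" using ex_index_le_average[OF N V] by blast
    let ?P = "\<lambda>l. ?p (int l)"
    have stp: "norm (?P (Suc l) - ?P l) \<le> A / real N * (?f (Suc l) + ?f l)" for l
    proof -
      have "?P (Suc l) - ?P l = (1 / real N) *\<^sub>R
          momentum_rate ((x (int l + 1), ?v (int l + 1)), (x (int l), ?v (int l)))"
        using discrete_momentum_step[OF x N, of "int l"] by (simp add: add.commute)
      then have "norm (?P (Suc l) - ?P l) = (1 / real N) *
          norm (momentum_rate ((x (int l + 1), ?v (int l + 1)), (x (int l), ?v (int l))))" using n by simp
      also have "\<dots> \<le> (1 / real N) * (A * ((norm (?v (int l + 1)))\<^sup>2 + (norm (?v (int l)))\<^sup>2))"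
        unfolding A_def using n by (intro mult_left_mono norm_momentum_rate_le S \<Lambda>) auto
      finally show ?thesis by (simp add: add.commute)
    qed
    \<comment> \<open>Stopping one step short of \<open>N\<close> keeps both \<open>l\<close> and
      \<open>Suc l\<close> within one period.\<close>
    obtain n' where n': "N = Suc n'" using N by (cases N) auto
    have P0: "norm (?P j - ?P 0) \<le> 2 * A * c" if "j < N" for j
    proof -
      have "?P j - ?P 0 = (\<Sum>l<j. ?P (Suc l) - ?P l)" by (rule sum_lessThan_telescope[symmetric])
      then have "norm (?P j - ?P 0) \<le> (\<Sum>l<j. norm (?P (Suc l) - ?P l))" by (simp only: norm_sum)
      also have "\<dots> \<le> (\<Sum>l<j. A / real N * (?f (Suc l) + ?f l))" by (intro sum_mono stp)
      also have "\<dots> \<le> (\<Sum>l<n'. A / real N * (?f (Suc l) + ?f l))"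
        using that n' A by (intro sum_mono2) auto
      also have "\<dots> = A / real N * ((\<Sum>l<n'. ?f (Suc l)) + (\<Sum>l<n'. ?f l))"
        by (simp only: sum_distrib_left[symmetric] sum.distrib)
      also have "\<dots> \<le> A / real N * (real N * c + real N * c)"
      proof (intro mult_left_mono add_mono)
        show "(\<Sum>l<n'. ?f (Suc l)) \<le> real N * c"
          using V unfolding n' sum.lessThan_Suc_shift by (smt (verit) zero_le_power2)
        show "(\<Sum>l<n'. ?f l) \<le> real N * c"
          using V unfolding n' sum.lessThan_Suc by (smt (verit) zero_le_power2)
      qed (use A n in auto)
      also have "\<dots> = 2 * A * c" using n by (simp add: field_simps)
      finally show ?thesis .
    qed
    have "norm (?v (int k0)) \<le> sqrt c" using k0 real_le_rsqrt by blast
    then have "norm (?P k0) \<le> \<Lambda> * sqrt c"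
      using order_trans[OF \<Lambda>(2)[OF S] mult_left_mono] \<Lambda>(1) unfolding discrete_momentum_def by auto
    then have Pk0: "norm (?P k0) \<le> \<Lambda> * sqrt c" .
    have tri: "norm (?P j) \<le> norm (?P k0) + norm (?P k0 - ?P 0) + norm (?P j - ?P 0)" for j
      using norm_triangle_sub[of "?P j" "?P 0"] norm_triangle_sub[of "?P 0" "?P k0"]
        norm_minus_commute[of "?P 0" "?P k0"] by linarith
    have P: "norm (?P j) \<le> B" if "j < N" for j
      using P0[OF that] P0[OF k0(1)] tri[of j] Pk0 unfolding B_def by linarith
    have vj: "norm (?v (int j)) \<le> K1" if "j < N" for j
    proof (cases "?v (int j) = 0")
      case False
      have "r\<^sup>2 * (norm (?v (int j)))\<^sup>2 \<le> norm (?v (int j)) * norm (?P j)"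
        using low[of "int j"] norm_cauchy_schwarz[of "?v (int j)" "?P j"] by linarith
      also have "\<dots> \<le> norm (?v (int j)) * B" using P[OF that] by (intro mult_left_mono) auto
      finally have "norm (?v (int j)) * (r\<^sup>2 * norm (?v (int j))) \<le> norm (?v (int j)) * B"
        by (simp add: power2_eq_square mult_ac)
      then have "r\<^sup>2 * norm (?v (int j)) \<le> B" using False by simp
      then show ?thesis using r_pos by (simp add: K1_def field_simps)
    qed (use B in simp)
    have vk: "norm (?v k) \<le> K1" for k
    proof -
      have "nat (k mod int N) < N" "int (nat (k mod int N)) = k mod int N" using N by (auto simp: nat_less_iff)
      then show ?thesis using vj[of "nat (k mod int N)"] discrete_velocity_mod[OF x, of k] by simp
    qed
    show "norm (?v k) \<le> K1" by (rule vk)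
    have "norm (momentum_rate ((x (k + 1), ?v (k + 1)), (x k, ?v k))) \<le> A * ((norm (?v (k + 1)))\<^sup>2 + (norm (?v k))\<^sup>2)"
      unfolding A_def by (intro norm_momentum_rate_le S \<Lambda>)
    also have "\<dots> \<le> A * (K1\<^sup>2 + K1\<^sup>2)" using vk A by (intro mult_left_mono add_mono power_mono) auto
    finally show "norm (momentum_rate ((x (k + 1), ?v (k + 1)), (x k, ?v k))) \<le> A * (K1\<^sup>2 + K1\<^sup>2)" .
  qed
  define K where "K = K1 + A * (K1\<^sup>2 + K1\<^sup>2) + 1"
  have "K1 \<le> K" "A * (K1\<^sup>2 + K1\<^sup>2) \<le> K" "K > 0" using B A by (auto simp: K_def add_nonneg_pos)
  then show ?thesis using vel rate that[of K] by (meson order_trans)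
qed

lemma continuous_on_momentum_rate:
  "continuous_on ((S2 \<times> UNIV) \<times> (S2 \<times> UNIV)) momentum_rate"
proof -
  have f: "continuous_on A (\<lambda>z. force (g z) (h z))"
    if "continuous_on A g" "continuous_on A h" "g ` A \<subseteq> S2" for A :: "(((real^3) \<times> (real^3)) \<times> ((real^3) \<times> (real^3))) set" and g h
    unfolding force_def
    by (intro continuous_intros that bounded_bilinear.continuous_on[OF bounded_bilinear_matrix_vector_mult]
        continuous_on_compose2[OF continuous_on_DM])
  show ?thesis
    unfolding momentum_rate_def case_prod_unfold
    by (intro continuous_on_diff continuous_on_scaleR continuous_on_add continuous_on_inner continuous_on_mult
        continuous_on_const continuous_on_fst continuous_on_snd continuous_on_id f
        bounded_bilinear.continuous_on[OF bounded_bilinear_matrix_vector_mult]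
        continuous_on_compose2[OF continuous_on_M]) auto
qed

end

section \<open>The limit curve\<close>

context metric_matrix
begin

text \<open>Position is an Euler scheme with the velocity as slope, momentum one with
  \<open>momentum_rate\<close> as slope. Both slopes are equicontinuous, so limits along one filter
  satisfy the differential equations. Neighbouring indices merge in the limit, which cancels the
  difference of squared velocities in \<open>momentum_rate\<close>.\<close>

lemma ex_limit_geodesic:
  obtains c v where "\<forall>t. c t \<in> S2" "\<forall>t. c (t + 1) = c t"
    "\<forall>t. (c has_vector_derivative v t) (at t)"
    "\<forall>t. ((\<lambda>t. M (c t) *v v t) has_vector_derivative
      force (c t) (v t) - (v t \<bullet> (M (c t) *v v t)) *\<^sub>R c t) (at t)"
    "\<exists>t. v t \<bullet> (M (c t) *v v t) \<le> 4 * pi\<^sup>2 * R\<^sup>2"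
    "\<exists>t. r\<^sup>2 / 16 \<le> v t \<bullet> (M (c t) *v v t)"
proof -
  define C where "C = 4 * pi\<^sup>2 * R\<^sup>2"
  let ?en = "\<lambda>N x. real N * (\<Sum>k<N. chord (x (int k)) (x (int k + 1)))"
  obtain N0 where N0: "N0 > 0" and "\<forall>N\<ge>N0. \<exists>x. discrete_geodesic N x \<and> r\<^sup>2 / 16 \<le> ?en N x \<and> ?en N x \<le> C"
    using ex_discrete_geodesic unfolding C_def by blast
  then have "\<forall>N. \<exists>x. N \<ge> N0 \<longrightarrow> discrete_geodesic N x \<and> r\<^sup>2 / 16 \<le> ?en N x \<and> ?en N x \<le> C" by blast
  from choice[OF this] obtain X0 where
    X0: "\<And>N. N \<ge> N0 \<Longrightarrow> discrete_geodesic N (X0 N) \<and> r\<^sup>2 / 16 \<le> ?en N (X0 N) \<and> ?en N (X0 N) \<le> C" by blast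
  \<comment> \<open>For small \<open>N\<close> a constant polygon is inserted, so that positions and
    velocities lie in fixed compact sets for every \<open>N\<close>, as the cluster argument
    demands.\<close>
  define X where "X N = (if N \<ge> N0 then X0 N else (\<lambda>k. axis 1 1))" for N
  have XX: "discrete_geodesic N (X N)" "r\<^sup>2 / 16 \<le> ?en N (X N)" "?en N (X N) \<le> C" if "N \<ge> N0" for N
    using X0[OF that] that by (simp_all add: X_def)
  have XS: "X N k \<in> S2" for N k
    using X0[of N] by (auto simp: X_def discrete_geodesic_def norm_axis_1)
  define V where "V N = discrete_velocity N (X N)" for N
  define P where "P N k = M (X N k) *v V N k" for N k
  define Z where "Z N k = (X N k, V N k)" for N k
  define W where "W N k = momentum_rate (Z N (k + 1), Z N k)" for N k
  obtain K where K: "K > 0" and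
    K1: "\<And>N x k. N > 0 \<Longrightarrow> discrete_geodesic N x \<Longrightarrow> ?en N x \<le> C \<Longrightarrow> norm (discrete_velocity N x k) \<le> K" and
    K2: "\<And>N x k. N > 0 \<Longrightarrow> discrete_geodesic N x \<Longrightarrow> ?en N x \<le> C \<Longrightarrow>
      norm (momentum_rate ((x (k + 1), discrete_velocity N x (k + 1)), (x k, discrete_velocity N x k))) \<le> K"
    using discrete_velocity_bound[of C] by blast
  have big: "\<forall>\<^sub>F N in sequentially. N \<ge> N0" by (rule eventually_ge_at_top)
  have V: "norm (V N k) \<le> K" for N k
  proof (cases "N \<ge> N0")
    case True
    then show ?thesis unfolding V_def using XX[OF True] N0 by (intro K1) auto
  next
    case False
    then show ?thesis using K by (simp add: V_def discrete_velocity_def X_def)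
  qed
  have W: "norm (W N k) \<le> K" if "N \<ge> N0" for N k
    unfolding W_def Z_def V_def using XX[OF that] N0 that by (intro K2) auto
  have Xstep: "X N (k + 1) = X N k + (1 / real N) *\<^sub>R V N k" if "N \<ge> N0" for N k
    using that N0 by (simp add: V_def discrete_velocity_def)
  have Pstep: "P N (k + 1) = P N k + (1 / real N) *\<^sub>R W N k" if "N \<ge> N0" for N k
  proof -
    have "discrete_momentum N (X N) = P N" by (simp add: fun_eq_iff discrete_momentum_def P_def V_def)
    then show ?thesis
      using discrete_momentum_step[OF XX(1)[OF that], of k] that N0 by (simp add: W_def Z_def V_def algebra_simps)
  qed
  let ?A = "S2 \<times> cball 0 K :: ((real^3) \<times> (real^3)) set"
  have ZA: "\<forall>N k. Z N k \<in> ?A" using XS V by (simp add: Z_def)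
  have "\<forall>\<^sub>F N in sequentially. \<forall>k. norm (X N (k + 1) - X N k) \<le> K / real N"
    using big by eventually_elim (simp add: Xstep V divide_right_mono)
  then have eX: "equicont X" by (rule equicont_lipschitz[OF K])
  have "\<forall>\<^sub>F N in sequentially. \<forall>k. norm (P N (k + 1) - P N k) \<le> K / real N"
    using big by eventually_elim (simp add: Pstep W divide_right_mono)
  then have eP: "equicont P" by (rule equicont_lipschitz[OF K])
  have eM: "equicont (\<lambda>N k. M (X N k))"
    by (rule equicont_compose[OF eX _ continuous_on_M compact_sphere]) (use XS in blast)
  \<comment> \<open>Equicontinuity of the velocity is recovered from that of momentum and position:
    M(x_i)(v_i - v_j) equals (p_i - p_j) - (M(x_i) - M(x_j)) v_j, and \<open>M\<close> is bounded
    below.\<close>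
  have eV: "equicont V"
  proof -
    obtain B where B: "B > 0" "\<And>(A::real^3^3) (v::real^3). norm (A *v v) \<le> norm A * norm v * B"
      using bounded_bilinear.pos_bounded[OF bounded_bilinear_matrix_vector_mult] by blast
    have key: "r\<^sup>2 * norm (V N i - V N j) \<le> norm (P N i - P N j) + norm (M (X N i) - M (X N j)) * (K * B)" for N i j
    proof (cases "V N i = V N j")
      case False
      let ?d = "V N i - V N j"
      have "M (X N i) *v ?d = (P N i - P N j) - (M (X N i) - M (X N j)) *v V N j"
        by (simp add: P_def matrix_vector_mult_diff_distrib matrix_vector_mult_diff_rdistrib)
      moreover have "norm ((M (X N i) - M (X N j)) *v V N j) \<le> norm (M (X N i) - M (X N j)) * norm (V N j) * B"
        by (rule B)
      moreover have "\<dots> \<le> norm (M (X N i) - M (X N j)) * K * B"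
        using V B by (intro mult_right_mono mult_left_mono) auto
      ultimately have n: "norm (M (X N i) *v ?d) \<le> norm (P N i - P N j) + norm (M (X N i) - M (X N j)) * (K * B)"
        using norm_triangle_ineq4[of "P N i - P N j" "(M (X N i) - M (X N j)) *v V N j"] by (simp add: mult.assoc)
      have "norm ?d * (r\<^sup>2 * norm ?d) = r\<^sup>2 * (?d \<bullet> ?d)" by (simp add: dot_square_norm power2_eq_square)
      also have "\<dots> \<le> ?d \<bullet> (M (X N i) *v ?d)" by (rule M_lower[OF XS])
      also have "\<dots> \<le> norm ?d * norm (M (X N i) *v ?d)" by (rule norm_cauchy_schwarz)
      finally have "r\<^sup>2 * norm ?d \<le> norm (M (X N i) *v ?d)" using False by simp
      with n show ?thesis by linarith
    qed (use K B in simp)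
    show ?thesis
      unfolding equicont_def
    proof (intro allI impI)
      fix e :: real assume e: "e > 0"
      then have "r\<^sup>2 * e / (1 + K * B) > 0" using r_pos K B by (intro divide_pos_pos mult_pos_pos add_pos_pos) auto
      then obtain d where d: "d > 0" "\<forall>\<^sub>F N in sequentially. \<forall>i j. \<bar>real_of_int i - real_of_int j\<bar> \<le> d * real N \<longrightarrow>
          norm ((P N i, M (X N i)) - (P N j, M (X N j))) \<le> r\<^sup>2 * e / (1 + K * B)"
        using equicont_Pair[OF eP eM] unfolding equicont_def by blast
      have "\<forall>\<^sub>F N in sequentially. \<forall>i j. \<bar>real_of_int i - real_of_int j\<bar> \<le> d * real N \<longrightarrow> norm (V N i - V N j) \<le> e"
        using d(2)
      proof eventually_elim
        case (elim N)
        show ?case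
        proof (intro allI impI)
          fix i j assume ij: "\<bar>real_of_int i - real_of_int j\<bar> \<le> d * real N"
          let ?q = "r\<^sup>2 * e / (1 + K * B)"
          have "norm (P N i - P N j, M (X N i) - M (X N j)) \<le> ?q" using elim ij by simp
          then have "norm (P N i - P N j) \<le> ?q" "norm (M (X N i) - M (X N j)) \<le> ?q"
            using norm_fst_le[of "P N i - P N j" "M (X N i) - M (X N j)"]
              norm_snd_le[of "M (X N i) - M (X N j)" "P N i - P N j"] by linarith+
          then have "norm (P N i - P N j) + norm (M (X N i) - M (X N j)) * (K * B) \<le> ?q + ?q * (K * B)"
            using K B by (intro add_mono mult_right_mono) auto
          also have "?q + ?q * (K * B) = ?q * (1 + K * B)" by (simp add: distrib_left)
          also have "\<dots> = r\<^sup>2 * e" using K B by (simp add: add_pos_pos less_imp_neq[symmetric])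
          finally have "r\<^sup>2 * norm (V N i - V N j) \<le> r\<^sup>2 * e" using key[of N i j] by linarith
          then show "norm (V N i - V N j) \<le> e" using r_pos by simp
        qed
      qed
      with d(1) show "\<exists>d>0. \<forall>\<^sub>F N in sequentially. \<forall>i j. \<bar>real_of_int i - real_of_int j\<bar> \<le> d * real N \<longrightarrow> norm (V N i - V N j) \<le> e"
        by blast
    qed
  qed
  have eZ: "equicont Z" unfolding Z_def by (rule equicont_Pair[OF eX eV])
  have cA: "compact (?A \<times> ?A)" by (intro compact_Times) auto
  have cmr: "continuous_on (?A \<times> ?A) momentum_rate"
    by (rule continuous_on_subset[OF continuous_on_momentum_rate]) auto
  have eW: "equicont W"
    unfolding W_def
    by (rule equicont_compose[OF equicont_Pair[OF equicont_shift[OF eZ] eZ] _ cmr cA]) (use ZA in blast)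
  define e where "e N k = V N k \<bullet> P N k" for N k
  have sum_e: "(\<Sum>k<N. e N (int k)) = real N * ?en N (X N)" if "N > 0" for N
    unfolding sum_discrete_energy[OF that] by (simp add: e_def P_def V_def discrete_momentum_def)
  \<comment> \<open>The mean of \<open>e\<close> over a period is the polygon energy, so some vertex
    obeys the upper bound and some vertex the lower one. The limit will have constant energy, so one
    time for each bound suffices.\<close>
  have "\<exists>k. N \<ge> N0 \<longrightarrow> k < N \<and> e N (int k) \<le> C" for N
    using ex_index_le_average[of N "\<lambda>k. e N (int k)" C] sum_e[of N] XX(3)[of N] N0 mult_left_mono[of "?en N (X N)" C "real N"]
    by (cases "N \<ge> N0") auto
  then have "\<forall>N. \<exists>k. N \<ge> N0 \<longrightarrow> k < N \<and> e N (int k) \<le> C" by blast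
  from choice[OF this] obtain a where a: "\<And>N. N \<ge> N0 \<Longrightarrow> a N < N \<and> e N (int (a N)) \<le> C" by blast
  have "\<exists>k. N \<ge> N0 \<longrightarrow> k < N \<and> r\<^sup>2 / 16 \<le> e N (int k)" for N
    using ex_index_le_average[of N "\<lambda>k. - e N (int k)" "- r\<^sup>2 / 16"] sum_e[of N] XX(2)[of N] N0
      mult_left_mono[of "r\<^sup>2 / 16" "?en N (X N)" "real N"]
    by (cases "N \<ge> N0") (auto simp: sum_negf)
  then have "\<forall>N. \<exists>k. N \<ge> N0 \<longrightarrow> k < N \<and> r\<^sup>2 / 16 \<le> e N (int k)" by blast
  from choice[OF this] obtain b where b: "\<And>N. N \<ge> N0 \<Longrightarrow> b N < N \<and> r\<^sup>2 / 16 \<le> e N (int (b N))" by blast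
  define \<alpha> where "\<alpha> N = (if N \<ge> N0 then real (a N) / real N else 0)" for N
  define \<beta> where "\<beta> N = (if N \<ge> N0 then real (b N) / real N else 0)" for N
  have \<alpha>\<beta>: "\<alpha> N \<in> {0..1}" "\<beta> N \<in> {0..1}" for N
    using a[of N] b[of N] by (auto simp: \<alpha>_def \<beta>_def)
  \<comment> \<open>The rescaled positions of the two special vertices are carried along, so that
    the same filter makes them converge.\<close>
  define Y where "Y N t = (Z N \<lfloor>real N * t\<rfloor>, (\<alpha> N, \<beta> N))" for N and t :: real
  have cK: "compact (?A \<times> ({0..1::real} \<times> {0..1::real}))" by (intro compact_Times) auto
  have YK: "Y N t \<in> ?A \<times> ({0..1::real} \<times> {0..1::real})" for N t
    unfolding Y_def using ZA \<alpha>\<beta> by (intro SigmaI) auto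
  obtain F y where F: "F \<le> sequentially" "F \<noteq> bot" and yK: "\<forall>t. y t \<in> ?A \<times> ({0..1::real} \<times> {0..1::real})"
    and ylim: "\<forall>t. ((\<lambda>N. Y N t) \<longlongrightarrow> y t) F"
    using cluster_filter[of _ Y, OF cK YK] by blast
  define c where "c t = fst (fst (y t))" for t
  define v where "v t = snd (fst (y t))" for t
  have yt: "fst (y t) = (c t, v t)" for t by (simp add: c_def v_def)
  have Zlim: "((\<lambda>N. Z N \<lfloor>real N * t\<rfloor>) \<longlongrightarrow> (c t, v t)) F" for t
    using tendsto_fst[OF ylim[rule_format, of t]] by (simp add: Y_def yt)
  have Xlim: "((\<lambda>N. X N \<lfloor>real N * t\<rfloor>) \<longlongrightarrow> c t) F" and Vlim: "((\<lambda>N. V N \<lfloor>real N * t\<rfloor>) \<longlongrightarrow> v t) F" for t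
    using tendsto_fst[OF Zlim[of t]] tendsto_snd[OF Zlim[of t]] by (simp_all add: Z_def)
  have cS: "c t \<in> S2" for t using yK by (auto simp: c_def mem_Times_iff)
  have bigF: "\<forall>\<^sub>F N in F. N \<ge> N0" using big F(1) by (simp add: le_filter_def)
  have Plim: "((\<lambda>N. P N \<lfloor>real N * t\<rfloor>) \<longlongrightarrow> M (c t) *v v t) F" for t
    unfolding P_def
    by (intro bounded_bilinear.tendsto[OF bounded_bilinear_matrix_vector_mult] tendsto_M Xlim Vlim cS)
  \<comment> \<open>The next index is the time later by 1 / N, a difference that equicontinuity
    removes in the limit.\<close>
  have Zlim1: "((\<lambda>N. Z N (\<lfloor>real N * t\<rfloor> + 1)) \<longlongrightarrow> (c t, v t)) F" for t
  proof -
    have "((\<lambda>N. t + 1 / real N) \<longlongrightarrow> t) F"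
      using tendsto_mono[OF F(1) tendsto_add[OF tendsto_const lim_const_over_n[of 1]]] by simp
    from equicont_limit_moving[OF F(1) eZ Zlim[of t] this]
    have "((\<lambda>N. Z N \<lfloor>real N * (t + 1 / real N)\<rfloor>) \<longlongrightarrow> (c t, v t)) F" .
    moreover have "\<forall>\<^sub>F N in F. Z N \<lfloor>real N * (t + 1 / real N)\<rfloor> = Z N (\<lfloor>real N * t\<rfloor> + 1)"
      using bigF
    proof eventually_elim
      case (elim N)
      then have "real N * (t + 1 / real N) = real N * t + 1" using N0 by (simp add: distrib_left)
      then show ?case by simp
    qed
    ultimately show ?thesis by (rule Lim_transform_eventually)
  qed
  have ZyA: "(c t, v t) \<in> ?A" for t using yK[rule_format, of t] unfolding yt[symmetric] by (auto simp: mem_Times_iff)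
  have Wlim: "((\<lambda>N. W N \<lfloor>real N * t\<rfloor>) \<longlongrightarrow> force (c t) (v t) - (v t \<bullet> (M (c t) *v v t)) *\<^sub>R c t) F" for t
  proof -
    have "((\<lambda>N. momentum_rate (Z N (\<lfloor>real N * t\<rfloor> + 1), Z N \<lfloor>real N * t\<rfloor>)) \<longlongrightarrow> momentum_rate ((c t, v t), (c t, v t))) F"
      by (rule continuous_on_tendsto_compose[OF cmr tendsto_Pair[OF Zlim1 Zlim]]) (use ZA ZyA in auto)
    then show ?thesis by (simp add: W_def momentum_rate_def)
  qed
  have "\<forall>\<^sub>F N in sequentially. \<forall>k. X N (k + 1) = X N k + (1 / real N) *\<^sub>R V N k"
    using big by eventually_elim (use Xstep in blast)
  from euler_scheme_limit[OF F this eV, of c v]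
  have dc: "(c has_vector_derivative v t) (at t)" for t using Xlim Vlim by blast
  have "\<forall>\<^sub>F N in sequentially. \<forall>k. P N (k + 1) = P N k + (1 / real N) *\<^sub>R W N k"
    using big by eventually_elim (use Pstep in blast)
  from euler_scheme_limit[OF F this eW, of "\<lambda>t. M (c t) *v v t"
      "\<lambda>t. force (c t) (v t) - (v t \<bullet> (M (c t) *v v t)) *\<^sub>R c t"]
  have dP: "((\<lambda>t. M (c t) *v v t) has_vector_derivative
      force (c t) (v t) - (v t \<bullet> (M (c t) *v v t)) *\<^sub>R c t) (at t)" for t using Plim Wlim by blast
  have per: "c (t + 1) = c t" for t
  proof -
    have "\<forall>\<^sub>F N in F. X N \<lfloor>real N * (t + 1)\<rfloor> = X N \<lfloor>real N * t\<rfloor>"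
      using bigF
    proof eventually_elim
      case (elim N)
      have m: "X N (j mod int N) = X N j" for j using XX(1)[OF elim] by (simp add: discrete_geodesic_def)
      have "real N * (t + 1) = real N * t + of_int (int N)" by (simp add: distrib_left)
      then have "\<lfloor>real N * (t + 1)\<rfloor> = \<lfloor>real N * t\<rfloor> + int N" by (simp only: floor_add_int)
      then show ?case using m[of "\<lfloor>real N * t\<rfloor> + int N"] m[of "\<lfloor>real N * t\<rfloor>"] by simp
    qed
    from Lim_transform_eventually[OF Xlim[of "t + 1"] this]
    show ?thesis by (rule tendsto_unique[OF F(2) _ Xlim[of t]])
  qed
  have elim': "((\<lambda>N. e N \<lfloor>real N * s N\<rfloor>) \<longlongrightarrow> v t \<bullet> (M (c t) *v v t)) F" if "(s \<longlongrightarrow> t) F" for s t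
    unfolding e_def
    by (intro tendsto_inner equicont_limit_moving[OF F(1) eV Vlim[of t] that] equicont_limit_moving[OF F(1) eP Plim[of t] that])
  have \<alpha>lim: "(\<alpha> \<longlongrightarrow> fst (snd (y 0))) F" and \<beta>lim: "(\<beta> \<longlongrightarrow> snd (snd (y 0))) F"
    using tendsto_fst[OF tendsto_snd[OF ylim[rule_format, of 0]]] tendsto_snd[OF tendsto_snd[OF ylim[rule_format, of 0]]]
    by (simp_all add: Y_def)
  have "\<forall>\<^sub>F N in F. e N \<lfloor>real N * \<alpha> N\<rfloor> \<le> C"
    using bigF by eventually_elim (use a N0 in \<open>auto simp: \<alpha>_def\<close>)
  from tendsto_upperbound[OF elim'[OF \<alpha>lim] this F(2)]
  have up: "v (fst (snd (y 0))) \<bullet> (M (c (fst (snd (y 0)))) *v v (fst (snd (y 0)))) \<le> C" .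
  have "\<forall>\<^sub>F N in F. r\<^sup>2 / 16 \<le> e N \<lfloor>real N * \<beta> N\<rfloor>"
    using bigF by eventually_elim (use b N0 in \<open>auto simp: \<beta>_def\<close>)
  from tendsto_lowerbound[OF elim'[OF \<beta>lim] this F(2)]
  have "r\<^sup>2 / 16 \<le> v (snd (snd (y 0))) \<bullet> (M (c (snd (snd (y 0)))) *v v (snd (snd (y 0))))" .
  then show ?thesis using that[of c v] cS per dc dP up unfolding C_def by blast
qed

end

section \<open>Smoothness and constant speed of the limit curve\<close>

lemma Ck_on_mult:
  fixes f g :: "'a::real_normed_vector \<Rightarrow> real"
  shows "open U \<Longrightarrow> Ck_on k U f \<Longrightarrow> Ck_on k U g \<Longrightarrow> Ck_on k U (\<lambda>x. f x * g x)"
  by (rule Ck_on_bilinear[OF _ bounded_bilinear_mult])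

lemma Ck_on_diff:
  assumes "open U" "Ck_on k U f" "Ck_on k U g"
  shows "Ck_on k U (\<lambda>x. f x - g x)"
  using Ck_on_add[OF assms(1,2) Ck_on_linear[OF assms(1) bounded_linear_minus[OF bounded_linear_ident] assms(3)]]
  by simp

lemma Ck_on_vec:
  fixes f :: "'a::real_normed_vector \<Rightarrow> real^'n"
  assumes "open U" "\<And>i. Ck_on k U (\<lambda>x. f x $ i)"
  shows "Ck_on k U f"
proof -
  have "Ck_on k U (\<lambda>x. \<Sum>i\<in>UNIV. f x $ i *\<^sub>R axis i (1::real))"
    by (intro Ck_on_sum[OF assms(1)] Ck_on_bilinear[OF assms(1) bounded_bilinear_scaleR] assms(2) Ck_on_const)
  moreover have "(\<Sum>i\<in>UNIV. w $ i *\<^sub>R axis i 1) = w" for w :: "real^'n"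
    using basis_expansion[of w] by (simp add: scalar_mult_eq_scaleR[symmetric])
  ultimately show ?thesis by (simp only:)
qed

lemma Ck_on_det3:
  fixes A :: "'a::real_normed_vector \<Rightarrow> real^3^3"
  assumes "open U" "\<And>i j. Ck_on k U (\<lambda>x. A x $ i $ j)"
  shows "Ck_on k U (\<lambda>x. det (A x))"
  unfolding det_3
  by (intro Ck_on_diff[OF assms(1)] Ck_on_add[OF assms(1)] Ck_on_mult[OF assms(1)] assms(2))

lemma Ck_on_has_vector_derivativeI:
  assumes "\<And>t. (f has_vector_derivative f' t) (at t)" "Ck_on k UNIV f'"
  shows "Ck_on (Suc k) UNIV (f :: real \<Rightarrow> 'b::real_normed_vector)"
proof (rule Ck_on_SucI[OF open_UNIV])
  show "(f has_derivative (\<lambda>h. h *\<^sub>R f' t)) (at t)" for t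
    using assms(1) by (simp add: has_vector_derivative_def)
  show "Ck_on k UNIV (\<lambda>t. h *\<^sub>R f' t)" for h
    by (rule Ck_on_linear[OF open_UNIV bounded_linear_scaleR_right assms(2)])
qed

lemma det_nonzero_if_positive_definite:
  fixes A :: "real^'n^'n"
  assumes "\<And>u. u \<noteq> 0 \<Longrightarrow> u \<bullet> (A *v u) > 0"
  shows "det A \<noteq> 0"
proof -
  have "\<forall>x. A *v x = 0 \<longrightarrow> x = 0" using assms by (metis inner_zero_right less_irrefl)
  then show ?thesis
    using matrix_left_invertible_ker[of A] invertible_left_inverse[of A] invertible_det_nz[of A] by auto
qed

context metric_matrix
begin

lemma M_pos: "x \<in> S2 \<Longrightarrow> u \<noteq> 0 \<Longrightarrow> u \<bullet> (M x *v u) > 0"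
  using M_lower[of x u] r_pos by (smt (verit) inner_gt_zero_iff mult_pos_pos zero_less_power)

lemma smooth_DM: "smooth_on (-{0}) (\<lambda>x. DM x i)"
  unfolding DM_def by (rule smooth_on_frechet_derivative[OF smooth_M])

lemma DM_sym:
  assumes "x \<in> S2"
  shows "u \<bullet> (DM x \<xi> *v w) = w \<bullet> (DM x \<xi> *v u)"
proof -
  have d: "((\<lambda>x. a \<bullet> (M x *v b)) has_derivative (\<lambda>\<xi>. a \<bullet> (DM x \<xi> *v b))) (at x)" for a b
    by (intro has_derivative_inner_right bounded_linear.has_derivative[OF
          bounded_bilinear.bounded_linear_left[OF bounded_bilinear_matrix_vector_mult]]
        M_has_derivative S2_nonzero assms)
  have "((\<lambda>x. u \<bullet> (M x *v w)) has_derivative (\<lambda>\<xi>. w \<bullet> (DM x \<xi> *v u))) (at x)"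
  proof (rule has_derivative_transform_within_open[OF d, of "-{0}"])
    fix z :: "real^3" assume "z \<in> -{0}"
    then have "z \<noteq> 0" by simp
    then show "w \<bullet> (M z *v u) = u \<bullet> (M z *v w)"
      using M_sym[of "sgn z" w u] M_sgn[of z] by (simp add: norm_sgn)
  qed (use S2_nonzero[OF assms] in auto)
  from has_derivative_unique[OF this d] show ?thesis by metis
qed

end

text \<open>Hamilton's equations for motion on the sphere. The term along \<open>c t\<close> is the
  reaction of the constraint: the momentum p = M v satisfies p \<bullet> c = 0, and differentiating
  this forces the normal component of p' to be - p \<bullet> v.\<close>

locale limit_geodesic = metric_matrix +
  fixes c v :: "real \<Rightarrow> real^3"
  assumes c_S2: "c t \<in> S2"
    and c_deriv: "(c has_vector_derivative v t) (at t)"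
    and p_deriv: "((\<lambda>t. M (c t) *v v t) has_vector_derivative
      force (c t) (v t) - (v t \<bullet> (M (c t) *v v t)) *\<^sub>R c t) (at t)"
begin

definition p :: "real \<Rightarrow> real^3" where "p t = M (c t) *v v t"

lemma v_tangent: "v t \<bullet> c t = 0"
proof -
  have "((\<lambda>t. c t \<bullet> c t) has_vector_derivative (c t \<bullet> v t + v t \<bullet> c t)) (at t)"
    by (rule bounded_bilinear.has_vector_derivative[OF bounded_bilinear_inner c_deriv c_deriv])
  moreover have "(\<lambda>t. c t \<bullet> c t) = (\<lambda>t. 1)" using c_S2 by (simp add: fun_eq_iff dot_square_norm)
  ultimately have "((\<lambda>t. 1::real) has_vector_derivative (c t \<bullet> v t + v t \<bullet> c t)) (at t)" by simp
  from vector_derivative_unique_at[OF this has_vector_derivative_const] show ?thesis by (simp add: inner_commute)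
qed

text \<open>Cramer's rule displays the velocity as a rational function of \<open>p\<close> and the
  entries of \<open>M (c t)\<close> with nonvanishing denominator, so it inherits the regularity of
  \<open>c\<close> and \<open>p\<close>.\<close>

lemma v_cramer:
  "v t = (\<chi> k. det (\<chi> i j. if j = k then p t $ i else M (c t) $ i $ j) * inverse (det (M (c t))))"
proof -
  have "det (M (c t)) \<noteq> 0" by (rule det_nonzero_if_positive_definite[OF M_pos[OF c_S2]])
  then show ?thesis using cramer[of "M (c t)" "v t" "p t"] by (simp add: p_def divide_inverse)
qed

lemma Ck_on_velocity:
  assumes c: "Ck_on k UNIV c" and p: "Ck_on k UNIV p"
  shows "Ck_on k UNIV v"
proof -
  note o = open_UNIV[where 'a = real]
  have A: "Ck_on k UNIV (\<lambda>t. M (c t))"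
    by (rule Ck_on_compose[OF o, where V = "-{0}"])
       (use smooth_M c S2_nonzero[OF c_S2] in \<open>auto simp: smooth_on_def\<close>)
  have Aij: "Ck_on k UNIV (\<lambda>t. M (c t) $ i $ j)" for i j
    by (intro Ck_on_linear[OF o bounded_linear_vec_nth] A)
  have pi: "Ck_on k UNIV (\<lambda>t. p t $ i)" for i
    by (intro Ck_on_linear[OF o bounded_linear_vec_nth] p)
  have di: "Ck_on k UNIV (\<lambda>t. inverse (det (M (c t))))"
    by (rule Ck_on_compose[OF o, where V = "-{0}" and f = inverse])
       (use det_nonzero_if_positive_definite[OF M_pos[OF c_S2]] Ck_on_inverse Ck_on_det3[OF o Aij] in auto)
  have "Ck_on k UNIV (\<lambda>t. det (\<chi> i j. if j = l then p t $ i else M (c t) $ i $ j))" for l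
  proof (rule Ck_on_det3[OF o])
    show "Ck_on k UNIV (\<lambda>t. (\<chi> i j. if j = l then p t $ i else M (c t) $ i $ j) $ i $ j)" for i j
      using Aij pi by (cases "j = l") simp_all
  qed
  from Ck_on_mult[OF o this di]
  have "Ck_on k UNIV (\<lambda>t. v t $ l)" for l by (subst v_cramer) simp
  then show ?thesis by (rule Ck_on_vec[OF o])
qed

text \<open>Bootstrapping: the equations express the derivatives of \<open>c\<close> and
  \<open>p\<close> through \<open>c\<close>, \<open>p\<close> and \<open>v\<close>, and
  \<open>v\<close> is a function of \<open>c\<close> and \<open>p\<close>, so each round gains one
  derivative.\<close>

lemma Ck_on_curve: "Ck_on k UNIV c \<and> Ck_on k UNIV p"
proof (induction k)
  case 0
  have "continuous_on UNIV c"
    using c_deriv by (intro continuous_at_imp_continuous_on ballI has_vector_derivative_continuous) blast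
  moreover have "continuous_on UNIV p"
    using p_deriv unfolding p_def[abs_def]
    by (intro continuous_at_imp_continuous_on ballI has_vector_derivative_continuous) blast
  ultimately show ?case by simp
next
  case (Suc k)
  note o = open_UNIV[where 'a = real]
  have c: "Ck_on k UNIV c" and p: "Ck_on k UNIV p" using Suc by auto
  have v: "Ck_on k UNIV v" by (rule Ck_on_velocity[OF c p])
  have D: "Ck_on k UNIV (\<lambda>t. DM (c t) i)" for i
    by (rule Ck_on_compose[OF o, where V = "-{0}" and f = "\<lambda>x. DM x i"])
       (use smooth_DM c S2_nonzero[OF c_S2] in \<open>auto simp: smooth_on_def\<close>)
  have "Ck_on k UNIV (\<lambda>t. force (c t) (v t) - (v t \<bullet> p t) *\<^sub>R c t)"
    unfolding force_def
    by (intro Ck_on_diff[OF o] Ck_on_sum[OF o] Ck_on_bilinear[OF o bounded_bilinear_scaleR]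
        Ck_on_bilinear[OF o bounded_bilinear_inner] Ck_on_mult[OF o] Ck_on_const
        Ck_on_bilinear[OF o bounded_bilinear_matrix_vector_mult] D v p c)
  then have "Ck_on (Suc k) UNIV p"
    by (intro Ck_on_has_vector_derivativeI[where f = p]) (use p_deriv in \<open>simp_all add: p_def[abs_def]\<close>)
  moreover have "Ck_on (Suc k) UNIV c"
    by (rule Ck_on_has_vector_derivativeI[OF c_deriv v])
  ultimately show ?case by blast
qed

lemma smooth_curve: "smooth_on UNIV c"
  using Ck_on_curve by (simp add: smooth_on_def)

text \<open>With a = v' and q = p', the derivative of v \<bullet> p is v \<bullet> q + a \<bullet>
  p. Symmetry of \<open>M\<close> gives a \<bullet> p = v \<bullet> q - v \<bullet> DM(v) v, and v
  \<bullet> q is half of v \<bullet> DM(v) v because the reaction does no work on a tangent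
  velocity.\<close>

lemma energy_constant: "v t \<bullet> (M (c t) *v v t) = v s \<bullet> (M (c s) *v v s)"
proof -
  have "((\<lambda>t. v t \<bullet> p t) has_vector_derivative 0) (at t)" for t
  proof -
    have "Ck_on 1 UNIV v" using Ck_on_velocity Ck_on_curve by blast
    then have "v differentiable (at t)" by simp
    then obtain a where a: "(v has_vector_derivative a) (at t)"
      using vector_derivative_works by blast
    define q where "q = force (c t) (v t) - (v t \<bullet> (M (c t) *v v t)) *\<^sub>R c t"
    have q: "(p has_vector_derivative q) (at t)" using p_deriv by (simp add: q_def p_def[abs_def])
    have nz: "c t \<noteq> 0" by (rule S2_nonzero[OF c_S2])
    have "((\<lambda>t. M (c t)) has_vector_derivative DM (c t) (v t)) (at t)"
    proof -
      have "((\<lambda>t. M (c t)) has_derivative (\<lambda>h. DM (c t) (h *\<^sub>R v t))) (at t)"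
        by (rule has_derivative_compose[OF c_deriv[unfolded has_vector_derivative_def] M_has_derivative[OF nz]])
      then show ?thesis by (simp add: has_vector_derivative_def linear_cmul[OF DM_linear[OF nz]])
    qed
    from bounded_bilinear.has_vector_derivative[OF bounded_bilinear_matrix_vector_mult this a]
    have "(p has_vector_derivative M (c t) *v a + DM (c t) (v t) *v v t) (at t)" by (simp add: p_def[abs_def])
    then have qa: "q = M (c t) *v a + DM (c t) (v t) *v v t" using q vector_derivative_unique_at by blast
    have vq: "v t \<bullet> q = 1/2 * (v t \<bullet> (DM (c t) (v t) *v v t))"
      using v_tangent[of t] inner_force[OF nz, of "v t" "v t"]
      by (simp add: q_def inner_diff_right inner_commute[of "v t" "force (c t) (v t)"])
    have "a \<bullet> p t = v t \<bullet> (M (c t) *v a)" unfolding p_def by (rule M_sym[OF c_S2])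
    also have "\<dots> = v t \<bullet> q - v t \<bullet> (DM (c t) (v t) *v v t)" by (simp add: qa inner_add_right)
    finally have "v t \<bullet> q + a \<bullet> p t = 0" using vq by simp
    moreover have "((\<lambda>t. v t \<bullet> p t) has_vector_derivative (v t \<bullet> q + a \<bullet> p t)) (at t)"
      by (rule bounded_bilinear.has_vector_derivative[OF bounded_bilinear_inner a q])
    ultimately show ?thesis by simp
  qed
  then have "\<forall>t. DERIV (\<lambda>t. v t \<bullet> p t) t :> 0"
    by (simp add: has_real_derivative_iff_has_vector_derivative)
  from DERIV_isconst_all[OF this, of t s] show ?thesis by (simp add: p_def)
qed

end

section \<open>The geodesic equation in coordinates\<close>

lemma matrix_inv_mult_left:
  fixes A :: "real^'n^'n"
  assumes "det A \<noteq> 0"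
  shows "matrix_inv A *v (A *v x) = x"
proof -
  have "\<exists>B. A ** B = mat 1 \<and> B ** A = mat 1"
    using assms invertible_det_nz[of A] unfolding invertible_def by blast
  then have "matrix_inv A ** A = mat 1" unfolding matrix_inv_def by (rule someI2_ex) blast
  then show ?thesis by (simp add: matrix_vector_mul_assoc)
qed

text \<open>The index computation that turns the Euler-Lagrange equation into the Christoffel form.
  In its use \<open>b i j l\<close> pairs the coordinate field i with the second chart derivative j,
  l, and \<open>T l i j\<close> is the derivative of the form in coordinate direction l. In
  dimension two, symmetry in the last two indices is a single equation for each first index.\<close>

lemma christoffel_identity:
  fixes b T :: "2 \<Rightarrow> 2 \<Rightarrow> 2 \<Rightarrow> real" and u :: "2 \<Rightarrow> real"
  assumes b: "\<And>i. b i 2 1 = b i 1 2" and T: "\<And>k. T k 2 1 = T k 1 2"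
  shows "1/2 * (\<Sum>i\<in>UNIV. \<Sum>j\<in>UNIV. u i * u j * T l i j) + (\<Sum>j\<in>UNIV. \<Sum>k\<in>UNIV. u j * u k * b j l k)
      - (\<Sum>j\<in>UNIV. \<Sum>k\<in>UNIV. (b j l k + T k l j + b l j k) * u k * u j) =
    - (1/2 * (\<Sum>i\<in>UNIV. \<Sum>j\<in>UNIV. ((b l j i + T i j l + b j l i) + (b l i j + T j i l + b i l j)
      - (b j i l + T l i j + b i j l)) * u i * u j))"
proof -
  consider "l = 1" | "l = 2" using exhaust_2 by blast
  then show ?thesis
    by cases (simp_all add: sum_2 b T field_simps)
qed

lemma sum_axis_2: "(w::real^2) = w $ 1 *\<^sub>R axis 1 1 + w $ 2 *\<^sub>R axis 2 1"
  by (simp add: vec_eq_iff forall_2 axis_def)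

lemma param_derivative_2:
  fixes \<phi> :: "real^2 \<Rightarrow> 'b::real_normed_vector"
  assumes "smooth_on U \<phi>" "z \<in> U"
  shows "frechet_derivative \<phi> (at z) w = w $ 1 *\<^sub>R partial 1 \<phi> z + w $ 2 *\<^sub>R partial 2 \<phi> z"
proof -
  have l: "linear (frechet_derivative \<phi> (at z))"
    using smooth_on_has_derivative[OF assms] has_derivative_linear by blast
  show ?thesis
    unfolding partial_def by (subst (1) sum_axis_2) (simp add: linear_add[OF l] linear_cmul[OF l])
qed

lemma param_tangent:
  assumes "local_parametrization \<phi> U" "z \<in> U"
  shows "frechet_derivative \<phi> (at z) w \<bullet> \<phi> z = 0"
proof -
  have U: "open U" and s: "smooth_on U \<phi>" and S: "\<phi> ` U \<subseteq> S2"
    using assms by (auto simp: local_parametrization_def)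
  note d = smooth_on_has_derivative[OF s assms(2)]
  have "((\<lambda>z. \<phi> z \<bullet> \<phi> z) has_derivative (\<lambda>w. \<phi> z \<bullet> frechet_derivative \<phi> (at z) w + frechet_derivative \<phi> (at z) w \<bullet> \<phi> z)) (at z)"
    by (rule has_derivative_inner[OF d d])
  then have "((\<lambda>z. 1::real) has_derivative (\<lambda>w. \<phi> z \<bullet> frechet_derivative \<phi> (at z) w + frechet_derivative \<phi> (at z) w \<bullet> \<phi> z)) (at z)"
    by (rule has_derivative_transform_within_open[OF _ U assms(2)]) (use S in \<open>auto simp: dot_square_norm\<close>)
  from fun_cong[OF has_derivative_unique[OF this has_derivative_const], of w]
  show ?thesis by (simp add: inner_commute)
qed

text \<open>A parametrization of a piece of the sphere extends radially to a map between open subsets of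
  Euclidean three-space, to which invariance of domain and the inverse function rule apply.\<close>

lemma chart_lift:
  assumes \<phi>: "local_parametrization \<phi> U"
    and c: "\<And>s. (c has_vector_derivative v s) (at s)" "\<And>s. c s \<in> S2" and t: "c t \<in> \<phi> ` U"
  obtains J y' where "open J" "t \<in> J" "\<And>s. s \<in> J \<Longrightarrow> c s \<in> \<phi> ` U"
    "\<And>s. s \<in> J \<Longrightarrow> ((\<lambda>s. inv_into U \<phi> (c s)) has_vector_derivative y' s) (at s)"
    "\<And>s. s \<in> J \<Longrightarrow> v s = frechet_derivative \<phi> (at (inv_into U \<phi> (c s))) (y' s)"
proof -
  have U: "open U" and s\<phi>: "smooth_on U \<phi>" and S\<phi>: "\<phi> ` U \<subseteq> S2" and inj: "inj_on \<phi> U"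
    and injd: "\<And>x. x \<in> U \<Longrightarrow> inj (frechet_derivative \<phi> (at x))"
    using \<phi> by (auto simp: local_parametrization_def)
  define \<pi> where "\<pi> z = (vector [z $ 1, z $ 2] :: real^2)" for z :: "real^3"
  have lpi: "linear \<pi>" by (rule linearI) (simp_all add: \<pi>_def vec_eq_iff forall_2 vector_2)
  then have bpi: "bounded_linear \<pi>" by (simp add: linear_conv_bounded_linear)
  \<comment> \<open>The third coordinate h becomes the radius 1 + h, which is why \<open>A\<close>
    asks for a third coordinate above -1.\<close>
  define \<Psi> where "\<Psi> z = (1 + z $ 3) *\<^sub>R \<phi> (\<pi> z)" for z :: "real^3"
  define A where "A = {z. \<pi> z \<in> U \<and> z $ 3 > -1}"
  have cpi: "continuous_on UNIV \<pi>" by (rule linear_continuous_on[OF bpi])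
  have oA: "open A"
  proof -
    have "A = \<pi> -` U \<inter> {z. z $ 3 > -1}" by (auto simp: A_def)
    moreover have "open (\<pi> -` U)" using open_vimage[OF U cpi] .
    moreover have "open {z::real^3. z $ 3 > -1}" by (intro open_Collect_less continuous_intros)
    ultimately show ?thesis by auto
  qed
  have nphi: "norm (\<phi> x) = 1" if "x \<in> U" for x using S\<phi> that by auto
  have n\<Psi>: "norm (\<Psi> z) = 1 + z $ 3" if "z \<in> A" for z
    using that nphi by (simp add: A_def \<Psi>_def)
  have inj\<Psi>: "inj_on \<Psi> A"
  proof (rule inj_onI)
    fix z w assume zw: "z \<in> A" "w \<in> A" "\<Psi> z = \<Psi> w"
    then have 3: "z $ 3 = w $ 3" using n\<Psi> by (metis add_left_cancel)
    moreover have "1 + z $ 3 \<noteq> 0" using zw(1) by (auto simp: A_def)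
    ultimately have "\<phi> (\<pi> z) = \<phi> (\<pi> w)" using zw(3) by (simp add: \<Psi>_def)
    then have "\<pi> z = \<pi> w" using inj zw by (auto simp: A_def inj_on_def)
    then show "z = w" using 3 by (simp add: \<pi>_def vec_eq_iff forall_2 forall_3 vector_2)
  qed
  define D where "D z w = (1 + z $ 3) *\<^sub>R frechet_derivative \<phi> (at (\<pi> z)) (\<pi> w) + w $ 3 *\<^sub>R \<phi> (\<pi> z)" for z w
  have d\<Psi>: "(\<Psi> has_derivative D z) (at z)" if "z \<in> A" for z
  proof -
    have 1: "((\<lambda>z. \<phi> (\<pi> z)) has_derivative (\<lambda>w. frechet_derivative \<phi> (at (\<pi> z)) (\<pi> w))) (at z)"
      using that by (intro has_derivative_compose[OF bounded_linear_imp_has_derivative[OF bpi]]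
          smooth_on_has_derivative[OF s\<phi>]) (auto simp: A_def)
    have 2: "((\<lambda>z::real^3. 1 + z $ 3) has_derivative (\<lambda>w. w $ 3)) (at z)"
      using has_derivative_add[OF has_derivative_const bounded_linear_imp_has_derivative[OF bounded_linear_vec_nth]] by simp
    show ?thesis
      unfolding \<Psi>_def[abs_def] D_def[abs_def] by (rule has_derivative_scaleR[OF 2 1])
  qed
  have c\<Psi>: "continuous_on A \<Psi>"
    by (intro continuous_at_imp_continuous_on ballI has_derivative_continuous[OF d\<Psi>])
  have oW: "open (\<Psi> ` A)" by (rule invariance_of_domain[OF c\<Psi> oA inj\<Psi>])
  have "\<exists>g'. (inv_into A \<Psi> has_derivative g') (at (\<Psi> z))" if z: "z \<in> A" for z
  proof -
    have zU: "\<pi> z \<in> U" and z3: "1 + z $ 3 > 0" using z by (auto simp: A_def)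
    have lD: "linear (D z)" using d\<Psi>[OF z] has_derivative_linear by blast
    have ld: "linear (frechet_derivative \<phi> (at (\<pi> z)))"
      using smooth_on_has_derivative[OF s\<phi> zU] has_derivative_linear by blast
    have "inj (D z)"
      unfolding linear_injective_0[OF lD]
    proof (intro allI impI)
      fix w assume w: "D z w = 0"
      \<comment> \<open>The chart derivative has tangent values, so pairing with the unit normal
        isolates the radial component.\<close>
      have "D z w \<bullet> \<phi> (\<pi> z) = w $ 3"
        using param_tangent[OF \<phi> zU, of "\<pi> w"] nphi[OF zU] by (simp add: D_def inner_add_left dot_square_norm)
      with w have w3: "w $ 3 = 0" by simp
      then have "frechet_derivative \<phi> (at (\<pi> z)) (\<pi> w) = 0" using w z3 by (simp add: D_def)
      then have "\<pi> w = 0" using injd[OF zU] linear_injective_0[OF ld] by blast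
      then show "w = 0" using w3 by (simp add: \<pi>_def vec_eq_iff forall_2 forall_3 vector_2)
    qed
    then have "surj (D z)" using linear_injective_imp_surjective[OF lD] by blast
    then obtain g' where "linear g'" "D z \<circ> g' = id" using linear_surjective_right_inverse[OF lD] by blast
    then have "(inv_into A \<Psi> has_derivative g') (at (\<Psi> z))"
      by (intro has_derivative_inverse_strong[OF oA z c\<Psi> _ d\<Psi>[OF z]]) (use inv_into_f_f[OF inj\<Psi>] in auto)
    then show ?thesis by blast
  qed
  then have "\<forall>b\<in>\<Psi> ` A. \<exists>g'. (inv_into A \<Psi> has_derivative g') (at b)" by blast
  from bchoice[OF this] obtain g' where g': "\<And>b. b \<in> \<Psi> ` A \<Longrightarrow> (inv_into A \<Psi> has_derivative g' b) (at b)" by blast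
  define J where "J = c -` (\<Psi> ` A)"
  have cc: "continuous_on UNIV c"
    using c(1) by (intro continuous_at_imp_continuous_on ballI has_vector_derivative_continuous) blast
  have oJ: "open J" unfolding J_def by (rule open_vimage[OF oW cc])
  \<comment> \<open>Points of the sphere have third coordinate 0, so there the inverse of
    \<open>\<Psi>\<close> gives the inverse of the chart.\<close>
  have fac: "inv_into A \<Psi> (c s) \<in> A \<and> \<pi> (inv_into A \<Psi> (c s)) \<in> U \<and> \<phi> (\<pi> (inv_into A \<Psi> (c s))) = c s" if "s \<in> J" for s
  proof -
    define z where "z = inv_into A \<Psi> (c s)"
    have z: "z \<in> A" "\<Psi> z = c s"
      using that unfolding z_def J_def by (auto intro: inv_into_into f_inv_into_f)
    then have "z $ 3 = 0" using n\<Psi>[OF z(1)] c(2)[of s] by simp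
    with z show ?thesis unfolding z_def[symmetric] by (auto simp: A_def \<Psi>_def)
  qed
  have yeq: "inv_into U \<phi> (c s) = \<pi> (inv_into A \<Psi> (c s))" if "s \<in> J" for s
    using fac[OF that] inv_into_f_f[OF inj, of "\<pi> (inv_into A \<Psi> (c s))"] by simp
  obtain x0 where x0: "x0 \<in> U" "c t = \<phi> x0" using t by blast
  have tJ: "t \<in> J"
  proof -
    have "\<pi> (vector [x0 $ 1, x0 $ 2, 0]) = x0" by (simp add: \<pi>_def vec_eq_iff forall_2 vector_2 vector_3)
    then have "vector [x0 $ 1, x0 $ 2, 0] \<in> A" "\<Psi> (vector [x0 $ 1, x0 $ 2, 0]) = c t"
      using x0 by (auto simp: A_def \<Psi>_def vector_3)
    then show ?thesis unfolding J_def by (metis imageI vimageI)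
  qed
  define y' where "y' s = \<pi> (g' (c s) (v s))" for s
  have dy: "((\<lambda>s. inv_into U \<phi> (c s)) has_vector_derivative y' s) (at s)" if s: "s \<in> J" for s
  proof -
    have cs: "c s \<in> \<Psi> ` A" using s by (simp add: J_def)
    interpret g: bounded_linear "g' (c s)" using g'[OF cs] by (rule has_derivative_bounded_linear)
    interpret pi: bounded_linear \<pi> by (rule bpi)
    have "((\<lambda>s. \<pi> (inv_into A \<Psi> (c s))) has_derivative (\<lambda>h. \<pi> (g' (c s) (h *\<^sub>R v s)))) (at s)"
      by (intro pi.has_derivative has_derivative_compose[OF c(1)[unfolded has_vector_derivative_def] g'[OF cs]])
    then have "((\<lambda>s. \<pi> (inv_into A \<Psi> (c s))) has_vector_derivative y' s) (at s)"
      by (simp add: has_vector_derivative_def y'_def g.scaleR pi.scaleR)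
    then show ?thesis
      by (rule has_vector_derivative_transform_within_open[OF _ oJ s]) (simp add: yeq)
  qed
  show ?thesis
  proof (rule that[OF oJ tJ])
    fix s assume s: "s \<in> J"
    show "c s \<in> \<phi> ` U" using fac[OF s] by (metis imageI)
    show "((\<lambda>s. inv_into U \<phi> (c s)) has_vector_derivative y' s) (at s)" by (rule dy[OF s])
    let ?y = "\<lambda>s. inv_into U \<phi> (c s)"
    have yU: "?y s \<in> U" and phy: "\<And>s. s \<in> J \<Longrightarrow> \<phi> (?y s) = c s" using fac s yeq by auto
    have "((\<lambda>s. \<phi> (?y s)) has_derivative (\<lambda>h. frechet_derivative \<phi> (at (?y s)) (h *\<^sub>R y' s))) (at s)"
      by (rule has_derivative_compose[OF dy[OF s, unfolded has_vector_derivative_def] smooth_on_has_derivative[OF s\<phi> yU]])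
    then have "((\<lambda>s. \<phi> (?y s)) has_vector_derivative frechet_derivative \<phi> (at (?y s)) (y' s)) (at s)"
      using linear_cmul[OF has_derivative_linear[OF smooth_on_has_derivative[OF s\<phi> yU]]]
      by (simp add: has_vector_derivative_def)
    then have "(c has_vector_derivative frechet_derivative \<phi> (at (?y s)) (y' s)) (at s)"
      by (rule has_vector_derivative_transform_within_open[OF _ oJ s]) (rule phy)
    then show "v s = frechet_derivative \<phi> (at (?y s)) (y' s)"
      using c(1) vector_derivative_unique_at by blast
  qed
qed

context limit_geodesic
begin

text \<open>Pairing the momentum equation with the coordinate fields \<open>D l\<close> removes the
  reaction, since these are tangent, and leaves the Euler-Lagrange equations for the canonical
  momenta \<open>P l\<close>, the components of H y'. Differentiating H y' and inverting
  \<open>H\<close> yields the Christoffel symbols.\<close>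

lemma christoffel_equation:
  assumes g: "\<And>p u w. p \<in> S2 \<Longrightarrow> u \<in> tangent_space p \<Longrightarrow> w \<in> tangent_space p \<Longrightarrow> g p u w = u \<bullet> (M p *v w)"
    and \<phi>: "local_parametrization \<phi> U" and t: "c t \<in> \<phi> ` U"
  defines "y \<equiv> \<lambda>s. inv_into U \<phi> (c s)"
  shows "velocity (velocity y) t $ k + (\<Sum>i\<in>UNIV. \<Sum>j\<in>UNIV.
    christoffel g \<phi> k i j (y t) * velocity y t $ i * velocity y t $ j) = 0"
proof -
  have U: "open U" and s\<phi>: "smooth_on U \<phi>" and S\<phi>: "\<phi> ` U \<subseteq> S2" and inj: "inj_on \<phi> U"
    and injd: "\<And>x. x \<in> U \<Longrightarrow> inj (frechet_derivative \<phi> (at x))"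
    using \<phi> by (auto simp: local_parametrization_def)
  obtain J y' where J: "open J" "t \<in> J" and cJ: "\<And>s. s \<in> J \<Longrightarrow> c s \<in> \<phi> ` U"
    and dy: "\<And>s. s \<in> J \<Longrightarrow> (y has_vector_derivative y' s) (at s)"
    and vy: "\<And>s. s \<in> J \<Longrightarrow> v s = frechet_derivative \<phi> (at (y s)) (y' s)"
    using chart_lift[OF \<phi> c_deriv c_S2 t] unfolding y_def by blast
  have yU: "y s \<in> U" and py: "\<phi> (y s) = c s" if "s \<in> J" for s
    using cJ[OF that] unfolding y_def by (auto intro: inv_into_into f_inv_into_f)
  define D where "D i z = partial i \<phi> z" for i z
  define E where "E i j z = partial j (D i) z" for i j z
  have sD: "smooth_on U (D i)" for i
    unfolding D_def partial_def by (rule smooth_on_frechet_derivative[OF s\<phi>])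
  have dD: "(D i has_derivative (\<lambda>w. w $ 1 *\<^sub>R E i 1 z + w $ 2 *\<^sub>R E i 2 z)) (at z)" if "z \<in> U" for i z
    using smooth_on_has_derivative[OF sD that, of i] param_derivative_2[OF sD that, of i]
    unfolding E_def by (metis (no_types, lifting) ext)
  have Esym: "E i j z = E j i z" if "z \<in> U" for i j z
    using symmetric_second_derivative[OF s\<phi> U that, of "axis i 1" "axis j 1"]
    unfolding E_def D_def partial_def[abs_def] .
  have d\<phi>: "(\<phi> has_derivative (\<lambda>w. w $ 1 *\<^sub>R D 1 z + w $ 2 *\<^sub>R D 2 z)) (at z)" if "z \<in> U" for z
    using smooth_on_has_derivative[OF s\<phi> that] param_derivative_2[OF s\<phi> that]
    unfolding D_def by (metis (no_types, lifting) ext)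
  have Dtan: "D i z \<bullet> \<phi> z = 0" if "z \<in> U" for i z
    using param_tangent[OF \<phi> that] by (simp add: D_def partial_def)
  have \<phi>S: "\<phi> z \<in> S2" if "z \<in> U" for z using S\<phi> that by blast
  have h: "coord_metric g \<phi> z $ i $ j = D i z \<bullet> (M (\<phi> z) *v D j z)" if "z \<in> U" for z i j
    using Dtan[OF that] by (simp add: coord_metric_def D_def[symmetric] g[OF \<phi>S[OF that]] tangent_space_def)
  define H where "H z = coord_metric g \<phi> z" for z
  have Hij: "H z $ i $ j = D i z \<bullet> (M (\<phi> z) *v D j z)" if "z \<in> U" for z i j
    using h[OF that] by (simp add: H_def)
  have Hpos: "w \<bullet> (H z *v w) > 0" if z: "z \<in> U" and w: "w \<noteq> 0" for z w
  proof -
    have l: "linear (frechet_derivative \<phi> (at z))"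
      using smooth_on_has_derivative[OF s\<phi> z] has_derivative_linear by blast
    have e: "frechet_derivative \<phi> (at z) w = w $ 1 *\<^sub>R D 1 z + w $ 2 *\<^sub>R D 2 z"
      using param_derivative_2[OF s\<phi> z] by (simp add: D_def)
    have "frechet_derivative \<phi> (at z) w \<noteq> 0"
      using injd[OF z] w linear_injective_0[OF l] by blast
    then have "frechet_derivative \<phi> (at z) w \<bullet> (M (\<phi> z) *v frechet_derivative \<phi> (at z) w) > 0"
      by (rule M_pos[OF \<phi>S[OF z]])
    moreover have "w \<bullet> (H z *v w) = w $ 1 * (H z $ 1 $ 1 * w $ 1 + H z $ 1 $ 2 * w $ 2) +
        w $ 2 * (H z $ 2 $ 1 * w $ 1 + H z $ 2 $ 2 * w $ 2)"
      by (simp add: inner_vec_def sum_2 matrix_vector_mult_def)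
    ultimately show ?thesis
      unfolding e Hij[OF z]
      by (simp add: inner_add matrix_vector_right_distrib matrix_vector_mult_scaleR algebra_simps)
  qed
  have detH: "det (H z) \<noteq> 0" if "z \<in> U" for z
    by (rule det_nonzero_if_positive_definite[OF Hpos[OF that]])
  \<comment> \<open>Each partial derivative of the coordinate metric is a combination of
    \<open>b\<close>, where a chart derivative is differentiated again, and \<open>T\<close>, where
    the form itself is differentiated.\<close>
  define b where "b i j l = D i (y t) \<bullet> (M (c t) *v E j l (y t))" for i j l
  define T where "T l i j = D i (y t) \<bullet> (DM (c t) (D l (y t)) *v D j (y t))" for l i j
  have bsym: "b i j l = b i l j" for i j l unfolding b_def using Esym[OF yU[OF J(2)]] by metis
  have Tsym: "T l i j = T l j i" for l i j unfolding T_def by (rule DM_sym[OF c_S2])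
  have ES: "E j l (y t) \<bullet> (M (c t) *v D i (y t)) = b i j l" for i j l
    unfolding b_def by (rule M_sym[OF c_S2])
  have dH: "((\<lambda>z. H z $ i $ j) has_derivative (\<lambda>w. w $ 1 * (b j i 1 + T 1 i j + b i j 1) + w $ 2 * (b j i 2 + T 2 i j + b i j 2))) (at (y t))"
    for i j
  proof -
    have z: "y t \<in> U" by (rule yU[OF J(2)])
    have nz: "\<phi> (y t) \<noteq> 0" by (rule S2_nonzero[OF \<phi>S[OF z]])
    have lM: "linear (DM (c t))" using DM_linear nz py[OF J(2)] by simp
    have m: "((\<lambda>z. M (\<phi> z)) has_derivative (\<lambda>w. DM (c t) (w $ 1 *\<^sub>R D 1 (y t) + w $ 2 *\<^sub>R D 2 (y t)))) (at (y t))"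
      using has_derivative_compose[OF d\<phi>[OF z] M_has_derivative[OF nz]] by (simp add: py[OF J(2)])
    have "((\<lambda>z. D i z \<bullet> (M (\<phi> z) *v D j z)) has_derivative
      (\<lambda>w. D i (y t) \<bullet> (M (\<phi> (y t)) *v (w $ 1 *\<^sub>R E j 1 (y t) + w $ 2 *\<^sub>R E j 2 (y t)) +
          DM (c t) (w $ 1 *\<^sub>R D 1 (y t) + w $ 2 *\<^sub>R D 2 (y t)) *v D j (y t)) +
        (w $ 1 *\<^sub>R E i 1 (y t) + w $ 2 *\<^sub>R E i 2 (y t)) \<bullet> (M (\<phi> (y t)) *v D j (y t)))) (at (y t))"
      by (intro has_derivative_inner dD[OF z] bounded_bilinear.FDERIV[OF bounded_bilinear_matrix_vector_mult] m)
    moreover have "(\<lambda>w. D i (y t) \<bullet> (M (\<phi> (y t)) *v (w $ 1 *\<^sub>R E j 1 (y t) + w $ 2 *\<^sub>R E j 2 (y t)) +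
          DM (c t) (w $ 1 *\<^sub>R D 1 (y t) + w $ 2 *\<^sub>R D 2 (y t)) *v D j (y t)) +
        (w $ 1 *\<^sub>R E i 1 (y t) + w $ 2 *\<^sub>R E i 2 (y t)) \<bullet> (M (\<phi> (y t)) *v D j (y t))) =
      (\<lambda>w::real^2. w $ 1 * (b j i 1 + T 1 i j + b i j 1) + w $ 2 * (b j i 2 + T 2 i j + b i j 2))"
      unfolding py[OF J(2)]
      by (rule ext) (simp add: linear_add[OF lM] linear_cmul[OF lM] inner_add matrix_vector_right_distrib
          matrix_vector_mult_add_rdistrib matrix_vector_mult_scaleR scaleR_matrix_vector_assoc[symmetric] ES
          b_def[symmetric] T_def[symmetric] algebra_simps)
    ultimately have "((\<lambda>z. D i z \<bullet> (M (\<phi> z) *v D j z)) has_derivative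
      (\<lambda>w. w $ 1 * (b j i 1 + T 1 i j + b i j 1) + w $ 2 * (b j i 2 + T 2 i j + b i j 2))) (at (y t))" by simp
    then show ?thesis
      by (rule has_derivative_transform_within_open[OF _ U z]) (simp add: Hij)
  qed
  have ph: "partial k (\<lambda>z. coord_metric g \<phi> z $ i $ j) (y t) = b j i k + T k i j + b i j k" for i j k
  proof -
    have "partial k (\<lambda>z. H z $ i $ j) (y t) = axis k 1 $ 1 * (b j i 1 + T 1 i j + b i j 1) + axis k 1 $ 2 * (b j i 2 + T 2 i j + b i j 2)"
      unfolding partial_def by (rule fun_cong[OF frechet_derivative_at[OF dH], symmetric])
    then show ?thesis using exhaust_2[of k] by (auto simp: H_def axis_def)
  qed
  define P where "P i s = p s \<bullet> D i (y s)" for i s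
  have vD: "v s = y' s $ 1 *\<^sub>R D 1 (y s) + y' s $ 2 *\<^sub>R D 2 (y s)" if "s \<in> J" for s
    using vy[OF that] param_derivative_2[OF s\<phi> yU[OF that]] by (simp add: D_def)
  have HP: "H (y s) *v y' s = (\<chi> i. P i s)" if s: "s \<in> J" for s
  proof -
    have "P i s = H (y s) $ i $ 1 * y' s $ 1 + H (y s) $ i $ 2 * y' s $ 2" for i
    proof -
      have "P i s = D i (y s) \<bullet> (M (c s) *v v s)" by (simp add: P_def p_def inner_commute)
      then show ?thesis
        by (simp add: vD[OF s] Hij[OF yU[OF s]] py[OF s] matrix_vector_right_distrib matrix_vector_mult_scaleR inner_add_right)
    qed
    then show ?thesis by (simp add: vec_eq_iff matrix_vector_mult_def sum_2)
  qed
  \<comment> \<open>\<open>chart_lift\<close> supplies only one derivative of \<open>y\<close>.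
    Cramer's rule writes \<open>y'\<close> through differentiable quantities and so provides the
    second.\<close>
  have cram: "y' s = (\<chi> k. det (\<chi> i j. if j = k then P i s else H (y s) $ i $ j) / det (H (y s)))" if "s \<in> J" for s
    using cramer[OF detH[OF yU[OF that]], of "y' s" "\<chi> i. P i s", unfolded vec_lambda_beta] HP[OF that] by blast
  define q where "q = force (c t) (v t) - (v t \<bullet> (M (c t) *v v t)) *\<^sub>R c t"
  have dp: "(p has_vector_derivative q) (at t)" using p_deriv by (simp add: q_def p_def[abs_def])
  define u where "u = y' t"
  have dyt: "(y has_derivative (\<lambda>h. h *\<^sub>R u)) (at t)"
    using dy[OF J(2)] by (simp add: has_vector_derivative_def u_def)
  have dDy: "((\<lambda>s. D i (y s)) has_vector_derivative (u $ 1 *\<^sub>R E i 1 (y t) + u $ 2 *\<^sub>R E i 2 (y t))) (at t)" for i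
    using has_derivative_compose[OF dyt dD[OF yU[OF J(2)], of i]]
    by (simp add: has_vector_derivative_def algebra_simps)
  have dHy: "((\<lambda>s. H (y s) $ i $ j) has_vector_derivative
      (u $ 1 * (b j i 1 + T 1 i j + b i j 1) + u $ 2 * (b j i 2 + T 2 i j + b i j 2))) (at t)" for i j
    using has_derivative_compose[OF dyt dH[of i j]] by (simp add: has_vector_derivative_def algebra_simps)
  have dP: "((\<lambda>s. P i s) has_vector_derivative
      (p t \<bullet> (u $ 1 *\<^sub>R E i 1 (y t) + u $ 2 *\<^sub>R E i 2 (y t)) + q \<bullet> D i (y t))) (at t)" for i
    unfolding P_def by (rule bounded_bilinear.has_vector_derivative[OF bounded_bilinear_inner dp dDy])
  have vt: "v t = u $ 1 *\<^sub>R D 1 (y t) + u $ 2 *\<^sub>R D 2 (y t)" unfolding u_def by (rule vD[OF J(2)])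
  have nzc: "c t \<noteq> 0" by (rule S2_nonzero[OF c_S2])
  have P': "p t \<bullet> (u $ 1 *\<^sub>R E l 1 (y t) + u $ 2 *\<^sub>R E l 2 (y t)) + q \<bullet> D l (y t) =
    1/2 * (\<Sum>i\<in>UNIV. \<Sum>j\<in>UNIV. u $ i * u $ j * T l i j) + (\<Sum>j\<in>UNIV. \<Sum>k\<in>UNIV. u $ j * u $ k * b j l k)" for l
  proof -
    have "q \<bullet> D l (y t) = 1/2 * (v t \<bullet> (DM (c t) (D l (y t)) *v v t))"
      using Dtan[OF yU[OF J(2)], of l] py[OF J(2)]
      by (simp add: q_def inner_diff_left inner_force[OF nzc] inner_commute[of "c t"])
    also have "v t \<bullet> (DM (c t) (D l (y t)) *v v t) = (\<Sum>i\<in>UNIV. \<Sum>j\<in>UNIV. u $ i * u $ j * T l i j)"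
      unfolding vt
      by (simp add: sum_2 inner_add matrix_vector_right_distrib matrix_vector_mult_scaleR T_def[symmetric] algebra_simps)
    finally have 1: "q \<bullet> D l (y t) = 1/2 * (\<Sum>i\<in>UNIV. \<Sum>j\<in>UNIV. u $ i * u $ j * T l i j)" .
    have "p t \<bullet> E l k (y t) = u $ 1 * b 1 l k + u $ 2 * b 2 l k" for k
    proof -
      have "p t \<bullet> E l k (y t) = E l k (y t) \<bullet> (M (c t) *v v t)" by (simp add: p_def inner_commute)
      then show ?thesis
        unfolding vt by (simp add: matrix_vector_right_distrib matrix_vector_mult_scaleR inner_add_right ES)
    qed
    then have "p t \<bullet> (u $ 1 *\<^sub>R E l 1 (y t) + u $ 2 *\<^sub>R E l 2 (y t)) = (\<Sum>j\<in>UNIV. \<Sum>k\<in>UNIV. u $ j * u $ k * b j l k)"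
      by (simp add: inner_add_right sum_2 algebra_simps)
    with 1 show ?thesis by simp
  qed
  have "\<exists>a. (y' has_vector_derivative a) (at t)"
  proof -
    have dH': "(\<lambda>s. H (y s) $ i $ j) differentiable (at t)" for i j
      using dHy by (metis differentiableI_vector)
    have dP'': "P i differentiable (at t)" for i
      using dP by (metis differentiableI_vector)
    have comp: "(\<lambda>s. det (\<chi> i j. if j = k then P i s else H (y s) $ i $ j) / det (H (y s))) differentiable (at t)" for k
    proof -
      have "(\<lambda>s. if k = j then P i s else H (y s) $ i $ j) differentiable (at t)" for i j
        by (cases "k = j") (simp_all add: dH' dP'')
      then show ?thesis
        unfolding det_2 using detH[OF yU[OF J(2)], unfolded det_2]
        by (intro differentiable_divide differentiable_diff differentiable_mult dH') simp_all
    qed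
    define G where "G k s = det (\<chi> i j. if j = k then P i s else H (y s) $ i $ j) / det (H (y s))" for k s
    have "\<exists>d. (G k has_vector_derivative d) (at t)" for k
      using comp[of k] vector_derivative_works unfolding G_def[abs_def] by blast
    then obtain d1 d2 where d: "(G 1 has_vector_derivative d1) (at t)" "(G 2 has_vector_derivative d2) (at t)" by metis
    have "((\<lambda>s. G 1 s *\<^sub>R axis 1 1 + G 2 s *\<^sub>R (axis 2 1 :: real^2)) has_vector_derivative
        (d1 *\<^sub>R axis 1 1 + d2 *\<^sub>R axis 2 1)) (at t)"
      by (intro has_vector_derivative_add bounded_linear.has_vector_derivative[OF bounded_linear_scaleR_left d(1)]
          bounded_linear.has_vector_derivative[OF bounded_linear_scaleR_left d(2)])
    moreover have "G 1 s *\<^sub>R axis 1 1 + G 2 s *\<^sub>R (axis 2 1 :: real^2) = y' s" if "s \<in> J" for s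
    proof -
      have "y' s $ k = G k s" for k by (subst cram[OF that]) (simp add: G_def)
      then show ?thesis using sum_axis_2[of "y' s"] by simp
    qed
    ultimately have "(y' has_vector_derivative (d1 *\<^sub>R axis 1 1 + d2 *\<^sub>R axis 2 1)) (at t)"
      by (rule has_vector_derivative_transform_within_open[OF _ J])
    then show ?thesis by blast
  qed
  then obtain a where a: "(y' has_vector_derivative a) (at t)" by blast
  have ai: "((\<lambda>s. y' s $ j) has_vector_derivative a $ j) (at t)" for j
    by (rule bounded_linear.has_vector_derivative[OF bounded_linear_vec_nth a])
  \<comment> \<open>The derivative of \<open>P l\<close> is computed twice, from H y' and from the
    momentum equation, and the comparison isolates the second derivative \<open>a\<close>.\<close>
  have EL: "(H (y t) *v a) $ l = - (1/2 * (\<Sum>i\<in>UNIV. \<Sum>j\<in>UNIV.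
      ((b l j i + T i j l + b j l i) + (b l i j + T j i l + b i l j) - (b j i l + T l i j + b i j l)) * u $ i * u $ j))" for l
  proof -
    have "((\<lambda>s. H (y s) $ l $ 1 * y' s $ 1 + H (y s) $ l $ 2 * y' s $ 2) has_vector_derivative
      (H (y t) $ l $ 1 * a $ 1 + (u $ 1 * (b 1 l 1 + T 1 l 1 + b l 1 1) + u $ 2 * (b 1 l 2 + T 2 l 1 + b l 1 2)) * u $ 1) +
      (H (y t) $ l $ 2 * a $ 2 + (u $ 1 * (b 2 l 1 + T 1 l 2 + b l 2 1) + u $ 2 * (b 2 l 2 + T 2 l 2 + b l 2 2)) * u $ 2)) (at t)"
      unfolding u_def
      by (intro has_vector_derivative_add bounded_bilinear.has_vector_derivative[OF bounded_bilinear_mult]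
          dHy[unfolded u_def] ai)
    moreover have "H (y s) $ l $ 1 * y' s $ 1 + H (y s) $ l $ 2 * y' s $ 2 = P l s" if "s \<in> J" for s
      using HP[OF that] by (simp add: vec_eq_iff matrix_vector_mult_def sum_2)
    ultimately have "(P l has_vector_derivative
      (H (y t) $ l $ 1 * a $ 1 + (u $ 1 * (b 1 l 1 + T 1 l 1 + b l 1 1) + u $ 2 * (b 1 l 2 + T 2 l 1 + b l 1 2)) * u $ 1) +
      (H (y t) $ l $ 2 * a $ 2 + (u $ 1 * (b 2 l 1 + T 1 l 2 + b l 2 1) + u $ 2 * (b 2 l 2 + T 2 l 2 + b l 2 2)) * u $ 2)) (at t)"
      by (rule has_vector_derivative_transform_within_open[OF _ J])
    from vector_derivative_unique_at[OF this dP]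
    have "(H (y t) *v a) $ l = 1/2 * (\<Sum>i\<in>UNIV. \<Sum>j\<in>UNIV. u $ i * u $ j * T l i j) + (\<Sum>j\<in>UNIV. \<Sum>k\<in>UNIV. u $ j * u $ k * b j l k)
      - (\<Sum>j\<in>UNIV. \<Sum>k\<in>UNIV. (b j l k + T k l j + b l j k) * u $ k * u $ j)"
      unfolding P' by (simp add: matrix_vector_mult_def sum_2 algebra_simps)
    also have "\<dots> = - (1/2 * (\<Sum>i\<in>UNIV. \<Sum>j\<in>UNIV.
      ((b l j i + T i j l + b j l i) + (b l i j + T j i l + b i l j) - (b j i l + T l i j + b i j l)) * u $ i * u $ j))"
      by (rule christoffel_identity) (rule bsym Tsym)+
    finally show ?thesis .
  qed
  have vel: "velocity y s = y' s" if "s \<in> J" for s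
    unfolding velocity_def by (rule vector_derivative_at[OF dy[OF that]])
  have "(velocity y has_vector_derivative a) (at t)"
    by (rule has_vector_derivative_transform_within_open[OF a J]) (simp add: vel)
  then have va: "velocity (velocity y) t = a"
    unfolding velocity_def by (rule vector_derivative_at)
  let ?I = "matrix_inv (coord_metric g \<phi> (y t))"
  have "a = ?I *v (H (y t) *v a)"
    unfolding H_def[symmetric] by (rule matrix_inv_mult_left[OF detH[OF yU[OF J(2)]], symmetric])
  then have ak: "a $ k = ?I $ k $ 1 * (H (y t) *v a) $ 1 + ?I $ k $ 2 * (H (y t) *v a) $ 2"
    by (metis (no_types, lifting) matrix_vector_mult_def sum_2 vec_lambda_beta)
  have ut: "velocity y t = u" using vel[OF J(2)] by (simp add: u_def)
  show ?thesis
    unfolding va ut christoffel_def ph ak EL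
    by (simp add: sum_2 algebra_simps)
qed

lemma geodesic_curve:
  assumes "\<And>p u w. p \<in> S2 \<Longrightarrow> u \<in> tangent_space p \<Longrightarrow> w \<in> tangent_space p \<Longrightarrow> g p u w = u \<bullet> (M p *v w)"
  shows "geodesic g c"
  unfolding geodesic_def Let_def
  using smooth_curve c_S2 christoffel_equation[OF assms] by blast

end

section \<open>The quadratic form of a Riemannian metric\<close>

text \<open>Near each point \<open>f\<close> agrees on the sphere with a smooth \<open>F\<close>,
  and \<open>f (sgn x)\<close> is \<open>F (sgn x)\<close> on the cone over that
  neighbourhood.\<close>

lemma smooth_on_S2_sgn:
  assumes "smooth_on_S2 f"
  shows "smooth_on (-{0}) (\<lambda>x. f (sgn x))"
  unfolding smooth_on_def
proof (intro allI Ck_on_local)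
  fix k and x :: "real^3" assume "x \<in> -{0}"
  then have "sgn x \<in> S2" by (simp add: norm_sgn)
  then obtain U F where U: "open U" "sgn x \<in> U" "smooth_on U F" "\<And>q. q \<in> U \<inter> S2 \<Longrightarrow> F q = f q"
    using assms unfolding smooth_on_S2_def by meson
  define V where "V = -{0} \<inter> sgn -` U"
  have oV: "open V"
    unfolding V_def
    by (rule continuous_open_preimage[OF smooth_on_imp_continuous_on[OF smooth_on_sgn] _ U(1)]) auto
  have "smooth_on V (\<lambda>x. F (sgn x))"
    by (rule smooth_on_compose[OF oV U(1,3) smooth_on_subset[OF smooth_on_sgn]]) (auto simp: V_def)
  then have "smooth_on V (\<lambda>x. f (sgn x))"
    by (rule smooth_on_cong[OF _ oV]) (use U(4) in \<open>auto simp: V_def norm_sgn\<close>)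
  then show "\<exists>V. open V \<and> x \<in> V \<and> Ck_on k V (\<lambda>x. f (sgn x))"
    using oV U(2) \<open>x \<in> -{0}\<close> by (intro exI[of _ V]) (auto simp: V_def smooth_on_def)
qed

text \<open>The tangential parts of the standard basis vectors. Smoothness of a metric is tested on
  global vector fields, and the sphere has no global frame of two of them; three fields that span
  every tangent plane avoid patching.\<close>

definition tangent_frame :: "3 \<Rightarrow> real^3 \<Rightarrow> real^3" where
  "tangent_frame i x = axis i 1 - (x $ i) *\<^sub>R x"

definition tangent_proj :: "real^3 \<Rightarrow> real^3 \<Rightarrow> real^3" where
  "tangent_proj x u = u - (u \<bullet> x) *\<^sub>R x"

text \<open>The matrix of the quadratic form on three-space that agrees with \<open>g\<close> on the tangent plane
  and with \<open>\<rho>\<close> times the Euclidean form on the normal line, extended to be constant along rays.\<close>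

definition metric_mat :: "metric_tensor \<Rightarrow> real \<Rightarrow> real^3 \<Rightarrow> real^3^3" where
  "metric_mat g \<rho> x = (\<chi> i j. g (sgn x) (tangent_frame i (sgn x)) (tangent_frame j (sgn x)) +
    \<rho> * (sgn x $ i * sgn x $ j))"

lemma sgn_S2: "x \<in> S2 \<Longrightarrow> sgn x = (x::real^3)"
  by (simp add: sgn_div_norm)

lemma tangent_frame_in: "x \<in> S2 \<Longrightarrow> tangent_frame i x \<in> tangent_space x"
  by (simp add: tangent_frame_def tangent_space_def inner_diff_left dot_square_norm inner_axis' )

lemma tangent_proj_in: "x \<in> S2 \<Longrightarrow> tangent_proj x u \<in> tangent_space x"
  by (simp add: tangent_proj_def tangent_space_def inner_diff_left dot_square_norm)

lemma tangent_proj_id: "u \<in> tangent_space x \<Longrightarrow> tangent_proj x u = u"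
  by (simp add: tangent_proj_def tangent_space_def)

lemma tangent_space_add: "u \<in> tangent_space x \<Longrightarrow> w \<in> tangent_space x \<Longrightarrow> a *\<^sub>R u + b *\<^sub>R w \<in> tangent_space x"
  by (simp add: tangent_space_def inner_add_left)

lemma tangent_proj_frame:
  "tangent_proj x u = u $ 1 *\<^sub>R tangent_frame 1 x + u $ 2 *\<^sub>R tangent_frame 2 x + u $ 3 *\<^sub>R tangent_frame 3 x"
  by (simp add: tangent_proj_def tangent_frame_def vec_eq_iff forall_3 axis_def inner_real3 algebra_simps)

lemma smooth_vector_field_frame: "smooth_vector_field (tangent_frame i)"
  unfolding smooth_vector_field_def smooth_on_S2_def
proof (intro conjI ballI)
  fix p :: "real^3" assume "p \<in> S2"
  note o = open_UNIV[where 'a = "real^3"]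
  have "smooth_on UNIV (\<lambda>x::real^3. x)" by (rule bounded_linear_imp_smooth_on[OF o bounded_linear_ident])
  then have "smooth_on UNIV (tangent_frame i)"
    unfolding tangent_frame_def[abs_def]
    by (intro smooth_on_diff[OF o] smooth_on_const smooth_on_bilinear[OF o bounded_bilinear_scaleR]
        smooth_on_component[OF o])
  then show "\<exists>U F. open U \<and> p \<in> U \<and> smooth_on U F \<and> (\<forall>q\<in>U \<inter> S2. F q = tangent_frame i q)" by blast
qed (rule tangent_frame_in)

context
  fixes g :: metric_tensor
  assumes g: "riemannian_metric g"
begin

lemma metric_sym: "x \<in> S2 \<Longrightarrow> u \<in> tangent_space x \<Longrightarrow> w \<in> tangent_space x \<Longrightarrow> g x u w = g x w u"
  using g unfolding riemannian_metric_def by blast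

lemma metric_linear: "x \<in> S2 \<Longrightarrow> u \<in> tangent_space x \<Longrightarrow> w \<in> tangent_space x \<Longrightarrow> z \<in> tangent_space x \<Longrightarrow>
    g x (a *\<^sub>R u + b *\<^sub>R w) z = a * g x u z + b * g x w z"
  using g unfolding riemannian_metric_def by blast

lemma metric_pos: "x \<in> S2 \<Longrightarrow> u \<in> tangent_space x \<Longrightarrow> u \<noteq> 0 \<Longrightarrow> g x u u > 0"
  using g unfolding riemannian_metric_def by blast

lemma metric_proj_left:
  assumes "x \<in> S2" "z \<in> tangent_space x"
  shows "g x (tangent_proj x u) z = u $ 1 * g x (tangent_frame 1 x) z + u $ 2 * g x (tangent_frame 2 x) z +
    u $ 3 * g x (tangent_frame 3 x) z"
proof -
  note fr = tangent_frame_in[OF assms(1)]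
  have "g x (tangent_proj x u) z = g x (1 *\<^sub>R (u $ 1 *\<^sub>R tangent_frame 1 x + u $ 2 *\<^sub>R tangent_frame 2 x) + u $ 3 *\<^sub>R tangent_frame 3 x) z"
    by (simp add: tangent_proj_frame)
  also have "\<dots> = 1 * g x (u $ 1 *\<^sub>R tangent_frame 1 x + u $ 2 *\<^sub>R tangent_frame 2 x) z + u $ 3 * g x (tangent_frame 3 x) z"
    by (intro metric_linear assms fr tangent_space_add)
  also have "g x (u $ 1 *\<^sub>R tangent_frame 1 x + u $ 2 *\<^sub>R tangent_frame 2 x) z =
      u $ 1 * g x (tangent_frame 1 x) z + u $ 2 * g x (tangent_frame 2 x) z"
    by (intro metric_linear assms fr)
  finally show ?thesis by simp
qed

text \<open>\<open>g\<close> is known to be bilinear on tangent vectors only, so it is evaluated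
  through projections to the tangent plane. Symmetry, definiteness and the bounds are read off from
  this splitting into tangential and normal part.\<close>

lemma metric_mat_form:
  assumes x: "x \<in> S2"
  shows "u \<bullet> (metric_mat g \<rho> x *v w) = g x (tangent_proj x u) (tangent_proj x w) + \<rho> * (u \<bullet> x) * (w \<bullet> x)"
proof -
  note fr = tangent_frame_in[OF x]
  have r: "g x (tangent_frame i x) (tangent_proj x w) =
      w $ 1 * g x (tangent_frame i x) (tangent_frame 1 x) + w $ 2 * g x (tangent_frame i x) (tangent_frame 2 x) +
      w $ 3 * g x (tangent_frame i x) (tangent_frame 3 x)" for i
    unfolding metric_sym[OF x fr tangent_proj_in[OF x]] metric_proj_left[OF x fr]
    by (simp add: metric_sym[OF x fr fr, of _ i])
  show ?thesis
    unfolding metric_proj_left[OF x tangent_proj_in[OF x]] r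
    by (simp add: metric_mat_def sgn_S2[OF x] matrix_vector_mult_def inner_real3 sum_3 algebra_simps)
qed

lemma metric_mat_tangent:
  assumes "x \<in> S2" "u \<in> tangent_space x" "w \<in> tangent_space x"
  shows "g x u w = u \<bullet> (metric_mat g \<rho> x *v w)"
  using assms by (simp add: metric_mat_form tangent_proj_id) (simp add: tangent_space_def)

lemma metric_mat_sym: "x \<in> S2 \<Longrightarrow> u \<bullet> (metric_mat g \<rho> x *v w) = w \<bullet> (metric_mat g \<rho> x *v u)"
  by (simp add: metric_mat_form metric_sym[OF _ tangent_proj_in tangent_proj_in, of x u w])

lemma smooth_metric_mat: "smooth_on (-{0}) (metric_mat g \<rho>)"
proof -
  have o: "open (-{0::real^3})" by auto
  have f: "smooth_on (-{0}) (\<lambda>x. g (sgn x) (tangent_frame i (sgn x)) (tangent_frame j (sgn x)))" for i j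
  proof -
    have "smooth_on_S2 (\<lambda>p. g p (tangent_frame i p) (tangent_frame j p))"
      using g smooth_vector_field_frame unfolding riemannian_metric_def by blast
    from smooth_on_S2_sgn[OF this] show ?thesis .
  qed
  have "smooth_on (-{0}) (\<lambda>x. metric_mat g \<rho> x $ i $ j)" for i j
    unfolding metric_mat_def
    by (simp, intro smooth_on_add[OF o] f smooth_on_bilinear[OF o bounded_bilinear_mult] smooth_on_const
        smooth_on_component[OF o smooth_on_sgn])
  then show ?thesis by (intro smooth_on_vec[OF o]) 
qed

lemma metric_mat_normal: "x \<in> S2 \<Longrightarrow> metric_mat g \<rho> x *v x = \<rho> *\<^sub>R x"
proof -
  assume x: "x \<in> S2"
  have xx: "x \<bullet> x = 1" using x by (simp add: dot_square_norm)
  have p0: "tangent_proj x x = 0" by (simp add: tangent_proj_def xx)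
  have "g x 0 z = 0" if "z \<in> tangent_space x" for z
    using metric_linear[OF x that that that, of 0 0] by simp
  then have "u \<bullet> (metric_mat g \<rho> x *v x) = u \<bullet> (\<rho> *\<^sub>R x)" for u
    using metric_sym[OF x tangent_proj_in[OF x] tangent_proj_in[OF x], of u x] tangent_proj_in[OF x]
    by (simp add: metric_mat_form[OF x] xx p0)
  then show ?thesis using vector_eq_ldot by blast
qed

lemma metric_mat_pos:
  assumes x: "x \<in> S2" and "\<rho> > 0" "u \<noteq> 0"
  shows "u \<bullet> (metric_mat g \<rho> x *v u) > 0"
proof (cases "tangent_proj x u = 0")
  case True
  then have u: "u = (u \<bullet> x) *\<^sub>R x" by (simp add: tangent_proj_def)
  then have ux: "u \<bullet> x \<noteq> 0" using \<open>u \<noteq> 0\<close> by (metis scaleR_zero_left)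
  have "metric_mat g \<rho> x *v u = (u \<bullet> x) *\<^sub>R \<rho> *\<^sub>R x"
    by (subst u) (simp only: matrix_vector_mult_scaleR metric_mat_normal[OF x])
  then have "u \<bullet> (metric_mat g \<rho> x *v u) = \<rho> * ((u \<bullet> x) * (u \<bullet> x))" by simp
  moreover have "(u \<bullet> x) * (u \<bullet> x) > 0" using ux by (metis not_real_square_gt_zero)
  ultimately show ?thesis using \<open>\<rho> > 0\<close> by simp
next
  case False
  then have "g x (tangent_proj x u) (tangent_proj x u) > 0" by (intro metric_pos x tangent_proj_in)
  moreover have "0 \<le> \<rho> * (u \<bullet> x) * (u \<bullet> x)" using \<open>\<rho> > 0\<close> by (simp add: mult.assoc)
  ultimately show ?thesis by (simp add: metric_mat_form[OF x])
qed

lemma metric_mat_Cauchy_Schwarz: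
  assumes x: "x \<in> S2" and \<rho>: "\<rho> > 0"
  shows "(u \<bullet> (metric_mat g \<rho> x *v w))\<^sup>2 \<le> (u \<bullet> (metric_mat g \<rho> x *v u)) * (w \<bullet> (metric_mat g \<rho> x *v w))"
proof (cases "w = 0")
  case False
  let ?A = "metric_mat g \<rho> x"
  define a b d where "a = w \<bullet> (?A *v w)" and "b = u \<bullet> (?A *v w)" and "d = u \<bullet> (?A *v u)"
  have a: "a > 0" unfolding a_def by (rule metric_mat_pos[OF x \<rho> False])
  have b': "w \<bullet> (?A *v u) = b" unfolding b_def by (rule metric_mat_sym[OF x])
  let ?z = "a *\<^sub>R u - b *\<^sub>R w"
  have "0 \<le> ?z \<bullet> (?A *v ?z)" using metric_mat_pos[OF x \<rho>, of ?z] by (cases "?z = 0") auto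
  also have "?z \<bullet> (?A *v ?z) = a * (a * d - b * b)"
    by (simp add: matrix_vector_mult_diff_distrib matrix_vector_mult_scaleR inner_diff b' a_def[symmetric]
        b_def[symmetric] d_def[symmetric] algebra_simps)
  finally have "b * b \<le> a * d" using a by (simp add: zero_le_mult_iff)
  then show ?thesis by (simp add: a_def b_def d_def power2_eq_square mult.commute)
qed simp

text \<open>The matrix is invertible and symmetric with the normal as eigenvector, so the preimage
  of a tangent vector is tangent again.\<close>

lemma metric_mat_solve:
  assumes x: "x \<in> S2" and w: "w \<in> tangent_space x"
  obtains z where "z \<in> tangent_space x" "metric_mat g 1 x *v z = w"
proof -
  let ?A = "metric_mat g 1 x"
  have "det ?A \<noteq> 0" by (rule det_nonzero_if_positive_definite) (rule metric_mat_pos[OF x zero_less_one])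
  then obtain B where "?A ** B = mat 1" using invertible_det_nz[of ?A] unfolding invertible_def by blast
  then have z: "?A *v (B *v w) = w" by (simp add: matrix_vector_mul_assoc)
  have "(B *v w) \<bullet> x = x \<bullet> (?A *v (B *v w))"
    using metric_mat_sym[OF x, of "B *v w" 1 x] metric_mat_normal[OF x, of 1] by simp
  also have "\<dots> = 0" using w by (simp add: z tangent_space_def inner_commute)
  finally have "B *v w \<in> tangent_space x" by (simp add: tangent_space_def)
  with z that show ?thesis by blast
qed

end

section \<open>Covectors, the dual metric and its extreme values\<close>

lemma cotangent_representation:
  assumes "\<nu> \<in> cotangent_space x"
  obtains w where "w \<in> tangent_space x" "\<nu> = (\<lambda>u. w \<bullet> u)"
proof
  have l: "linear \<nu>" and 0: "\<nu> x = 0" using assms by (auto simp: cotangent_space_def)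
  let ?w = "\<Sum>i\<in>Basis. \<nu> i *\<^sub>R i"
  show eq: "\<nu> = (\<lambda>u. ?w \<bullet> u)"
  proof
    fix u
    have "\<nu> u = \<nu> (\<Sum>i\<in>Basis. (u \<bullet> i) *\<^sub>R i)" by (simp add: euclidean_representation)
    also have "\<dots> = (\<Sum>i\<in>Basis. (u \<bullet> i) * \<nu> i)" by (simp add: linear_sum[OF l] linear_cmul[OF l])
    also have "\<dots> = ?w \<bullet> u"
      unfolding inner_sum_left inner_scaleR_left by (intro sum.cong) (auto simp: inner_commute)
    finally show "\<nu> u = ?w \<bullet> u" .
  qed
  show "?w \<in> tangent_space x" using 0 fun_cong[OF eq, of x] by (simp add: tangent_space_def)
qed

lemma sharp_eq:
  assumes g: "riemannian_metric g" and x: "x \<in> S2" and z: "z \<in> tangent_space x"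
  shows "sharp g x (\<lambda>u. (metric_mat g 1 x *v z) \<bullet> u) = z"
  unfolding sharp_def
proof (rule the_equality)
  show "z \<in> tangent_space x \<and> (\<forall>w\<in>tangent_space x. g x z w = (metric_mat g 1 x *v z) \<bullet> w)"
    using z metric_mat_tangent[OF g x z, of _ 1] metric_mat_sym[OF g x, of z 1] by (auto simp: inner_commute)
next
  fix v assume v: "v \<in> tangent_space x \<and> (\<forall>w\<in>tangent_space x. g x v w = (metric_mat g 1 x *v z) \<bullet> w)"
  have d: "v - z \<in> tangent_space x" using v z by (simp add: tangent_space_def inner_diff_left)
  have "v \<bullet> (metric_mat g 1 x *v (v - z)) = (v - z) \<bullet> (metric_mat g 1 x *v z)"
    using v d metric_mat_tangent[OF g x _ d, of v 1] by (simp add: inner_commute)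
  also have "\<dots> = z \<bullet> (metric_mat g 1 x *v (v - z))" by (rule metric_mat_sym[OF g x])
  finally have "(v - z) \<bullet> (metric_mat g 1 x *v (v - z)) = 0" by (simp add: inner_diff_left)
  then show "v = z" using metric_mat_pos[OF g x zero_less_one, of "v - z"] by force
qed

lemma sharp_round_metric:
  assumes "w \<in> tangent_space x"
  shows "sharp round_metric x (\<lambda>u. w \<bullet> u) = w"
  unfolding sharp_def round_metric_def
proof (rule the_equality)
  fix v assume v: "v \<in> tangent_space x \<and> (\<forall>u\<in>tangent_space x. v \<bullet> u = w \<bullet> u)"
  then have "v - w \<in> tangent_space x" using assms by (simp add: tangent_space_def inner_diff_left)
  then have "(v - w) \<bullet> (v - w) = 0" using v by (simp add: inner_diff_left)
  then show "v = w" by simp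
qed (use assms in simp)

lemma metric_mat_in_tangent:
  assumes g: "riemannian_metric g" and x: "x \<in> S2" and z: "z \<in> tangent_space x"
  shows "metric_mat g 1 x *v z \<in> tangent_space x"
  using metric_mat_sym[OF g x, of x 1 z] metric_mat_normal[OF g x, of 1] z
  by (simp add: tangent_space_def inner_commute)

text \<open>Every covector is the pairing with some tangent vector M z, and \<open>z\<close> is its
  sharp. The squared dual norm of the covector is then z \<bullet> M z, and its round norm is |M
  z|.\<close>

lemma unit_covector_norms_eq:
  assumes g: "riemannian_metric g"
  shows "unit_covector_norms g = {norm (metric_mat g 1 x *v z) | x z. x \<in> S2 \<and> z \<in> tangent_space x \<and> z \<bullet> (metric_mat g 1 x *v z) = 1}"
    (is "_ = ?B")
proof -
  have key: "dual_metric g x (\<lambda>u. (metric_mat g 1 x *v z) \<bullet> u) (\<lambda>u. (metric_mat g 1 x *v z) \<bullet> u) = z \<bullet> (metric_mat g 1 x *v z)"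
    "sqrt (dual_metric round_metric x (\<lambda>u. (metric_mat g 1 x *v z) \<bullet> u) (\<lambda>u. (metric_mat g 1 x *v z) \<bullet> u)) = norm (metric_mat g 1 x *v z)"
    if "x \<in> S2" "z \<in> tangent_space x" for x z
    using that metric_mat_tangent[OF g that(1,2,2), of 1]
    by (simp_all add: dual_metric_def sharp_eq[OF g] sharp_round_metric[OF metric_mat_in_tangent[OF g]] round_metric_def norm_eq_sqrt_inner)
  show ?thesis
  proof (intro set_eqI iffI)
    fix n assume "n \<in> unit_covector_norms g"
    then obtain x \<nu> where n: "n = sqrt (dual_metric round_metric x \<nu> \<nu>)" and x: "x \<in> S2"
      and \<nu>: "\<nu> \<in> cotangent_space x" "dual_metric g x \<nu> \<nu> = 1"
      unfolding unit_covector_norms_def by blast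
    obtain w where w: "w \<in> tangent_space x" "\<nu> = (\<lambda>u. w \<bullet> u)" using cotangent_representation[OF \<nu>(1)] .
    obtain z where z: "z \<in> tangent_space x" "metric_mat g 1 x *v z = w" using metric_mat_solve[OF g x w(1)] .
    have "n = norm (metric_mat g 1 x *v z)" using key(2)[OF x z(1)] n by (simp add: w(2) z(2))
    moreover have "z \<bullet> (metric_mat g 1 x *v z) = 1" using key(1)[OF x z(1)] \<nu>(2) by (simp add: w(2) z(2))
    ultimately show "n \<in> ?B" using x z(1) by blast
  next
    fix n assume "n \<in> ?B"
    then obtain x z where n: "n = norm (metric_mat g 1 x *v z)" and x: "x \<in> S2" and z: "z \<in> tangent_space x" "z \<bullet> (metric_mat g 1 x *v z) = 1"
      by blast
    have "(\<lambda>u. (metric_mat g 1 x *v z) \<bullet> u) \<in> cotangent_space x"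
      using metric_mat_in_tangent[OF g x z(1)]
      by (auto simp: cotangent_space_def tangent_space_def intro!: linearI inner_add_right)
    then show "n \<in> unit_covector_norms g"
      unfolding unit_covector_norms_def using key[OF x z(1)] n x z(2) by force
  qed
qed

text \<open>This gives the supremum in \<open>R_max\<close> its meaning. For w = M z, Cauchy-Schwarz
  for the form gives |w|^4 \<le> (w \<bullet> M w)(z \<bullet> M z) = w \<bullet> M w, which is at
  most a constant times |w|^2.\<close>

lemma bdd_above_unit_covector_norms:
  assumes g: "riemannian_metric g"
  shows "bdd_above (unit_covector_norms g)"
proof -
  let ?A = "metric_mat g 1"
  obtain B where B: "B > 0" "\<And>(A::real^3^3) (v::real^3). norm (A *v v) \<le> norm A * norm v * B"
    using bounded_bilinear.pos_bounded[OF bounded_bilinear_matrix_vector_mult] by blast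
  have "continuous_on S2 ?A"
    by (rule continuous_on_subset[OF smooth_on_imp_continuous_on[OF smooth_metric_mat[OF g]]]) auto
  then obtain C where C: "\<And>x. x \<in> S2 \<Longrightarrow> norm (?A x) \<le> C"
    using compact_imp_bounded[OF compact_continuous_image[OF _ compact_sphere]] by (force simp: bounded_iff)
  \<comment> \<open>The estimate bounds the squared norm; the maximum with 1 covers the passage to
    the norm itself.\<close>
  have "norm (?A x *v z) \<le> max 1 (C * B)" if x: "x \<in> S2" and z: "z \<bullet> (?A x *v z) = 1" for x z
  proof (cases "norm (?A x *v z) = 0")
    case False
    let ?w = "?A x *v z"
    have "norm (?A x *v ?w) \<le> norm (?A x) * norm ?w * B" by (rule B)
    also have "\<dots> \<le> C * norm ?w * B" using C[OF x] B by (intro mult_right_mono) auto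
    finally have n: "norm (?A x *v ?w) \<le> (C * B) * norm ?w" by (simp add: mult_ac)
    have "(norm ?w)\<^sup>2 * (norm ?w)\<^sup>2 = (?w \<bullet> (?A x *v z))\<^sup>2" by (simp add: dot_square_norm power2_eq_square)
    also have "\<dots> \<le> (?w \<bullet> (?A x *v ?w)) * (z \<bullet> (?A x *v z))"
      by (rule metric_mat_Cauchy_Schwarz[OF g x zero_less_one])
    also have "\<dots> \<le> norm ?w * norm (?A x *v ?w)" using z by (simp add: norm_cauchy_schwarz)
    also have "\<dots> \<le> norm ?w * ((C * B) * norm ?w)" by (intro mult_left_mono n) auto
    finally have "(norm ?w)\<^sup>2 * (norm ?w)\<^sup>2 \<le> (norm ?w)\<^sup>2 * (C * B)" by (simp only: power2_eq_square mult_ac)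
    then have n2: "(norm ?w)\<^sup>2 \<le> C * B" by (rule mult_left_le_imp_le) (use False in simp)
    show ?thesis
    proof (cases "norm ?w \<le> 1")
      case False
      then have "norm ?w \<le> (norm ?w)\<^sup>2" by (intro self_le_power) auto
      with n2 show ?thesis by linarith
    qed simp
  qed simp
  then show ?thesis unfolding unit_covector_norms_eq[OF g] by (intro bdd_aboveI[of _ "max 1 (C * B)"]) blast
qed

lemma normalized_tangent:
  assumes g: "riemannian_metric g" and x: "x \<in> S2" and u: "u \<in> tangent_space x" "u \<noteq> 0"
  defines "q \<equiv> u \<bullet> (metric_mat g 1 x *v u)"
  shows "q > 0" "norm (metric_mat g 1 x *v u) / sqrt q \<in> unit_covector_norms g"
proof -
  show q: "q > 0" unfolding q_def by (rule metric_mat_pos[OF g x zero_less_one u(2)])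
  let ?z = "(1 / sqrt q) *\<^sub>R u"
  have "?z \<in> tangent_space x" using u by (simp add: tangent_space_def)
  moreover have "?z \<bullet> (metric_mat g 1 x *v ?z) = (1 / sqrt q) * ((1 / sqrt q) * q)"
    by (simp add: matrix_vector_mult_scaleR q_def)
  then have "?z \<bullet> (metric_mat g 1 x *v ?z) = 1" using q by (simp add: field_simps)
  moreover have "norm (metric_mat g 1 x *v ?z) = norm (metric_mat g 1 x *v u) / sqrt q"
    using q by (simp add: matrix_vector_mult_scaleR)
  ultimately show "norm (metric_mat g 1 x *v u) / sqrt q \<in> unit_covector_norms g"
    unfolding unit_covector_norms_eq[OF g] using x by (metis (mono_tags, lifting) mem_Collect_eq)
qed

text \<open>Euclidean Cauchy-Schwarz gives g(u, u) \<le> |u| |M u|, and |M u| is at most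
  \<open>R_max g\<close> times the square root of g(u, u); one such root cancels.\<close>

lemma metric_upper_bound:
  assumes g: "riemannian_metric g" and x: "x \<in> S2" and u: "u \<in> tangent_space x"
  shows "g x u u \<le> (R_max g)\<^sup>2 * (u \<bullet> u)"
proof (cases "u = 0")
  case True
  then show ?thesis using metric_mat_tangent[OF g x u u, of 1] by simp
next
  case False
  define q where "q = u \<bullet> (metric_mat g 1 x *v u)"
  have q: "q > 0" and m: "norm (metric_mat g 1 x *v u) / sqrt q \<in> unit_covector_norms g"
    using normalized_tangent[OF g x u False] by (simp_all add: q_def)
  have "norm (metric_mat g 1 x *v u) / sqrt q \<le> R_max g"
    unfolding R_max_def by (rule cSup_upper[OF m bdd_above_unit_covector_norms[OF g]])
  then have n: "norm (metric_mat g 1 x *v u) \<le> R_max g * sqrt q" using q by (simp add: divide_le_eq)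
  have "sqrt q * sqrt q = q" using q by simp
  also have "q \<le> norm u * norm (metric_mat g 1 x *v u)" unfolding q_def by (rule norm_cauchy_schwarz)
  also have "\<dots> \<le> norm u * (R_max g * sqrt q)" by (intro mult_left_mono n) auto
  finally have "sqrt q * sqrt q \<le> (norm u * R_max g) * sqrt q" by (simp only: mult.assoc)
  then have "sqrt q \<le> norm u * R_max g" by (rule mult_right_le_imp_le) (use q in simp)
  then have "(sqrt q)\<^sup>2 \<le> (norm u * R_max g)\<^sup>2" using q by (intro power_mono) auto
  then show ?thesis
    using q metric_mat_tangent[OF g x u u, of 1] by (simp add: q_def power_mult_distrib power2_norm_eq_inner mult.commute)
qed

lemma unit_covector_norms_nonneg: "n \<in> unit_covector_norms g \<Longrightarrow> riemannian_metric g \<Longrightarrow> 0 \<le> n"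
  using unit_covector_norms_eq by auto

text \<open>Dual to the upper bound. With M z = u the definition of \<open>r_min\<close> gives r^2
  (z \<bullet> u) \<le> u \<bullet> u, and Cauchy-Schwarz for the form gives (u \<bullet> u)^2 \<le>
  g(u, u) (z \<bullet> u); together they eliminate z \<bullet> u.\<close>

lemma metric_lower_bound:
  assumes g: "riemannian_metric g" and x: "x \<in> S2" and u: "u \<in> tangent_space x" and r: "0 \<le> r_min g"
  shows "(r_min g)\<^sup>2 * (u \<bullet> u) \<le> g x u u"
proof (cases "u = 0")
  case True
  then show ?thesis using metric_mat_tangent[OF g x u u, of 1] by simp
next
  case False
  let ?A = "metric_mat g 1 x"
  obtain z where z: "z \<in> tangent_space x" "?A *v z = u" using metric_mat_solve[OF g x u] .
  have z0: "z \<noteq> 0" using z False by auto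
  define q where "q = z \<bullet> u"
  have q: "q > 0" and m: "norm u / sqrt q \<in> unit_covector_norms g"
    using normalized_tangent[OF g x z(1) z0] by (simp_all add: q_def z(2))
  have "r_min g \<le> norm u / sqrt q"
    unfolding r_min_def
    by (rule cInf_lower[OF m]) (intro bdd_belowI[of _ 0] unit_covector_norms_nonneg[OF _ g])
  then have "r_min g * sqrt q \<le> norm u" using q by (simp add: le_divide_eq)
  then have "(r_min g * sqrt q)\<^sup>2 \<le> (norm u)\<^sup>2" using r q by (intro power_mono) auto
  then have rq: "(r_min g)\<^sup>2 * q \<le> u \<bullet> u" using q by (simp add: power_mult_distrib power2_norm_eq_inner)
  have gu: "g x u u = u \<bullet> (?A *v u)" by (rule metric_mat_tangent[OF g x u u])
  have pos: "u \<bullet> (?A *v u) > 0" by (rule metric_mat_pos[OF g x zero_less_one False])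
  have uu: "u \<bullet> u > 0" using False by simp
  have "(u \<bullet> u) * (u \<bullet> u) = (u \<bullet> (?A *v z))\<^sup>2" by (simp add: z(2) power2_eq_square)
  also have "\<dots> \<le> (u \<bullet> (?A *v u)) * (z \<bullet> (?A *v z))" by (rule metric_mat_Cauchy_Schwarz[OF g x zero_less_one])
  finally have "(u \<bullet> u) * (u \<bullet> u) \<le> (u \<bullet> (?A *v u)) * q" by (simp add: q_def z(2))
  then have "(r_min g)\<^sup>2 * ((u \<bullet> u) * (u \<bullet> u)) \<le> (r_min g)\<^sup>2 * ((u \<bullet> (?A *v u)) * q)" by (intro mult_left_mono) auto
  also have "\<dots> = (u \<bullet> (?A *v u)) * ((r_min g)\<^sup>2 * q)" by simp
  also have "\<dots> \<le> (u \<bullet> (?A *v u)) * (u \<bullet> u)" using pos by (intro mult_left_mono rq) auto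
  finally have "(u \<bullet> u) * ((r_min g)\<^sup>2 * (u \<bullet> u)) \<le> (u \<bullet> u) * (u \<bullet> (?A *v u))" by (simp add: mult_ac)
  then show ?thesis using uu by (simp add: gu)
qed

lemma ex_tangent: "\<exists>x\<in>S2. \<exists>u\<in>tangent_space x. u \<bullet> u = 1"
proof -
  have "axis 1 1 \<in> S2" "axis 2 1 \<in> tangent_space (axis 1 1)" "axis 2 1 \<bullet> axis 2 (1::real) = (1::real)"
    by (simp_all add: tangent_space_def inner_axis_axis)
  then show ?thesis by blast
qed

text \<open>Positivity of \<open>r_min g\<close> comes from the balance condition with \<beta> > 0
  and not from compactness: a zero numerator or denominator would make the quotient 0.\<close>

lemma balanced_bounds:
  assumes g: "riemannian_metric g" and \<beta>: "0 < \<beta>" and bal: "fiberwise_balanced \<beta> g"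
  shows "0 < r_min g" "\<beta> * (R_max g)\<^sup>2 \<le> (r_min g)\<^sup>2" "(r_min g)\<^sup>2 \<le> (R_max g)\<^sup>2"
proof -
  obtain x u where xu: "x \<in> S2" "u \<in> tangent_space x" "u \<bullet> u = 1" using ex_tangent by blast
  then have "u \<noteq> 0" by auto
  then have "unit_covector_norms g \<noteq> {}" using normalized_tangent(2)[OF g xu(1,2)] by blast
  then have r0: "0 \<le> r_min g"
    unfolding r_min_def by (intro cInf_greatest unit_covector_norms_nonneg[OF _ g])
  have b: "\<beta> \<le> (r_min g / R_max g)\<^sup>2" using bal by (simp add: fiberwise_balanced_def)
  then have nz: "r_min g \<noteq> 0" "R_max g \<noteq> 0" using \<beta> by auto
  show "0 < r_min g" using r0 nz by simp
  have "(R_max g)\<^sup>2 > 0" using nz by simp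
  then show "\<beta> * (R_max g)\<^sup>2 \<le> (r_min g)\<^sup>2" using b by (simp add: power_divide le_divide_eq)
  show "(r_min g)\<^sup>2 \<le> (R_max g)\<^sup>2"
    using metric_lower_bound[OF g xu(1,2) r0] metric_upper_bound[OF g xu(1,2)] xu(3) by simp
qed

text \<open>The normal weight \<open>(r_min g)\<^sup>2\<close> lies between the two bounds for the
  tangential part, so both bounds persist on three-space.\<close>

lemma metric_matrix_metric_mat:
  assumes g: "riemannian_metric g" and \<beta>: "0 < \<beta>" and bal: "fiberwise_balanced \<beta> g"
  shows "metric_matrix (metric_mat g ((r_min g)\<^sup>2)) (r_min g) (R_max g)"
proof
  note b = balanced_bounds[OF assms]
  show "smooth_on (-{0}) (metric_mat g ((r_min g)\<^sup>2))" by (rule smooth_metric_mat[OF g])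
  show "0 < r_min g" by (rule b)
  show "metric_mat g ((r_min g)\<^sup>2) (s *\<^sub>R x) = metric_mat g ((r_min g)\<^sup>2) x" if "0 < s" for s x
    using that by (simp add: metric_mat_def sgn_scaleR sgn_pos)
  fix x u :: "real^3" assume x: "x \<in> S2"
  show "metric_mat g ((r_min g)\<^sup>2) x *v x = (r_min g)\<^sup>2 *\<^sub>R x" by (rule metric_mat_normal[OF g x])
  show "u \<bullet> (metric_mat g ((r_min g)\<^sup>2) x *v w) = w \<bullet> (metric_mat g ((r_min g)\<^sup>2) x *v u)" for w
    by (rule metric_mat_sym[OF g x])
  let ?p = "tangent_proj x u"
  have xx: "x \<bullet> x = 1" using x by (simp add: dot_square_norm)
  have uu: "u \<bullet> u = ?p \<bullet> ?p + (u \<bullet> x) * (u \<bullet> x)"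
    by (simp add: tangent_proj_def inner_diff inner_commute xx algebra_simps)
  have f: "u \<bullet> (metric_mat g ((r_min g)\<^sup>2) x *v u) = g x ?p ?p + (r_min g)\<^sup>2 * ((u \<bullet> x) * (u \<bullet> x))"
    by (simp add: metric_mat_form[OF g x] mult.assoc)
  show "(r_min g)\<^sup>2 * (u \<bullet> u) \<le> u \<bullet> (metric_mat g ((r_min g)\<^sup>2) x *v u)"
    unfolding f uu distrib_left using metric_lower_bound[OF g x tangent_proj_in[OF x]] b(1) by simp
  show "u \<bullet> (metric_mat g ((r_min g)\<^sup>2) x *v u) \<le> (R_max g)\<^sup>2 * (u \<bullet> u)"
    unfolding f uu distrib_left
    by (intro add_mono metric_upper_bound[OF g x tangent_proj_in[OF x]] mult_right_mono b(3)) simp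
qed

section \<open>Area\<close>

lemma spherical_coords_has_derivative:
  "(spherical_coords has_derivative (\<lambda>h.
      (cos (x $ 1) * h $ 1 * cos (x $ 2) - sin (x $ 1) * sin (x $ 2) * h $ 2) *\<^sub>R axis 1 1 +
      (cos (x $ 1) * h $ 1 * sin (x $ 2) + sin (x $ 1) * cos (x $ 2) * h $ 2) *\<^sub>R axis 2 1 +
      (- sin (x $ 1) * h $ 1) *\<^sub>R axis 3 1)) (at x)"
proof -
  have eq: "spherical_coords = (\<lambda>x. (sin (x $ 1) * cos (x $ 2)) *\<^sub>R axis 1 1 +
      (sin (x $ 1) * sin (x $ 2)) *\<^sub>R axis 2 1 + cos (x $ 1) *\<^sub>R axis 3 1)"
    by (simp add: fun_eq_iff spherical_coords_def vec_eq_iff forall_3 vector_3 axis_def)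
  have c: "((\<lambda>x::real^2. x $ i) has_derivative (\<lambda>h. h $ i)) (at x)" for i
    by (rule bounded_linear_imp_has_derivative[OF bounded_linear_vec_nth])
  show ?thesis
    unfolding eq
    by (rule derivative_eq_intros c refl)+ (simp add: fun_eq_iff vec_eq_iff forall_3 axis_def algebra_simps)
qed

lemma partial_spherical_coords:
  "partial 1 spherical_coords x = vector [cos (x $ 1) * cos (x $ 2), cos (x $ 1) * sin (x $ 2), - sin (x $ 1)]"
  "partial 2 spherical_coords x = vector [- sin (x $ 1) * sin (x $ 2), sin (x $ 1) * cos (x $ 2), 0]"
  unfolding partial_def frechet_derivative_at[OF spherical_coords_has_derivative, symmetric]
  by (simp_all add: vec_eq_iff forall_3 vector_3 axis_def)

lemma spherical_coords_inner:
  "spherical_coords x \<bullet> spherical_coords x = 1"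
  "partial 1 spherical_coords x \<bullet> spherical_coords x = 0"
  "partial 2 spherical_coords x \<bullet> spherical_coords x = 0"
  "partial 1 spherical_coords x \<bullet> partial 1 spherical_coords x = 1"
  "partial 2 spherical_coords x \<bullet> partial 2 spherical_coords x = (sin (x $ 1))\<^sup>2"
  "partial 1 spherical_coords x \<bullet> partial 2 spherical_coords x = 0"
proof -
  have sc: "(sin a)\<^sup>2 = 1 - (cos a)\<^sup>2" for a :: real by (simp add: sin_squared_eq)
  note defs = partial_spherical_coords spherical_coords_def inner_real3 vector_3
  show "spherical_coords x \<bullet> spherical_coords x = 1"
    unfolding defs using sc[of "x $ 1"] sc[of "x $ 2"] by algebra
  show "partial 1 spherical_coords x \<bullet> spherical_coords x = 0"
    unfolding defs using sc[of "x $ 1"] sc[of "x $ 2"] by algebra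
  show "partial 2 spherical_coords x \<bullet> spherical_coords x = 0"
    unfolding defs by (simp add: algebra_simps)
  show "partial 1 spherical_coords x \<bullet> partial 1 spherical_coords x = 1"
    unfolding defs using sc[of "x $ 1"] sc[of "x $ 2"] by algebra
  show "partial 2 spherical_coords x \<bullet> partial 2 spherical_coords x = (sin (x $ 1))\<^sup>2"
    unfolding defs using sc[of "x $ 1"] sc[of "x $ 2"] by algebra
  show "partial 1 spherical_coords x \<bullet> partial 2 spherical_coords x = 0"
    unfolding defs by (simp add: algebra_simps)
qed

text \<open>Monotonicity of determinants: the form dominates \<rho> diag(1, s^2), the difference is
  positive semidefinite, and adding it to the diagonal form cannot lower the determinant.\<close>

lemma gram_lower_bound:
  fixes a b d \<rho> s :: real
  assumes "0 \<le> \<rho>" and pos: "\<And>l m. \<rho> * (l\<^sup>2 + m\<^sup>2 * s\<^sup>2) \<le> l\<^sup>2 * a + 2 * l * m * b + m\<^sup>2 * d"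
  shows "(\<rho> * s)\<^sup>2 \<le> a * d - b\<^sup>2"
proof -
  define a' d' where "a' = a - \<rho>" and "d' = d - \<rho> * s\<^sup>2"
  have a': "a' \<ge> 0" using pos[of 1 0] by (simp add: a'_def)
  have d': "d' \<ge> 0" using pos[of 0 1] by (simp add: d'_def)
  have q: "0 \<le> l\<^sup>2 * a' + 2 * l * m * b + m\<^sup>2 * d'" for l m
    using pos[of l m] by (simp add: a'_def d'_def algebra_simps)
  have "b\<^sup>2 \<le> a' * d'"
  proof (cases "a' = 0")
    case True
    have "0 \<le> 2 * l * b + d'" for l using q[of l 1] True by simp
    have "b = 0"
    proof (rule ccontr)
      assume "b \<noteq> 0"
      \<comment> \<open>At this \<open>l\<close> the affine function \<open>2 * l * b + d'\<close>
        would take the value -1.\<close>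
      then have "2 * (- (d' + 1) / (2 * b)) * b = - (d' + 1)" by simp
      then show False using \<open>\<And>l. 0 \<le> 2 * l * b + d'\<close>[of "- (d' + 1) / (2 * b)"] by linarith
    qed
    then show ?thesis using True by simp
  next
    case False
    \<comment> \<open>The choice l = -b, m = a' turns the form into \<open>a'\<close> times its
      determinant.\<close>
    have "0 \<le> a' * (a' * d' - b\<^sup>2)" using q[of "- b" a'] by (simp add: power2_eq_square algebra_simps)
    then show ?thesis using False a' by (simp add: zero_le_mult_iff)
  qed
  moreover have "a * d - b\<^sup>2 = (a' * d' - b\<^sup>2) + \<rho> * d' + \<rho> * s\<^sup>2 * a' + (\<rho> * s)\<^sup>2"
    by (simp add: a'_def d'_def power2_eq_square algebra_simps)
  moreover have "0 \<le> \<rho> * d'" "0 \<le> \<rho> * s\<^sup>2 * a'" using assms(1) a' d' by auto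
  ultimately show ?thesis by linarith
qed

lemma area_density_lower_bound:
  assumes g: "riemannian_metric g" and r: "0 \<le> r_min g" and s: "0 \<le> sin (x $ 1)"
  shows "(r_min g)\<^sup>2 * sin (x $ 1) \<le> area_density g (spherical_coords x) (partial 1 spherical_coords x) (partial 2 spherical_coords x)"
proof -
  let ?p = "spherical_coords x" and ?u = "partial 1 spherical_coords x" and ?v = "partial 2 spherical_coords x"
  have p: "?p \<in> S2" using spherical_coords_inner(1)[of x] by (simp add: norm_eq_sqrt_inner)
  have uv: "?u \<in> tangent_space ?p" "?v \<in> tangent_space ?p"
    using spherical_coords_inner(2,3) by (auto simp: tangent_space_def)
  let ?A = "metric_mat g 1 ?p"
  have gA: "g ?p w z = w \<bullet> (?A *v z)" if "w \<in> tangent_space ?p" "z \<in> tangent_space ?p" for w z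
    by (rule metric_mat_tangent[OF g p that])
  have "((r_min g)\<^sup>2 * sin (x $ 1))\<^sup>2 \<le> g ?p ?u ?u * g ?p ?v ?v - (g ?p ?u ?v)\<^sup>2"
  proof (rule gram_lower_bound)
    fix l m
    let ?w = "l *\<^sub>R ?u + m *\<^sub>R ?v"
    have w: "?w \<in> tangent_space ?p" by (rule tangent_space_add[OF uv])
    have "(r_min g)\<^sup>2 * (?w \<bullet> ?w) \<le> g ?p ?w ?w" by (rule metric_lower_bound[OF g p w r])
    moreover have "?w \<bullet> ?w = l\<^sup>2 + m\<^sup>2 * (sin (x $ 1))\<^sup>2"
      using spherical_coords_inner[of x] by (simp add: inner_add inner_commute[of ?v ?u] power2_eq_square)
    moreover have "g ?p ?w ?w = l\<^sup>2 * g ?p ?u ?u + 2 * l * m * g ?p ?u ?v + m\<^sup>2 * g ?p ?v ?v"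
      unfolding gA[OF w w] gA[OF uv(1,1)] gA[OF uv] gA[OF uv(2,2)]
      using metric_mat_sym[OF g p, of ?v 1 ?u]
      by (simp add: inner_add matrix_vector_right_distrib matrix_vector_mult_scaleR power2_eq_square algebra_simps)
    ultimately show "(r_min g)\<^sup>2 * (l\<^sup>2 + m\<^sup>2 * (sin (x $ 1))\<^sup>2) \<le>
        l\<^sup>2 * g ?p ?u ?u + 2 * l * m * g ?p ?u ?v + m\<^sup>2 * g ?p ?v ?v" by simp
  qed simp
  then show ?thesis unfolding area_density_def by (intro real_le_rsqrt)
qed

lemma nn_integral_sphere:
  "(\<integral>\<^sup>+x\<in>box 0 (vector [pi, 2 * pi]). ennreal (sin (x $ 1)) \<partial>(lborel :: (real^2) measure)) = ennreal (4 * pi)"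
proof -
  \<comment> \<open>The colatitude interval is closed to suit the fundamental theorem of calculus;
    its endpoints contribute nothing since the sine vanishes there.\<close>
  define f :: "real^2 \<Rightarrow> real \<Rightarrow> ennreal" where
    "f b s = (if b = axis 1 1 then ennreal (sin s) * indicator {0..pi} s else indicator {0<..<2 * pi} s)" for b s
  have B: "(Basis :: (real^2) set) = {axis 1 1, axis 2 1}" and ne: "axis 1 1 \<noteq> (axis 2 1 :: real^2)"
    by (auto simp: Basis_vec_def axis_eq_axis) (metis exhaust_2)
  have eq: "ennreal (sin (x $ 1)) * indicator (box 0 (vector [pi, 2 * pi])) x = (\<Prod>b\<in>Basis. f b (x \<bullet> b))" for x :: "real^2"
  proof -
    have "(\<Prod>b\<in>Basis. f b (x \<bullet> b)) = (ennreal (sin (x $ 1)) * indicator {0..pi} (x $ 1)) * indicator {0<..<2 * pi} (x $ 2)"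
      using ne by (simp add: B f_def inner_axis)
    moreover have "x \<in> box 0 (vector [pi, 2 * pi]) \<longleftrightarrow> 0 < x $ 1 \<and> x $ 1 < pi \<and> 0 < x $ 2 \<and> x $ 2 < 2 * pi"
      by (auto simp: mem_box B inner_axis vector_2)
    moreover have "x $ 1 = 0 \<or> x $ 1 = pi \<Longrightarrow> sin (x $ 1) = 0" by auto
    ultimately show ?thesis by (auto simp: indicator_def)
  qed
  have 1: "(\<integral>\<^sup>+s. ennreal (sin s) * indicator {0..pi} s \<partial>lborel) = ennreal (- cos pi - - cos 0)"
    by (rule nn_integral_FTC_Icc) (auto intro!: derivative_eq_intros sin_ge_zero)
  have 2: "(\<integral>\<^sup>+s. indicator {0<..<2 * pi} s \<partial>lborel) = ennreal (2 * pi)"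
    by (simp add: nn_integral_indicator)
  have "(\<integral>\<^sup>+x. (\<Prod>b\<in>Basis. f b (x \<bullet> b)) \<partial>lborel) = (\<Prod>b\<in>Basis. \<integral>\<^sup>+s. f b s \<partial>lborel)"
    by (rule nn_integral_lborel_prod) (auto simp: f_def)
  also have "\<dots> = (\<integral>\<^sup>+s. ennreal (sin s) * indicator {0..pi} s \<partial>lborel) * (\<integral>\<^sup>+s. indicator {0<..<2 * pi} s \<partial>lborel)"
    using ne by (simp add: B f_def)
  also have "\<dots> = ennreal 2 * ennreal (2 * pi)" unfolding 1 2 by simp
  also have "\<dots> = ennreal (2 * (2 * pi))" by (rule ennreal_mult[symmetric]) auto
  also have "2 * (2 * pi) = 4 * pi" by simp
  finally show ?thesis by (simp add: eq)
qed

lemma area_lower_bound: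
  assumes g: "riemannian_metric g" and r: "0 \<le> r_min g"
  shows "ennreal (4 * pi * (r_min g)\<^sup>2) \<le> area g"
proof -
  have "ennreal (4 * pi * (r_min g)\<^sup>2) = ennreal ((r_min g)\<^sup>2) * ennreal (4 * pi)"
    by (simp add: ennreal_mult[symmetric] mult.commute)
  also have "\<dots> = (\<integral>\<^sup>+x. ennreal ((r_min g)\<^sup>2) * (ennreal (sin (x $ 1)) * indicator (box 0 (vector [pi, 2 * pi])) x) \<partial>(lborel :: (real^2) measure))"
    unfolding nn_integral_sphere[symmetric] by (rule nn_integral_cmult[symmetric]) measurable
  also have "\<dots> \<le> area g"
    unfolding area_def
  proof (rule nn_integral_mono)
    fix x :: "real^2"
    show "ennreal ((r_min g)\<^sup>2) * (ennreal (sin (x $ 1)) * indicator (box 0 (vector [pi, 2 * pi])) x) \<le>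
      ennreal (area_density g (spherical_coords x) (partial 1 spherical_coords x) (partial 2 spherical_coords x)) *
      indicator (box 0 (vector [pi, 2 * pi])) x"
    proof (cases "x \<in> box 0 (vector [pi, 2 * pi])")
      case True
      then have "0 < x $ 1" "x $ 1 < pi" using mem_box_cart(1)[of x 0 "vector [pi, 2 * pi]"] by (auto simp: forall_2 vector_2)
      then have s: "0 \<le> sin (x $ 1)" by (intro sin_ge_zero) auto
      show ?thesis
        using area_density_lower_bound[OF g r s] s True by (simp add: ennreal_mult[symmetric] ennreal_leI)
    qed simp
  qed
  finally show ?thesis .
qed

theorem theorem3p1:
  fixes \<beta> :: real and g :: metric_tensor
  assumes "0 < \<beta>" and "\<beta> \<le> 1"
    and "riemannian_metric g"
    and "fiberwise_balanced \<beta> g"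
  shows "(L_min g)\<^sup>2 \<le> ennreal (pi / \<beta>) * area g"
proof -
  note g = assms(3) and b = balanced_bounds[OF assms(3,1,4)]
  define M where "M = metric_mat g ((r_min g)\<^sup>2)"
  interpret metric_matrix M "r_min g" "R_max g"
    unfolding M_def by (rule metric_matrix_metric_mat[OF g assms(1,4)])
  obtain c v where c: "\<forall>t. c t \<in> S2" "\<forall>t. c (t + 1) = c t"
    "\<forall>t. (c has_vector_derivative v t) (at t)"
    "\<forall>t. ((\<lambda>t. M (c t) *v v t) has_vector_derivative
      force (c t) (v t) - (v t \<bullet> (M (c t) *v v t)) *\<^sub>R c t) (at t)"
    and up: "\<exists>t. v t \<bullet> (M (c t) *v v t) \<le> 4 * pi\<^sup>2 * (R_max g)\<^sup>2"
    and low: "\<exists>t. (r_min g)\<^sup>2 / 16 \<le> v t \<bullet> (M (c t) *v v t)"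
    using ex_limit_geodesic by blast
  interpret limit_geodesic M "r_min g" "R_max g" c v
    by unfold_locales (use c in blast)+
  have gM: "g p u w = u \<bullet> (M p *v w)" if "p \<in> S2" "u \<in> tangent_space p" "w \<in> tangent_space p" for p u w
    unfolding M_def by (rule metric_mat_tangent[OF g that])
  define e where "e = v 0 \<bullet> (M (c 0) *v v 0)"
  have e: "v t \<bullet> (M (c t) *v v t) = e" for t unfolding e_def by (rule energy_constant)
  have e1: "e \<le> 4 * pi\<^sup>2 * (R_max g)\<^sup>2" and e2: "(r_min g)\<^sup>2 / 16 \<le> e" using up low by (auto simp: e)
  have e0: "e > 0" using e2 b(1) by (smt (verit) divide_pos_pos zero_less_power)
  have vel: "velocity c t = v t" for t unfolding velocity_def by (rule vector_derivative_at[OF c_deriv])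
  \<comment> \<open>A constant curve would have zero velocity, against the lower bound on the
    energy.\<close>
  have "\<not> c constant_on UNIV"
  proof
    assume "c constant_on UNIV"
    then obtain a where "c = (\<lambda>t. a)" unfolding constant_on_def by blast
    then have "((\<lambda>t. a) has_vector_derivative v 0) (at 0)" using c_deriv[of 0] by simp
    from vector_derivative_unique_at[OF this has_vector_derivative_const] have "v 0 = 0" .
    then show False using e0 by (simp add: e_def)
  qed
  then have cg: "closed_geodesic g c 1"
    unfolding closed_geodesic_def using geodesic_curve[OF gM] c(2) by simp
  have vt: "v t \<in> tangent_space (c t)" for t using v_tangent by (simp add: tangent_space_def)
  \<comment> \<open>The energy is constant, so the speed is \<open>sqrt e\<close> throughout a
    period of length 1.\<close>
  have len: "curve_length g c 1 = sqrt e"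
    unfolding curve_length_def vel gM[OF c_S2 vt vt] e by simp
  have "L_min g \<le> ennreal (sqrt e)"
    unfolding L_min_def by (rule Inf_lower) (use cg len in force)
  then have "(L_min g)\<^sup>2 \<le> (ennreal (sqrt e))\<^sup>2" by (rule power_mono) simp
  also have "\<dots> = ennreal e" using e0 by (simp add: ennreal_power)
  also have "\<dots> \<le> ennreal (pi / \<beta> * (4 * pi * (r_min g)\<^sup>2))"
  proof (rule ennreal_leI)
    \<comment> \<open>Balance trades R^2 for r^2 / \<beta>; once 4 \<pi> r^2 is split off for the
      area, the factor \<pi> / \<beta> remains.\<close>
    have "e \<le> 4 * pi\<^sup>2 / \<beta> * (\<beta> * (R_max g)\<^sup>2)" using e1 assms(1) by simp
    also have "\<dots> \<le> 4 * pi\<^sup>2 / \<beta> * (r_min g)\<^sup>2" using b(2) assms(1) by (intro mult_left_mono) auto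
    finally show "e \<le> pi / \<beta> * (4 * pi * (r_min g)\<^sup>2)" by (simp add: power2_eq_square mult_ac)
  qed
  also have "\<dots> = ennreal (pi / \<beta>) * ennreal (4 * pi * (r_min g)\<^sup>2)"
    using assms(1) by (intro ennreal_mult) auto
  also have "\<dots> \<le> ennreal (pi / \<beta>) * area g"
    using b(1) by (intro mult_left_mono area_lower_bound[OF g]) auto
  finally show ?thesis .
qed

end
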